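(* Let $\{c_n\}_{n\in\mathbb N}\subset\mathbb C\setminus\{0\}$ and let $\{t_n\}_{n\in\mathbb N}\subset\mathbb C$ be pairwise distinct with $|t_n|\to\infty$, such that $$f(z)=\sum_{n=1}^{\infty}\frac{c_n}{(z-t_n)^2},\qquad \sum_{n=1}^{\infty}\frac{|c_n|}{|t_n|^2}<\infty .$$ Assume that $f$ has only finitely many zeros. Then there exist an entire function $g$ (whose zeros are simple and are exactly the poles of $f$), a polynomial $P\not\equiv0$, and an entire function $Q$ such that $$f=\frac{P}{g^2},\qquad Pg''-P'g'+Qg=0 .$$ If, in addition, $f$ has finite order, then $Q$ is a polynomial, $$\deg Q\ge\deg P,\qquad \rho_0:=\frac{\deg Q-\deg P+2}{2}\in\left\{1,\tfrac32,2,\tfrac52,\dots\right\};$$ both $f$ and $g$ have order and lower order equal to $\rho_0$, and both are of normal type: $$0<\tau(f)=\sigma(f)<\infty,\qquad 0<\tau(g)=\sigma(g)<\infty .$$ Finally (still for $f$ of finite order), if $P(z)=\prod_{j=1}^{n}(z-p_j)^{\alpha_j}$ with distinct $p_j$, then $$\frac{Q(z)}{P(z)}=S(z)+\sum_{j=1}^{n}\alpha_j\,\frac{g'(p_j)}{g(p_j)}\,\frac1{z-p_j},$$ where $S$ is a polynomial.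
   Context: In the condition $\sum|c_n|/|t_n|^2<\infty$ a possible term with $t_n=0$ is omitted. Under this condition the series for $f$ converges locally uniformly off $\{t_n\}$ and defines a meromorphic function in $\mathbb C$. Order and lower order of a meromorphic $f$ are $\limsup$ and $\liminf$ as $r\to\infty$ of $\log T(r,f)/\log r$, where $T(r,f)$ is the Nevanlinna characteristic; for an entire function one may use $\log M(r,g)$, $M(r,g)=\max_{|z|=r}|g(z)|$, in place of $T$. The type $\sigma$ and lower type $\tau$ with respect to the order $\rho_0$ are: $\sigma(f)=\limsup_{r\to\infty}T(r,f)/r^{\rho_0}$, $\tau(f)=\liminf_{r\to\infty}T(r,f)/r^{\rho_0}$ for the meromorphic function $f$, and $\sigma(g)=\limsup_{r\to\infty}\log M(r,g)/r^{\rho_0}$, $\tau(g)=\liminf_{r\to\infty}\log M(r,g)/r^{\rho_0}$ for the entire function $g$. *)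

theory Defs
  imports "HOL-Complex_Analysis.Complex_Analysis"
begin

section \<open>The Nevanlinna characteristic\<close>

definition pole_count :: "(complex \<Rightarrow> complex) \<Rightarrow> real \<Rightarrow> nat" where
  "pole_count f r = (\<Sum>z | norm z \<le> r \<and> is_pole f z. nat (- zorder f z))"

text \<open>At \<open>s = 0\<close> the integrand is \<open>0 / 0 = 0\<close>; it vanishes near \<open>0\<close> anyway.\<close>

definition nevanlinna_N :: "(complex \<Rightarrow> complex) \<Rightarrow> real \<Rightarrow> real" where
  "nevanlinna_N f r =
     integral {0..r} (\<lambda>s. (real (pole_count f s) - real (pole_count f 0)) / s)
     + real (pole_count f 0) * ln r"

text \<open>\<open>ln (max 1 x)\<close> is \<open>log\<^sup>+ x\<close>. The value of \<open>f\<close> at a pole is arbitrary, but a circle meets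
  only finitely many poles of a meromorphic function.\<close>

definition nevanlinna_m :: "(complex \<Rightarrow> complex) \<Rightarrow> real \<Rightarrow> real" where
  "nevanlinna_m f r =
     integral {0..2 * pi} (\<lambda>\<theta>. ln (max 1 (norm (f (of_real r * cis \<theta>))))) / (2 * pi)"

definition nevanlinna_T :: "(complex \<Rightarrow> complex) \<Rightarrow> real \<Rightarrow> real" where
  "nevanlinna_T f r = nevanlinna_m f r + nevanlinna_N f r"

definition max_modulus :: "(complex \<Rightarrow> complex) \<Rightarrow> real \<Rightarrow> real" where
  "max_modulus g r = (SUP z\<in>sphere 0 r. norm (g z))"


section \<open>Order and type\<close>

definition mero_order :: "(complex \<Rightarrow> complex) \<Rightarrow> ereal" where
  "mero_order f = Limsup at_top (\<lambda>r. ereal (ln (nevanlinna_T f r) / ln r))"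

definition mero_lower_order :: "(complex \<Rightarrow> complex) \<Rightarrow> ereal" where
  "mero_lower_order f = Liminf at_top (\<lambda>r. ereal (ln (nevanlinna_T f r) / ln r))"

definition mero_type :: "real \<Rightarrow> (complex \<Rightarrow> complex) \<Rightarrow> ereal" where
  "mero_type \<rho> f = Limsup at_top (\<lambda>r. ereal (nevanlinna_T f r / r powr \<rho>))"

definition mero_lower_type :: "real \<Rightarrow> (complex \<Rightarrow> complex) \<Rightarrow> ereal" where
  "mero_lower_type \<rho> f = Liminf at_top (\<lambda>r. ereal (nevanlinna_T f r / r powr \<rho>))"

definition entire_type :: "real \<Rightarrow> (complex \<Rightarrow> complex) \<Rightarrow> ereal" where
  "entire_type \<rho> g = Limsup at_top (\<lambda>r. ereal (ln (max_modulus g r) / r powr \<rho>))"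

definition entire_lower_type :: "real \<Rightarrow> (complex \<Rightarrow> complex) \<Rightarrow> ereal" where
  "entire_lower_type \<rho> g = Liminf at_top (\<lambda>r. ereal (ln (max_modulus g r) / r powr \<rho>))"


section \<open>The representation \<open>f = P / g\<^sup>2\<close>\<close>

text \<open>Equality of meromorphic functions is equality off the poles, where the values of \<open>f\<close>
  carry no meaning.\<close>

definition square_representation ::
  "(complex \<Rightarrow> complex) \<Rightarrow> (complex \<Rightarrow> complex) \<Rightarrow> complex poly \<Rightarrow> (complex \<Rightarrow> complex) \<Rightarrow> bool"
where
  "square_representation f g P Q \<longleftrightarrow>
     g holomorphic_on UNIV \<and> Q holomorphic_on UNIV \<and> P \<noteq> 0 \<and>
     {z. g z = 0} = {z. is_pole f z} \<and> (\<forall>z. g z = 0 \<longrightarrow> deriv g z \<noteq> 0) \<and>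
     (\<forall>z. \<not> is_pole f z \<longrightarrow> f z = poly P z / (g z)\<^sup>2) \<and>
     (\<forall>z. poly P z * deriv (deriv g) z - poly (pderiv P) z * deriv g z + Q z * g z = 0)"

end

theory Submission
  imports Defs
begin

text \<open>
  Let \<open>g\<close> have simple zeros exactly at the poles of \<open>f\<close>. As \<open>f\<close> has finitely many zeros, \<open>f = P / g\<^sup>2\<close>
  after multiplying \<open>g\<close> by an exponential, and since all residues of \<open>f\<close> vanish, \<open>P g'' - P' g'\<close> is
  divisible by \<open>g\<close>, which gives \<open>Q\<close>. If \<open>f\<close> has finite order, Jensen's formula bounds the growth of \<open>g\<close>, so
  \<open>g' / g\<close> and \<open>g'' / g\<close>, hence \<open>Q\<close>, are bounded by a power of \<open>r\<close> on suitable circles, and \<open>Q\<close> is a polynomial.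

  With \<open>n = deg Q - deg P + 2\<close> and \<open>z = \<beta> \<zeta>\<^bsup>2/n\<^esup>\<close> for suitable \<open>\<beta>\<close>, each of \<open>n\<close> sectors becomes a half-plane in
  which \<open>G'' = a G' + b G\<close> with \<open>a \<rightarrow> 0\<close>, \<open>b \<rightarrow> 1\<close>. Comparing \<open>\<bar>G' + G\<bar>\<close> with \<open>\<bar>G' - G\<bar>\<close> along lines shows that a
  solution is either dominant or recessive in the whole half-plane. Hence \<open>ln\<^sup>+ \<bar>g\<bar> / r\<^bsup>n/2\<^esup>\<close> converges on almost every
  ray, and dominated convergence gives the asymptotics of the proximity integral; Jensen's formula excludes that
  the limit is zero, and thereby that \<open>g\<close> is recessive in every sector. If \<open>n \<le> 0\<close>, then \<open>g\<close> would be a polynomial.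
  If \<open>n = 1\<close>, there is only one sector, and \<open>g (F - a)\<close>, where \<open>F' = f\<close> and \<open>a\<close> is the limit of \<open>F\<close>
  in its central direction, would be a second entire solution that is recessive everywhere.
\<close>

section \<open>Second-order equations in a half-plane\<close>

text \<open>The half-plane argument needs no asymptotic integration. The functional
  \<open>\<Delta>\<close> compares the two exponential modes quadratically and, far out, is
  nondecreasing in every direction of sufficiently positive real part. Its sign therefore decides
  between growth and decay on a ray, and segments carry it from one ray to another. On a recessive
  ray only an upper bound for |g| results, so ln |g| need not have a limit there; this is why ln+ is
  used. Positivity of its limiting mean rests on |ln x| = 2 ln+ x - ln x: Jensen's formula bounds
  the mean of ln |g| from below, while |ln |g||, truncated at the expected rate
  \<open>\<kappa>\<close>, has a positive limiting mean on dominant and recessive rays alike. Every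
  nonzero solution is thus dominant in some sector, which makes a single sector fatal. The second
  solution there is reduction of order: the Wronskian of \<open>g\<close> and \<open>g F\<close> is
  \<open>g\<^sup>2 f = P\<close>, and by Abel's formula the Wronskians of the equation are exactly
  the multiples of \<open>P\<close>.\<close>

lemma exp_growth_upper:
  fixes f f' :: "real \<Rightarrow> real"
  assumes "\<And>x. s \<le> x \<Longrightarrow> x \<le> t \<Longrightarrow> (f has_real_derivative f' x) (at x)"
    and "\<And>x. s \<le> x \<Longrightarrow> x \<le> t \<Longrightarrow> f' x \<le> k * f x" and "s \<le> t"
  shows "f t \<le> f s * exp (k * (t - s))"
proof -
  \<comment> \<open>Gronwall's multiplier. The signs of \<open>k\<close> and \<open>f\<close> are
    arbitrary; a negative \<open>k\<close> later yields decay.\<close>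
  define h where "h = (\<lambda>x. f x * exp (- k * x))"
  have "h t \<le> h s"
  proof (rule DERIV_nonpos_imp_nonincreasing[OF \<open>s \<le> t\<close>])
    fix x assume x: "s \<le> x" "x \<le> t"
    have "(h has_real_derivative (f' x - k * f x) * exp (- k * x)) (at x)"
      unfolding h_def by (rule derivative_eq_intros assms x refl | simp add: algebra_simps)+
    moreover have "(f' x - k * f x) * exp (- k * x) \<le> 0"
      using assms(2)[OF x] by (simp add: mult_le_0_iff)
    ultimately show "\<exists>y. (h has_real_derivative y) (at x) \<and> y \<le> 0" by blast
  qed
  hence "f t * exp (- k * t) * exp (k * t) \<le> f s * exp (- k * s) * exp (k * t)"
    unfolding h_def by (intro mult_right_mono) auto
  thus ?thesis
    by (simp add: mult.assoc flip: exp_add) (simp add: algebra_simps)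
qed

lemma exp_growth_lower:
  fixes f f' :: "real \<Rightarrow> real"
  assumes "\<And>x. s \<le> x \<Longrightarrow> x \<le> t \<Longrightarrow> (f has_real_derivative f' x) (at x)"
    and "\<And>x. s \<le> x \<Longrightarrow> x \<le> t \<Longrightarrow> k * f x \<le> f' x" and "s \<le> t"
  shows "f s * exp (k * (t - s)) \<le> f t"
proof -
  have "- f t \<le> - f s * exp (k * (t - s))"
    by (rule exp_growth_upper[where f' = "\<lambda>x. - f' x"])
       (use assms in \<open>auto intro!: derivative_eq_intros\<close>)
  thus ?thesis by simp
qed

lemma has_real_derivative_cmod_power2:
  assumes "(p has_vector_derivative p') (at x)"
  shows "((\<lambda>x. (cmod (p x))\<^sup>2) has_real_derivative 2 * Re (cnj (p x) * p')) (at x)"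
proof -
  have "((\<lambda>x. p x \<bullet> p x) has_derivative (\<lambda>h. p x \<bullet> (h *\<^sub>R p') + (h *\<^sub>R p') \<bullet> p x)) (at x)"
    by (rule has_derivative_inner) (use assms in \<open>auto simp: has_vector_derivative_def\<close>)
  moreover have "(\<lambda>h. p x \<bullet> (h *\<^sub>R p') + (h *\<^sub>R p') \<bullet> p x) = (*) (2 * Re (cnj (p x) * p'))"
    by (auto simp: inner_complex_def algebra_simps)
  ultimately show ?thesis
    by (simp only: has_field_derivative_def power2_norm_eq_inner)
qed

text \<open>Gronwall for the energy. The cross terms carry the factor 1 + B, so with
  \<open>B\<close> near 1 and \<open>A\<close> near 0 the rate is near 2 and |G| itself grows at
  most at the sharp rate 1; \<open>growth_bound\<close> relies on that.\<close>

lemma second_order_energy_bound: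
  fixes G G1 a b :: "real \<Rightarrow> complex"
  assumes "\<And>x. s \<le> x \<Longrightarrow> x \<le> t \<Longrightarrow> (G has_vector_derivative G1 x) (at x)"
    and "\<And>x. s \<le> x \<Longrightarrow> x \<le> t \<Longrightarrow> (G1 has_vector_derivative a x * G1 x + b x * G x) (at x)"
    and "\<And>x. s \<le> x \<Longrightarrow> x \<le> t \<Longrightarrow> cmod (a x) \<le> A"
    and "\<And>x. s \<le> x \<Longrightarrow> x \<le> t \<Longrightarrow> cmod (b x) \<le> B"
    and "s \<le> t"
  shows "(cmod (G t))\<^sup>2 + (cmod (G1 t))\<^sup>2
           \<le> ((cmod (G s))\<^sup>2 + (cmod (G1 s))\<^sup>2) * exp ((1 + B + 2 * A) * (t - s))"
proof (rule exp_growth_upper[OF _ _ \<open>s \<le> t\<close>])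
  fix x assume x: "s \<le> x" "x \<le> t"
  show "((\<lambda>x. (cmod (G x))\<^sup>2 + (cmod (G1 x))\<^sup>2) has_real_derivative
    2 * Re (cnj (G x) * G1 x) + 2 * Re (cnj (G1 x) * (a x * G1 x + b x * G x))) (at x)"
    by (intro DERIV_add has_real_derivative_cmod_power2 assms x)
  have A: "0 \<le> A" "0 \<le> B" using assms(3,4)[OF x] norm_ge_zero order_trans by blast+
  have 1: "Re (cnj (G x) * G1 x) \<le> cmod (G x) * cmod (G1 x)"
    by (metis complex_Re_le_cmod complex_mod_cnj norm_mult)
  have "Re (cnj (G1 x) * (a x * G1 x + b x * G x)) \<le> cmod (G1 x) * cmod (a x * G1 x + b x * G x)"
    by (metis complex_Re_le_cmod complex_mod_cnj norm_mult)
  also have "\<dots> \<le> cmod (G1 x) * (A * cmod (G1 x) + B * cmod (G x))"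
    by (intro mult_left_mono norm_triangle_le)
       (auto simp: norm_mult intro!: add_mono mult_right_mono assms x)
  finally have 2: "Re (cnj (G1 x) * (a x * G1 x + b x * G x))
      \<le> A * (cmod (G1 x))\<^sup>2 + B * (cmod (G x) * cmod (G1 x))"
    by (simp add: algebra_simps power2_eq_square)
  have 3: "2 * (cmod (G x) * cmod (G1 x)) \<le> (cmod (G x))\<^sup>2 + (cmod (G1 x))\<^sup>2"
    using sum_squares_bound[of "cmod (G x)" "cmod (G1 x)"] by simp
  have "2 * Re (cnj (G x) * G1 x) + 2 * Re (cnj (G1 x) * (a x * G1 x + b x * G x))
     \<le> (1 + B) * (2 * (cmod (G x) * cmod (G1 x))) + 2 * A * (cmod (G1 x))\<^sup>2"
    using 1 2 by (simp add: algebra_simps)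
  also have "\<dots> \<le> (1 + B) * ((cmod (G x))\<^sup>2 + (cmod (G1 x))\<^sup>2) + 2 * A * ((cmod (G x))\<^sup>2 + (cmod (G1 x))\<^sup>2)"
    using A by (intro add_mono mult_left_mono 3) auto
  finally show "2 * Re (cnj (G x) * G1 x) + 2 * Re (cnj (G1 x) * (a x * G1 x + b x * G x))
     \<le> (1 + B + 2 * A) * ((cmod (G x))\<^sup>2 + (cmod (G1 x))\<^sup>2)"
    by (simp add: algebra_simps)
qed

locale halfplane_ode =
  fixes G G1 a b :: "complex \<Rightarrow> complex" and R0 :: real
  assumes deriv_G: "\<And>z. 0 < Re z \<Longrightarrow> R0 \<le> cmod z \<Longrightarrow> (G has_field_derivative G1 z) (at z)"
    and deriv_G1: "\<And>z. 0 < Re z \<Longrightarrow> R0 \<le> cmod z \<Longrightarrow>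
          (G1 has_field_derivative a z * G1 z + b z * G z) (at z)"
    and coeff_lim: "\<And>e. 0 < e \<Longrightarrow> \<exists>R\<ge>R0. \<forall>z. 0 < Re z \<and> R \<le> cmod z \<longrightarrow> cmod (a z) \<le> e \<and> cmod (b z - 1) \<le> e"
begin

text \<open>For the limit equation G'' = G the coordinates \<open>p\<close> and \<open>q\<close>
  decouple: p' = p and q' = -q.\<close>

definition p where "p z = G1 z + G z"
definition q where "q z = G1 z - G z"
text \<open>The weight 4 makes positivity give |q| < |p| / 2, hence |G| = |p - q| / 2 \<ge> |p| / 4;
  with weight 1 the lower bound for |G| would be lost.\<close>

definition \<Delta> where "\<Delta> z = (cmod (p z))\<^sup>2 - 4 * (cmod (q z))\<^sup>2"

definition small_coeff where
  "small_coeff e z \<longleftrightarrow> 0 < Re z \<and> R0 \<le> cmod z \<and> cmod (a z) \<le> e \<and> cmod (b z - 1) \<le> e"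

definition perturb where "perturb z = a z * G1 z + (b z - 1) * G z"

lemma perturb_bound:
  assumes "small_coeff e z"
  shows "cmod (perturb z) \<le> e * (cmod (p z) + cmod (q z))"
proof -
  have e: "0 \<le> e" using assms norm_ge_zero order_trans unfolding small_coeff_def by blast
  have *: "cmod (G1 z) = cmod (p z + q z) / 2" "cmod (G z) = cmod (p z - q z) / 2"
    by (auto simp: p_def q_def simp flip: mult_2 simp: norm_mult)
  have 1: "cmod (G1 z) \<le> (cmod (p z) + cmod (q z)) / 2" "cmod (G z) \<le> (cmod (p z) + cmod (q z)) / 2"
    unfolding * using norm_triangle_ineq[of "p z" "q z"] norm_triangle_ineq4[of "p z" "q z"] by auto
  have "cmod (perturb z) \<le> e * cmod (G1 z) + e * cmod (G z)"
    unfolding perturb_def using assms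
    by (intro norm_triangle_le) (auto simp: norm_mult small_coeff_def intro!: add_mono mult_right_mono)
  also have "\<dots> \<le> e * ((cmod (p z) + cmod (q z)) / 2) + e * ((cmod (p z) + cmod (q z)) / 2)"
    using e 1 by (intro add_mono mult_left_mono) auto
  finally show ?thesis by (simp add: algebra_simps)
qed

lemma line_derivs:
  assumes "small_coeff e (w + of_real s * u)"
  shows "((\<lambda>s. p (w + of_real s * u)) has_vector_derivative
            u * (p (w + of_real s * u) + perturb (w + of_real s * u))) (at s)"
    and "((\<lambda>s. q (w + of_real s * u)) has_vector_derivative
            u * (- q (w + of_real s * u) + perturb (w + of_real s * u))) (at s)"
proof -
  let ?z = "w + of_real s * u"
  have z: "0 < Re ?z" "R0 \<le> cmod ?z" using assms by (auto simp: small_coeff_def)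
  have l: "((\<lambda>s. w + of_real s * u) has_vector_derivative u) (at s)"
    by (auto intro!: derivative_eq_intros has_vector_derivative_real_field simp: has_vector_derivative_def scaleR_conv_of_real)
  have "(p has_field_derivative (a ?z * G1 ?z + b ?z * G ?z) + G1 ?z) (at ?z)"
    unfolding p_def[abs_def] by (intro DERIV_add deriv_G deriv_G1 z)
  from field_vector_diff_chain_at[OF l this]
  show "((\<lambda>s. p (w + of_real s * u)) has_vector_derivative
            u * (p ?z + perturb ?z)) (at s)"
    by (simp add: o_def p_def perturb_def algebra_simps)
  have "(q has_field_derivative (a ?z * G1 ?z + b ?z * G ?z) - G1 ?z) (at ?z)"
    unfolding q_def[abs_def] by (intro DERIV_diff deriv_G deriv_G1 z)
  from field_vector_diff_chain_at[OF l this]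
  show "((\<lambda>s. q (w + of_real s * u)) has_vector_derivative
            u * (- q ?z + perturb ?z)) (at s)"
    by (simp add: o_def q_def perturb_def algebra_simps)
qed

text \<open>Directional derivatives of |p|^2 and |q|^2 along \<open>u\<close>, with the second
  derivative of \<open>G\<close> eliminated by the equation.\<close>

definition Dp where "Dp u z = 2 * Re (cnj (p z) * (u * (p z + perturb z)))"
definition Dq where "Dq u z = 2 * Re (cnj (q z) * (u * (- q z + perturb z)))"

lemma line_deriv_cmod:
  assumes "small_coeff e (w + of_real s * u)"
  shows "((\<lambda>s. (cmod (p (w + of_real s * u)))\<^sup>2) has_real_derivative Dp u (w + of_real s * u)) (at s)"
    and "((\<lambda>s. (cmod (q (w + of_real s * u)))\<^sup>2) has_real_derivative Dq u (w + of_real s * u)) (at s)"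
    and "((\<lambda>s. \<Delta> (w + of_real s * u)) has_real_derivative
             Dp u (w + of_real s * u) - 4 * Dq u (w + of_real s * u)) (at s)"
proof -
  show 1: "((\<lambda>s. (cmod (p (w + of_real s * u)))\<^sup>2) has_real_derivative Dp u (w + of_real s * u)) (at s)"
    unfolding Dp_def by (rule has_real_derivative_cmod_power2[OF line_derivs(1)[OF assms]])
  show 2: "((\<lambda>s. (cmod (q (w + of_real s * u)))\<^sup>2) has_real_derivative Dq u (w + of_real s * u)) (at s)"
    unfolding Dq_def by (rule has_real_derivative_cmod_power2[OF line_derivs(2)[OF assms]])
  show "((\<lambda>s. \<Delta> (w + of_real s * u)) has_real_derivative
             Dp u (w + of_real s * u) - 4 * Dq u (w + of_real s * u)) (at s)"
    unfolding \<Delta>_def by (intro DERIV_diff DERIV_cmult 1 2)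
qed

lemma Dp_Dq_bounds:
  assumes "small_coeff e z" "cmod u = 1"
  shows "\<bar>Dp u z - 2 * Re u * (cmod (p z))\<^sup>2\<bar> \<le> 2 * e * cmod (p z) * (cmod (p z) + cmod (q z))"
    and "\<bar>Dq u z + 2 * Re u * (cmod (q z))\<^sup>2\<bar> \<le> 2 * e * cmod (q z) * (cmod (p z) + cmod (q z))"
proof -
  have gen: "\<bar>Re (cnj x * (u * perturb z))\<bar> \<le> e * cmod x * (cmod (p z) + cmod (q z))" for x
  proof -
    have "\<bar>Re (cnj x * (u * perturb z))\<bar> \<le> cmod x * cmod (perturb z)"
      using abs_Re_le_cmod[of "cnj x * (u * perturb z)"] assms(2) by (simp add: norm_mult)
    also have "\<dots> \<le> cmod x * (e * (cmod (p z) + cmod (q z)))"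
      by (intro mult_left_mono perturb_bound assms) auto
    finally show ?thesis by (simp add: algebra_simps)
  qed
  have sq: "Re (cnj x * (u * x)) = Re u * (cmod x)\<^sup>2" for x
    unfolding cmod_power2 by (simp add: algebra_simps power2_eq_square)
  have "Dp u z = 2 * Re (cnj (p z) * (u * p z)) + 2 * Re (cnj (p z) * (u * perturb z))"
    unfolding Dp_def by (simp only: distrib_left plus_complex.sel)
  hence "Dp u z - 2 * Re u * (cmod (p z))\<^sup>2 = 2 * Re (cnj (p z) * (u * perturb z))"
    unfolding sq by simp
  thus "\<bar>Dp u z - 2 * Re u * (cmod (p z))\<^sup>2\<bar> \<le> 2 * e * cmod (p z) * (cmod (p z) + cmod (q z))"
    using gen[of "p z"] by (simp add: abs_mult)
  have "Dq u z = - (2 * Re (cnj (q z) * (u * q z))) + 2 * Re (cnj (q z) * (u * perturb z))"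
    unfolding Dq_def by (simp only: distrib_left plus_complex.sel mult_minus_right uminus_complex.sel)
  hence "Dq u z + 2 * Re u * (cmod (q z))\<^sup>2 = 2 * Re (cnj (q z) * (u * perturb z))"
    unfolding sq by simp
  thus "\<bar>Dq u z + 2 * Re u * (cmod (q z))\<^sup>2\<bar> \<le> 2 * e * cmod (q z) * (cmod (p z) + cmod (q z))"
    using gen[of "q z"] by (simp add: abs_mult)
qed

text \<open>Growth of |p|^2 and decay of |q|^2 both push \<open>\<Delta>\<close> upward, so the
  bound involves the sum of the squares and not \<open>\<Delta>\<close> itself; for 5 e \<le> 2 Re u
  it is nonnegative whatever the sign of \<open>\<Delta>\<close>.\<close>

lemma D\<Delta>_lower:
  assumes "small_coeff e z" "cmod u = 1"
  shows "(2 * Re u - 5 * e) * ((cmod (p z))\<^sup>2 + 4 * (cmod (q z))\<^sup>2) \<le> Dp u z - 4 * Dq u z"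
proof -
  have e: "0 \<le> e" using assms norm_ge_zero order_trans unfolding small_coeff_def by blast
  define x y where "x = cmod (p z)" and "y = cmod (q z)"
  have xy: "4 * (x * y) \<le> x\<^sup>2 + 4 * y\<^sup>2"
    using zero_le_power2[of "x - 2 * y"] by (simp add: power2_eq_square algebra_simps)
  have "Dp u z - 4 * Dq u z \<ge> 2 * Re u * (x\<^sup>2 + 4 * y\<^sup>2) - 2 * e * ((x + 4 * y) * (x + y))"
    using Dp_Dq_bounds[OF assms] unfolding x_def y_def by (simp add: algebra_simps abs_le_iff)
  \<comment> \<open>5 x y \<le> 5/4 (x^2 + 4 y^2) gives the factor 9/4, and 2 * 9/4 is then rounded
    up to 5.\<close>
  moreover have "2 * e * ((x + 4 * y) * (x + y)) \<le> 2 * e * (9/4 * (x\<^sup>2 + 4 * y\<^sup>2))"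
    using e xy by (intro mult_left_mono) (auto simp: algebra_simps power2_eq_square)
  moreover have "2 * e * (9/4 * (x\<^sup>2 + 4 * y\<^sup>2)) \<le> 5 * e * (x\<^sup>2 + 4 * y\<^sup>2)"
    using mult_nonneg_nonneg[OF e, of "x\<^sup>2 + 4 * y\<^sup>2"] by (simp add: algebra_simps)
  ultimately show ?thesis unfolding x_def y_def by (simp add: algebra_simps)
qed

lemma \<Delta>_growth:
  assumes "\<And>s. s1 \<le> s \<Longrightarrow> s \<le> s2 \<Longrightarrow> small_coeff e (w + of_real s * u)"
    and "cmod u = 1" "5 * e \<le> 2 * Re u" "s1 \<le> s2"
  shows "\<Delta> (w + of_real s1 * u) \<le> \<Delta> (w + of_real s2 * u)"
    and "\<Delta> (w + of_real s1 * u) * exp ((2 * Re u - 5 * e) * (s2 - s1)) \<le> \<Delta> (w + of_real s2 * u)"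
proof -
  have ge: "\<Delta> z \<le> (cmod (p z))\<^sup>2 + 4 * (cmod (q z))\<^sup>2" for z unfolding \<Delta>_def by simp
  have "0 \<le> Dp u z - 4 * Dq u z \<and> (2 * Re u - 5 * e) * \<Delta> z \<le> Dp u z - 4 * Dq u z"
    if "small_coeff e z" for z
  proof -
    have "0 \<le> (2 * Re u - 5 * e) * ((cmod (p z))\<^sup>2 + 4 * (cmod (q z))\<^sup>2)" using assms by simp
    moreover have "(2 * Re u - 5 * e) * \<Delta> z \<le> (2 * Re u - 5 * e) * ((cmod (p z))\<^sup>2 + 4 * (cmod (q z))\<^sup>2)"
      using assms ge by (intro mult_left_mono) auto
    ultimately show ?thesis using D\<Delta>_lower[OF that assms(2)] by linarith
  qed note * = this
  show "\<Delta> (w + of_real s1 * u) * exp ((2 * Re u - 5 * e) * (s2 - s1)) \<le> \<Delta> (w + of_real s2 * u)"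
    by (rule exp_growth_lower[where f = "\<lambda>s. \<Delta> (w + of_real s * u)", OF line_deriv_cmod(3)])
       (use * assms in auto)
  show "\<Delta> (w + of_real s1 * u) \<le> \<Delta> (w + of_real s2 * u)"
    using exp_growth_lower[where f = "\<lambda>s. \<Delta> (w + of_real s * u)" and k = 0,
        OF line_deriv_cmod(3)[of e]] * assms by auto
qed

section \<open>Dominant and recessive rays\<close>

definition dominant where "dominant u \<longleftrightarrow> (\<exists>s1. \<forall>s\<ge>s1. \<Delta> (of_real s * u) > 0)"

lemma small_coeff_ray:
  assumes "0 < e" "cmod u = 1" "0 < Re u"
  obtains r where "0 < r" "\<And>s. r \<le> s \<Longrightarrow> small_coeff e (of_real s * u)"
proof -
  obtain R where R: "R \<ge> R0" "\<And>z. 0 < Re z \<and> R \<le> cmod z \<Longrightarrow> cmod (a z) \<le> e \<and> cmod (b z - 1) \<le> e"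
    using coeff_lim[OF assms(1)] by blast
  show ?thesis
  proof (rule that[of "max 1 R"])
    fix s assume "max 1 R \<le> s"
    hence "0 < Re (of_real s * u)" "R \<le> cmod (of_real s * u)"
      using assms by (auto simp: norm_mult)
    with R show "small_coeff e (of_real s * u)" unfolding small_coeff_def by fastforce
  qed auto
qed

text \<open>Monotonicity makes a single positive value of \<open>\<Delta>\<close> sufficient; so on
  a ray that is not dominant \<open>\<Delta> \<le> 0\<close> at all large points.\<close>

lemma dominant_if_pos:
  assumes u: "cmod u = 1" "0 < Re u" and e: "5 * e \<le> 2 * Re u"
    and sm: "\<And>s. r \<le> s \<Longrightarrow> small_coeff e (of_real s * u)" and pos: "\<Delta> (of_real r * u) > 0"
  shows "dominant u"
  unfolding dominant_def
proof (intro exI allI impI)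
  fix s assume "r \<le> s"
  show "\<Delta> (of_real s * u) > 0"
    using \<Delta>_growth(1)[of r s e 0 u] sm u e \<open>r \<le> s\<close> pos by auto
qed

text \<open>While \<open>\<Delta>\<close> is positive, |q| \<le> |p| / 2, so \<open>p\<close> obeys
  p' = p up to a relative error O(e), and |G| lies between |p| / 4 and |p|. The lower rate for |p|^2
  comes from \<open>\<Delta>\<close>, the upper one from \<open>Dp\<close>.\<close>

lemma dominant_limit:
  assumes u: "cmod u = 1" "0 < Re u" and "dominant u"
  shows "((\<lambda>s. ln (cmod (G (of_real s * u))) / s) \<longlongrightarrow> Re u) at_top"
proof (rule tendstoI)
  fix d :: real assume "0 < d"
  \<comment> \<open>Re u / 5 keeps \<open>\<Delta>\<close> monotone; d / 6 leaves room for the loss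
    5/2 e s and for a constant below e s.\<close>
  define e where "e = min (Re u / 5) (d / 6)"
  have e: "0 < e" "5 * e \<le> 2 * Re u" "6 * e \<le> d" using u \<open>0 < d\<close> by (auto simp: e_def min_def)
  obtain r where r: "0 < r" "\<And>s. r \<le> s \<Longrightarrow> small_coeff e (of_real s * u)"
    using small_coeff_ray[OF e(1) u] by metis
  obtain s1 where s1: "\<And>s. s1 \<le> s \<Longrightarrow> \<Delta> (of_real s * u) > 0"
    using \<open>dominant u\<close> unfolding dominant_def by blast
  define s2 where "s2 = max r s1"
  define D where "D = \<Delta> (of_real s2 * u)"
  define M where "M = (cmod (p (of_real s2 * u)))\<^sup>2"
  have D: "0 < D" unfolding D_def by (rule s1) (simp add: s2_def)
  have qp: "cmod (q (of_real s * u)) \<le> cmod (p (of_real s * u)) / 2" if "s2 \<le> s" for s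
  proof -
    have "4 * (cmod (q (of_real s * u)))\<^sup>2 < (cmod (p (of_real s * u)))\<^sup>2"
      using s1[of s] that unfolding \<Delta>_def s2_def by auto
    hence "(2 * cmod (q (of_real s * u)))\<^sup>2 \<le> (cmod (p (of_real s * u)))\<^sup>2" by (simp add: power_mult_distrib)
    from power2_le_imp_le[OF this] show ?thesis by simp
  qed
  have low: "D * exp ((2 * Re u - 5 * e) * (s - s2)) \<le> (cmod (p (of_real s * u)))\<^sup>2" if "s2 \<le> s" for s
  proof -
    have "D * exp ((2 * Re u - 5 * e) * (s - s2)) \<le> \<Delta> (of_real s * u)"
      unfolding D_def using \<Delta>_growth(2)[of s2 s e 0 u] r u e that by (auto simp: s2_def)
    thus ?thesis unfolding \<Delta>_def by (smt (verit) zero_le_power2)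
  qed
  have up: "(cmod (p (of_real s * u)))\<^sup>2 \<le> M * exp ((2 * Re u + 3 * e) * (s - s2))" if "s2 \<le> s" for s
    unfolding M_def
  proof (rule exp_growth_upper[OF _ _ that])
    fix x assume x: "s2 \<le> x" "x \<le> s"
    hence sm: "small_coeff e (of_real x * u)" using r by (auto simp: s2_def)
    thus "((\<lambda>s. (cmod (p (of_real s * u)))\<^sup>2) has_real_derivative Dp u (of_real x * u)) (at x)"
      using line_deriv_cmod(1)[of e 0 x u] by simp
    let ?z = "of_real x * u"
    have "Dp u ?z \<le> 2 * Re u * (cmod (p ?z))\<^sup>2 + 2 * e * cmod (p ?z) * (cmod (p ?z) + cmod (q ?z))"
      using Dp_Dq_bounds(1)[OF sm u(1)] by linarith
    also have "\<dots> \<le> 2 * Re u * (cmod (p ?z))\<^sup>2 + 2 * e * cmod (p ?z) * (3/2 * cmod (p ?z))"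
      using e qp[OF x(1)] by (intro add_left_mono mult_left_mono) auto
    finally show "Dp u ?z \<le> (2 * Re u + 3 * e) * (cmod (p ?z))\<^sup>2"
      by (simp add: algebra_simps power2_eq_square)
  qed
  have M: "0 < M" using up[of s2] low[of s2] D by auto
  have G: "cmod (p z) / 4 \<le> cmod (G z) \<and> cmod (G z) \<le> cmod (p z)" if "cmod (q z) \<le> cmod (p z) / 2" for z
  proof -
    have "2 * G z = p z - q z" by (simp add: p_def q_def)
    hence "2 * cmod (G z) = cmod (p z - q z)" by (metis norm_mult norm_numeral)
    thus ?thesis using norm_triangle_ineq2[of "p z" "q z"] norm_triangle_ineq4[of "p z" "q z"] that
      by linarith
  qed
  \<comment> \<open>Collects all that stays bounded: the initial values, the factor 4 and the shift
    of the starting point \<open>s2\<close>.\<close>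
  define C where "C = \<bar>ln D\<bar> + \<bar>ln M\<bar> + ln 4 + \<bar>2 * Re u + 3 * e\<bar> * \<bar>s2\<bar> + \<bar>2 * Re u - 5 * e\<bar> * \<bar>s2\<bar>"
  have main: "\<bar>ln (cmod (G (of_real s * u))) - Re u * s\<bar> \<le> 5/2 * e * s + C" if "s2 \<le> s" for s
  proof -
    let ?z = "of_real s * u"
    have s: "0 < s" using r that by (auto simp: s2_def)
    have pos: "0 < (cmod (p ?z))\<^sup>2" using low[OF that] D by (smt (verit) exp_gt_zero mult_pos_pos)
    hence pp: "0 < cmod (p ?z)" by auto
    have lp: "ln ((cmod (p ?z))\<^sup>2) = 2 * ln (cmod (p ?z))" using pp by (simp add: ln_realpow)
    have "ln (D * exp ((2 * Re u - 5 * e) * (s - s2))) \<le> ln ((cmod (p ?z))\<^sup>2)"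
      using low[OF that] D pos by (subst ln_le_cancel_iff) auto
    hence 1: "ln D + (2 * Re u - 5 * e) * (s - s2) \<le> 2 * ln (cmod (p ?z))"
      using D lp by (simp add: ln_mult)
    have "ln ((cmod (p ?z))\<^sup>2) \<le> ln (M * exp ((2 * Re u + 3 * e) * (s - s2)))"
      using up[OF that] M pos by (subst ln_le_cancel_iff) auto
    hence 2: "2 * ln (cmod (p ?z)) \<le> ln M + (2 * Re u + 3 * e) * (s - s2)"
      using M lp by (simp add: ln_mult)
    have "ln (cmod (p ?z) / 4) \<le> ln (cmod (G ?z)) \<and> ln (cmod (G ?z)) \<le> ln (cmod (p ?z))"
      using G[OF qp[OF that]] pp by (intro conjI ln_mono) auto
    hence 3: "ln (cmod (p ?z)) - ln 4 \<le> ln (cmod (G ?z))" "ln (cmod (G ?z)) \<le> ln (cmod (p ?z))"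
      using pp by (auto simp: ln_div)
    define k1 k2 where "k1 = 2 * Re u - 5 * e" and "k2 = 2 * Re u + 3 * e"
    have 4: "k1 * (s - s2) \<ge> k1 * s - \<bar>k1\<bar> * \<bar>s2\<bar>" "k2 * (s - s2) \<le> k2 * s + \<bar>k2\<bar> * \<bar>s2\<bar>"
      using abs_ge_self[of "k1 * s2"] abs_ge_minus_self[of "k2 * s2"]
      by (auto simp: abs_mult right_diff_distrib)
    have 5: "ln 4 \<ge> (0::real)" "0 < e * s" using e s by auto
    have 6: "\<bar>k1\<bar> * \<bar>s2\<bar> \<ge> 0" "\<bar>k2\<bar> * \<bar>s2\<bar> \<ge> 0" by auto
    have C: "C = \<bar>ln D\<bar> + \<bar>ln M\<bar> + ln 4 + \<bar>k2\<bar> * \<bar>s2\<bar> + \<bar>k1\<bar> * \<bar>s2\<bar>"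
      by (simp add: C_def k1_def k2_def)
    have k: "k1 * s = 2 * (Re u * s) - 5 * (e * s)" "k2 * s = 2 * (Re u * s) + 3 * (e * s)"
      by (auto simp: k1_def k2_def algebra_simps)
    have 7: "- \<bar>ln D\<bar> \<le> ln D" "ln M \<le> \<bar>ln M\<bar>" "0 \<le> \<bar>ln D\<bar>" "0 \<le> \<bar>ln M\<bar>" by auto
    note low_k = 1[folded k1_def] and up_k = 2[folded k2_def]
    have "2 * (Re u * s) - 5 * (e * s) - 2 * C \<le> 2 * ln (cmod (G ?z))"
      using low_k 3 4(1) 5 6 7 C k by linarith
    moreover have "2 * ln (cmod (G ?z)) \<le> 2 * (Re u * s) + 3 * (e * s) + 2 * C"
      using up_k 3 4(2) 5 6 7 C k by linarith
    ultimately show ?thesis using 5 by (simp add: abs_le_iff mult.assoc)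
  qed
  show "\<forall>\<^sub>F s in at_top. dist (ln (cmod (G (of_real s * u))) / s) (Re u) < d"
    using eventually_gt_at_top[of "max s2 (C / e)"]
  proof eventually_elim
    case (elim s)
    hence s: "s2 \<le> s" "0 < s" "C < e * s" using r e by (auto simp: s2_def field_simps)
    have "\<bar>ln (cmod (G (of_real s * u))) / s - Re u\<bar> = \<bar>ln (cmod (G (of_real s * u))) - Re u * s\<bar> / s"
      using s by (simp add: field_simps)
    also have "\<dots> \<le> (5/2 * e * s + C) / s" using main[OF s(1)] s by (intro divide_right_mono) auto
    also have "\<dots> < d"
    proof -
      have "6 * e * s \<le> d * s" using e s by (intro mult_right_mono) auto
      moreover have "0 < e * s" using e s by simp
      ultimately have "5/2 * e * s + C < d * s" using s by linarith
      thus ?thesis using s by (simp add: pos_divide_less_eq)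
    qed
    finally show ?case by (simp add: dist_real_def)
  qed
qed

text \<open>Here |p| \<le> 2 |q| at all large points, so \<open>q\<close> obeys q' = -q up to a
  relative error O(e) and controls \<open>G\<close> through |G| \<le> 3/2 |q|.\<close>

lemma not_dominant_decay:
  assumes u: "cmod u = 1" "0 < Re u" and "\<not> dominant u" and d: "0 < d"
  shows "\<forall>\<^sub>F s in at_top. cmod (G (of_real s * u)) \<le> exp (- (Re u - d) * s)"
proof -
  define e where "e = min (Re u / 5) (d / 6)"
  have e: "0 < e" "5 * e \<le> 2 * Re u" "6 * e \<le> d" using u \<open>0 < d\<close> by (auto simp: e_def min_def)
  obtain r where r: "0 < r" "\<And>s. r \<le> s \<Longrightarrow> small_coeff e (of_real s * u)"
    using small_coeff_ray[OF e(1) u] by metis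
  have neg: "\<Delta> (of_real s * u) \<le> 0" if "r \<le> s" for s
    using dominant_if_pos[OF u e(2), of s] r that assms(3) by force
  have pq: "cmod (p (of_real s * u)) \<le> 2 * cmod (q (of_real s * u))" if "r \<le> s" for s
  proof -
    have "(cmod (p (of_real s * u)))\<^sup>2 \<le> (2 * cmod (q (of_real s * u)))\<^sup>2"
      using neg[OF that] unfolding \<Delta>_def by (simp add: power_mult_distrib)
    from power2_le_imp_le[OF this] show ?thesis by simp
  qed
  define M where "M = (cmod (q (of_real r * u)))\<^sup>2"
  have up: "(cmod (q (of_real s * u)))\<^sup>2 \<le> M * exp (- (2 * Re u - 6 * e) * (s - r))" if "r \<le> s" for s
    unfolding M_def
  proof (rule exp_growth_upper[OF _ _ that])
    fix x assume x: "r \<le> x" "x \<le> s"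
    hence sm: "small_coeff e (of_real x * u)" using r by auto
    thus "((\<lambda>s. (cmod (q (of_real s * u)))\<^sup>2) has_real_derivative Dq u (of_real x * u)) (at x)"
      using line_deriv_cmod(2)[of e 0 x u] by simp
    let ?z = "of_real x * u"
    have "Dq u ?z \<le> - 2 * Re u * (cmod (q ?z))\<^sup>2 + 2 * e * cmod (q ?z) * (cmod (p ?z) + cmod (q ?z))"
      using Dp_Dq_bounds(2)[OF sm u(1)] by linarith
    also have "\<dots> \<le> - 2 * Re u * (cmod (q ?z))\<^sup>2 + 2 * e * cmod (q ?z) * (3 * cmod (q ?z))"
      using e pq[OF x(1)] by (intro add_left_mono mult_left_mono) auto
    finally show "Dq u ?z \<le> - (2 * Re u - 6 * e) * (cmod (q ?z))\<^sup>2"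
      by (simp add: algebra_simps power2_eq_square)
  qed
  define C where "C = 3/2 * sqrt M * exp ((Re u - 3 * e) * r)"
  have G: "cmod (G (of_real s * u)) \<le> C * exp (- (Re u - 3 * e) * s)" if "r \<le> s" for s
  proof -
    let ?z = "of_real s * u"
    have "2 * G ?z = p ?z - q ?z" by (simp add: p_def q_def)
    hence "2 * cmod (G ?z) = cmod (p ?z - q ?z)" by (metis norm_mult norm_numeral)
    hence 1: "cmod (G ?z) \<le> 3/2 * cmod (q ?z)"
      using norm_triangle_ineq4[of "p ?z" "q ?z"] pq[OF that] by linarith
    have "(cmod (q ?z))\<^sup>2 \<le> (sqrt M * exp (- (Re u - 3 * e) * (s - r)))\<^sup>2"
      using up[OF that] by (simp add: M_def power_mult_distrib flip: exp_double) (simp add: algebra_simps)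
    from power2_le_imp_le[OF this] have "cmod (q ?z) \<le> sqrt M * exp (- (Re u - 3 * e) * (s - r))"
      by (simp add: M_def)
    also have "\<dots> = sqrt M * exp ((Re u - 3 * e) * r) * exp (- (Re u - 3 * e) * s)"
      by (simp add: algebra_simps flip: exp_add)
    finally show ?thesis using 1 unfolding C_def by simp
  qed
  have "C \<ge> 0" by (simp add: C_def M_def)
  \<comment> \<open>Half of the allowance 6 e was spent on the rate; the other half absorbs the
    constant \<open>C\<close>.\<close>
  have "((\<lambda>s. C * exp (- (3 * e) * s)) \<longlongrightarrow> C * 0) at_top"
    by (intro tendsto_intros filterlim_compose[OF exp_at_bot]
          filterlim_tendsto_neg_mult_at_bot[OF tendsto_const] filterlim_ident) (use e in auto)
  hence "\<forall>\<^sub>F s in at_top. C * exp (- (3 * e) * s) < 1"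
    by (intro order_tendstoD) auto
  thus ?thesis using eventually_ge_at_top[of "max r 1"]
  proof eventually_elim
    case (elim s)
    have "cmod (G (of_real s * u)) \<le> C * exp (- (Re u - 3 * e) * s)" using G elim by simp
    also have "\<dots> = C * exp (- (3 * e) * s) * exp (- (Re u - 6 * e) * s)"
      by (simp add: algebra_simps flip: exp_add)
    also have "\<dots> \<le> 1 * exp (- (Re u - 6 * e) * s)"
      using elim by (intro mult_right_mono) auto
    also have "\<dots> \<le> exp (- (Re u - d) * s)"
      using e elim by (auto intro!: mult_right_mono)
    finally show ?case .
  qed
qed

text \<open>\<open>\<Delta>\<close> is monotone along every line of sufficiently positive direction,
  not only along rays from the origin: a segment carries positivity from a point of the first ray to
  a point of the second.\<close>

lemma dominant_transfer:
  assumes u: "cmod u = 1" "0 < Re u" and v: "cmod v = 1" "0 < Re v" and dom: "dominant u"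
  shows "dominant v"
proof -
  \<comment> \<open>The segment will have a direction \<open>x\<close> with Re x > Re v / 2, so 5 e
    = Re v \<le> 2 Re x.\<close>
  define e where "e = Re v / 5"
  have e: "0 < e" "5 * e \<le> 2 * Re v" using v by (auto simp: e_def)
  obtain R where R: "R \<ge> R0" "\<And>z. 0 < Re z \<Longrightarrow> R \<le> cmod z \<Longrightarrow> cmod (a z) \<le> e \<and> cmod (b z - 1) \<le> e"
    using coeff_lim[OF e(1)] by blast
  \<comment> \<open>Right of a vertical line the coefficients are small, and a segment moving
    rightwards stays there.\<close>
  have sm: "small_coeff e z" if "max R 1 \<le> Re z" for z
    using R(1) R(2)[of z] that complex_Re_le_cmod[of z] unfolding small_coeff_def by fastforce
  obtain s1 where s1: "\<And>s. s1 \<le> s \<Longrightarrow> \<Delta> (of_real s * u) > 0"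
    using dom unfolding dominant_def by blast
  define s0 where "s0 = max s1 (max R 1 / Re u)"
  define w where "w = of_real s0 * u"
  have w: "max R 1 \<le> Re w" "\<Delta> w > 0"
    using u s1[of s0] by (auto simp: w_def s0_def field_simps max_def)
  text \<open>The direction of the segment from \<open>w\<close> to a far point of the ray of \<open>v\<close> is almost \<open>v\<close>.\<close>
  have "((\<lambda>T. Re (v - w * of_real (1/T))) \<longlongrightarrow> Re (v - w * of_real 0)) at_top"
    by (intro tendsto_intros tendsto_divide_0[OF tendsto_const] filterlim_at_top_imp_at_infinity filterlim_ident)
  \<comment> \<open>The fractions 3/5 and, below, 6/5 keep Re x = Re (z - w) / |z - w| above Re v /
    2.\<close>
  moreover have "Re (v - w * of_real 0) > Re v * (3/5)" using v by simp
  ultimately have "\<forall>\<^sub>F T in at_top. Re (v - w * of_real (1/T)) > Re v * (3/5)"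
    by (rule order_tendstoD)
  moreover have "((\<lambda>T. cmod (v - w * of_real (1/T))) \<longlongrightarrow> cmod (v - w * of_real 0)) at_top"
    by (intro tendsto_intros tendsto_divide_0[OF tendsto_const] filterlim_at_top_imp_at_infinity filterlim_ident)
  hence "\<forall>\<^sub>F T in at_top. cmod (v - w * of_real (1/T)) < 6/5"
    by (rule order_tendstoD) (use v in simp)
  ultimately have "\<forall>\<^sub>F T in at_top. Re (v - w * of_real (1/T)) > Re v * (3/5) \<and> cmod (v - w * of_real (1/T)) < 6/5
      \<and> T \<ge> max R 1 / Re v \<and> T > 0"
    using eventually_ge_at_top[of "max R 1 / Re v"] eventually_gt_at_top[of 0]
    by eventually_elim auto
  then obtain T where T: "Re (v - w * of_real (1/T)) > Re v * (3/5)" "cmod (v - w * of_real (1/T)) < 6/5"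
      "T \<ge> max R 1 / Re v" "T > 0" using eventually_happens' trivial_limit_at_top_linorder by blast
  define z where "z = of_real T * v"
  have z: "z - w = of_real T * (v - w * of_real (1/T))" using T by (simp add: z_def field_simps)
  have Rez: "Re (z - w) > T * (Re v * (3/5))" unfolding z using T by simp
  have Cz: "cmod (z - w) < T * (6/5)" unfolding z norm_mult using T by simp
  have "z \<noteq> w" using Rez T v by (auto simp: mult_pos_pos) (smt (verit) mult_pos_pos)
  define L where "L = cmod (z - w)"
  define x where "x = sgn (z - w)"
  have L: "0 < L" using \<open>z \<noteq> w\<close> by (simp add: L_def)
  have x: "cmod x = 1" "of_real L * x = z - w"
    using \<open>z \<noteq> w\<close> by (auto simp: x_def L_def norm_sgn) (simp add: sgn_eq)
  have "L * Re x = Re (z - w)" unfolding x(2)[symmetric] by simp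
  hence "L * Re x > T * (Re v * (3/5))" using Rez by simp
  moreover have "T * (Re v * (3/5)) \<ge> L * (Re v / 2)"
    using Cz v unfolding L_def by (simp add: mult_right_mono)
  ultimately have "L * (Re v / 2) < L * Re x" by linarith
  hence Rex: "Re v / 2 < Re x" using L by simp
  have "\<Delta> (w + of_real 0 * x) \<le> \<Delta> (w + of_real L * x)"
  proof (rule \<Delta>_growth(1))
    fix s assume "0 \<le> s" "s \<le> L"
    thus "small_coeff e (w + of_real s * x)"
      using w Rex v by (intro sm) (simp add: add_increasing2)
  qed (use x Rex v L e in \<open>auto simp: e_def\<close>)
  hence pos: "\<Delta> (of_real T * v) > 0" using w x z_def by simp
  show ?thesis
  proof (rule dominant_if_pos[OF v e(2) _ pos])
    fix s assume "T \<le> s"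
    thus "small_coeff e (of_real s * v)" using T v
      by (intro sm) (auto simp: field_simps intro: order_trans)
  qed
qed

end

section \<open>Jensen's formula\<close>

lemma entire_factor_at:
  assumes "g holomorphic_on UNIV" "g w \<noteq> 0"
  obtains n G where "G holomorphic_on UNIV" "G a \<noteq> 0" "\<And>z. g z = (z - a) ^ n * G z"
proof -
  define n where "n = nat (zorder g a)"
  obtain r where r: "r > 0" "zor_poly g a holomorphic_on cball a r"
     "\<And>z. z \<in> cball a r \<Longrightarrow> g z = zor_poly g a z * (z - a) ^ n \<and> zor_poly g a z \<noteq> 0"
    using zorder_exist_zero[OF assms(1) open_UNIV connected_UNIV UNIV_I, of a] assms(2)
    unfolding n_def by blast
  \<comment> \<open>For n > 0 the quotient has the default value 0 at \<open>a\<close>; the local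
    cofactor supplies the right one.\<close>
  define G where "G = (\<lambda>z. if z = a then zor_poly g a a else g z / (z - a) ^ n)"
  have 1: "G holomorphic_on (UNIV - {a})"
  proof (rule holomorphic_transform)
    show "(\<lambda>z. g z / (z - a) ^ n) holomorphic_on (UNIV - {a})"
      by (intro holomorphic_intros holomorphic_on_subset[OF assms(1)]) auto
  qed (auto simp: G_def)
  have 2: "G holomorphic_on (ball a r)"
  proof (rule holomorphic_transform)
    show "zor_poly g a holomorphic_on (ball a r)"
      by (rule holomorphic_on_subset[OF r(2)]) auto
  qed (use r in \<open>auto simp: G_def\<close>)
  have "G holomorphic_on ((UNIV - {a}) \<union> ball a r)"
    by (intro holomorphic_on_Un 1 2 open_ball) auto
  moreover have "(UNIV - {a}) \<union> ball a r = UNIV" using r(1) by auto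
  ultimately have "G holomorphic_on UNIV" by simp
  moreover have "G a \<noteq> 0" using r(1,3) by (auto simp: G_def)
  moreover have "g z = (z - a) ^ n * G z" for z
    using r(1) r(3)[of a] by (auto simp: G_def)
  ultimately show ?thesis using that by blast
qed

lemma entire_factor_finite:
  assumes "g holomorphic_on UNIV" "g w \<noteq> 0" "finite Z"
  obtains m G where "G holomorphic_on UNIV" "\<And>a. a \<in> Z \<Longrightarrow> G a \<noteq> 0"
    "\<And>z. g z = (\<Prod>a\<in>Z. (z - a) ^ m a) * G z"
proof -
  have "\<exists>m G. G holomorphic_on UNIV \<and> (\<forall>a\<in>Z. G a \<noteq> 0) \<and> (\<forall>z. g z = (\<Prod>a\<in>Z. (z - a) ^ m a) * G z)"
    using \<open>finite Z\<close>
  proof (induction Z)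
    case empty
    thus ?case using assms by (intro exI[of _ "\<lambda>_. 0"] exI[of _ g]) auto
  next
    case (insert b Z)
    then obtain m G where G: "G holomorphic_on UNIV" "\<And>a. a \<in> Z \<Longrightarrow> G a \<noteq> 0"
      "\<And>z. g z = (\<Prod>a\<in>Z. (z - a) ^ m a) * G z" by blast
    have "G w \<noteq> 0" using G(3)[of w] assms(2) by auto
    then obtain n H where H: "H holomorphic_on UNIV" "H b \<noteq> 0" "\<And>z. G z = (z - b) ^ n * H z"
      using entire_factor_at[OF G(1)] by metis
    have "(\<Prod>a\<in>insert b Z. (z - a) ^ (m(b := n)) a) = (z - b) ^ n * (\<Prod>a\<in>Z. (z - a) ^ m a)" for z
    proof -
      have "(\<Prod>a\<in>Z. (z - a) ^ (m(b := n)) a) = (\<Prod>a\<in>Z. (z - a) ^ m a)"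
        using insert.hyps by (intro prod.cong) auto
      thus ?thesis using insert.hyps by simp
    qed
    moreover have "H a \<noteq> 0" if "a \<in> insert b Z" for a
      using that H G(2) by auto
    ultimately show ?case using H G(3)
      by (intro exI[of _ "m(b := n)"] exI[of _ H]) (auto simp: mult_ac)
  qed
  thus ?thesis using that by blast
qed

lemma entire_zeros_finite:
  assumes "g holomorphic_on UNIV" "g w \<noteq> 0"
  shows "finite {z. cmod z \<le> r \<and> g z = 0}"
proof -
  have "\<not> g constant_on UNIV" if "g z = 0" for z
    using that assms(2) unfolding constant_on_def by (metis UNIV_I)
  hence "finite {z \<in> cball 0 r. g z = 0}"
  proof (cases "\<exists>z. g z = 0")
    case True
    thus ?thesis
      using \<open>\<And>z. g z = 0 \<Longrightarrow> \<not> g constant_on UNIV\<close> assms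
      by (intro holomorphic_compact_finite_zeros[of g UNIV "cball 0 r"]) (auto simp: connected_UNIV)
  qed auto
  thus ?thesis by (simp add: conj_commute)
qed

text \<open>Lets integrals over a circle ignore the angles at which a finite set is met. The angle
  \<open>2*pi\<close> is added by hand since \<open>Arg2pi\<close> stays below it.\<close>

lemma finite_cis_preimage:
  assumes "finite A"
  shows "finite {\<theta>\<in>{0..2*pi}. cis \<theta> \<in> A}"
proof -
  have "\<theta> \<in> insert (2*pi) (Arg2pi ` A)" if "\<theta> \<in> {0..2*pi}" "cis \<theta> \<in> A" for \<theta>
  proof (cases "\<theta> = 2 * pi")
    case False
    hence "Arg2pi (cis \<theta>) = \<theta>"
      using that by (intro Arg2pi_unique[of 1]) (auto simp: cis_conv_exp)
    thus ?thesis using that by force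
  qed auto
  hence "{\<theta>\<in>{0..2*pi}. cis \<theta> \<in> A} \<subseteq> insert (2*pi) (Arg2pi ` A)" by blast
  thus ?thesis using assms finite_subset by blast
qed

lemma finite_circle_preimage:
  assumes "finite A" "0 < r"
  shows "finite {\<theta>\<in>{0..2*pi}. complex_of_real r * cis \<theta> \<in> A}"
proof -
  have "{\<theta>\<in>{0..2*pi}. complex_of_real r * cis \<theta> \<in> A} \<subseteq> {\<theta>\<in>{0..2*pi}. cis \<theta> \<in> (\<lambda>z. z / of_real r) ` A}"
    using assms(2) by (auto simp: image_iff intro!: bexI[of _ "of_real r * cis _"])
  thus ?thesis using finite_cis_preimage[of "(\<lambda>z. z / of_real r) ` A"] assms finite_subset by blast
qed

section \<open>Means of logarithms over circles\<close>

lemma circle_mean_value: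
  fixes L :: "complex \<Rightarrow> complex"
  assumes "L holomorphic_on S" "open S" "cball 0 r \<subseteq> S" "0 < r"
  shows "((\<lambda>\<theta>. L (of_real r * cis \<theta>)) has_integral 2 * of_real pi * L 0) {0..2*pi}"
proof -
  have "((\<lambda>u. L u / (u - 0)) has_contour_integral (2 * of_real pi * \<i> * L 0)) (circlepath 0 r)"
    by (rule Cauchy_integral_circlepath_simple) (use assms in \<open>auto intro: holomorphic_on_subset\<close>)
  hence "((\<lambda>t. L (of_real r * cis t) / (of_real r * cis t) * r * \<i> * cis t) has_integral (2 * of_real pi * \<i> * L 0)) {0..2*pi}"
    unfolding circlepath_def by (subst (asm) has_contour_integral_part_circlepath_iff) auto
  hence "((\<lambda>t. \<i> * L (of_real r * cis t)) has_integral (2 * of_real pi * \<i> * L 0)) {0..2*pi}"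
    by (rule has_integral_eq[rotated]) (use assms in \<open>auto simp: field_simps\<close>)
  from has_integral_mult_right[OF this, of "- \<i>"]
  show ?thesis by (simp add: mult_ac)
qed

lemma circle_mean_value_ln_cmod:
  assumes "G holomorphic_on ball 0 R" "r < R" "0 < r" "\<And>z. z \<in> ball 0 R \<Longrightarrow> G z \<noteq> 0"
  shows "((\<lambda>\<theta>. ln (cmod (G (of_real r * cis \<theta>)))) has_integral 2 * pi * ln (cmod (G 0))) {0..2*pi}"
    and "(\<lambda>\<theta>. ln (cmod (G (of_real r * cis \<theta>)))) absolutely_integrable_on {0..2*pi}"
proof -
  obtain L where L: "L holomorphic_on ball 0 R" "\<And>z. z \<in> ball 0 R \<Longrightarrow> exp (L z) = G z"
    using holomorphic_logarithm_exists[OF convex_ball open_ball assms(1), of 0] assms by (metis centre_in_ball less_trans)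
  have re: "Re (L z) = ln (cmod (G z))" if "z \<in> ball 0 R" for z
    using L(2)[OF that] by (metis ln_exp norm_exp_eq_Re)
  have in_ball: "of_real r * cis \<theta> \<in> ball 0 R" for \<theta> using assms by (simp add: norm_mult)
  have "((\<lambda>\<theta>. L (of_real r * cis \<theta>)) has_integral 2 * of_real pi * L 0) {0..2*pi}"
    using assms by (intro circle_mean_value[OF L(1)]) auto
  from has_integral_linear[OF this bounded_linear_Re]
  show "((\<lambda>\<theta>. ln (cmod (G (of_real r * cis \<theta>)))) has_integral 2 * pi * ln (cmod (G 0))) {0..2*pi}"
    using re[OF in_ball] re[of 0] assms by (simp add: o_def)
  have "continuous_on {0..2*pi} (\<lambda>\<theta>. Re (L (of_real r * cis \<theta>)))"
    by (intro continuous_intros continuous_on_compose2[OF holomorphic_on_imp_continuous_on[OF L(1)]])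
       (use in_ball in auto)
  hence "(\<lambda>\<theta>. Re (L (of_real r * cis \<theta>))) absolutely_integrable_on {0..2*pi}"
    using absolutely_integrable_continuous_real by blast
  thus "(\<lambda>\<theta>. ln (cmod (G (of_real r * cis \<theta>)))) absolutely_integrable_on {0..2*pi}"
    using re[OF in_ball] by simp
qed

text \<open>Conjugation and a factor of modulus 1 turn |r cis \<theta> - a| into the modulus of r -
  cnj a z on the unit circle, a function without zeros in |z| < r / |a|.\<close>

lemma ln_cmod_minus_inside:
  assumes "cmod a < r"
  shows "((\<lambda>\<theta>. ln (cmod (of_real r * cis \<theta> - a))) has_integral 2 * pi * ln r) {0..2*pi}"
    and "(\<lambda>\<theta>. ln (cmod (of_real r * cis \<theta> - a))) absolutely_integrable_on {0..2*pi}"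
proof -
  have r: "0 < r" using assms norm_ge_zero le_less_trans by blast
  \<comment> \<open>For a = 0 any radius above 1 would do.\<close>
  define R where "R = (if a = 0 then 2 else r / cmod a)"
  define G where "G = (\<lambda>z. of_real r - cnj a * z)"
  have R: "1 < R" using assms r by (auto simp: R_def)
  have nz: "G z \<noteq> 0" if "z \<in> ball 0 R" for z
  proof
    assume "G z = 0"
    hence "cmod a * cmod z = r" using r by (simp add: G_def) (metis abs_of_pos complex_mod_cnj norm_mult norm_of_real)
    thus False using that r by (auto simp: R_def field_simps split: if_splits)
  qed
  have eq: "cmod (G (of_real 1 * cis \<theta>)) = cmod (of_real r * cis \<theta> - a)" for \<theta>
  proof -
    have "cmod (of_real r * cis \<theta> - a) = cmod (cnj (of_real r * cis \<theta> - a))" by (simp only: complex_mod_cnj)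
    also have "\<dots> = cmod (cis \<theta>) * cmod (cnj (of_real r * cis \<theta> - a))" by simp
    also have "\<dots> = cmod (cis \<theta> * cnj (of_real r * cis \<theta> - a))" by (simp only: norm_mult)
    also have "cis \<theta> * cnj (of_real r * cis \<theta> - a) = G (of_real 1 * cis \<theta>)"
      by (simp add: G_def cis_cnj algebra_simps cis_mult)
    finally show ?thesis by simp
  qed
  have hol: "G holomorphic_on ball 0 R" unfolding G_def by (intro holomorphic_intros)
  show "((\<lambda>\<theta>. ln (cmod (of_real r * cis \<theta> - a))) has_integral 2 * pi * ln r) {0..2*pi}"
    using circle_mean_value_ln_cmod(1)[OF hol R zero_less_one nz] r unfolding eq by (simp add: G_def)
  show "(\<lambda>\<theta>. ln (cmod (of_real r * cis \<theta> - a))) absolutely_integrable_on {0..2*pi}"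
    using circle_mean_value_ln_cmod(2)[OF hol R zero_less_one nz] unfolding eq .
qed

text \<open>For \<open>\<bar>w\<bar> = 1\<close> and \<open>0 < \<rho> < 1\<close> the quantity \<open>\<bar>z - \<rho> w\<bar>\<^sup>2 / \<rho> = (1 - \<rho>)\<^sup>2 / \<rho> + \<bar>z - w\<bar>\<^sup>2\<close>
  decreases in \<open>\<rho>\<close>, so the singular integral is a monotone limit of regular ones.\<close>

lemma ln_cmod_minus_unit:
  assumes w: "cmod w = 1"
  shows "((\<lambda>\<theta>. ln (cmod (cis \<theta> - w))) has_integral 0) {0..2*pi}"
proof -
  define \<rho> where "\<rho> = (\<lambda>k::nat. 1 - inverse (real (k + 2)))"
  have \<rho>: "0 < \<rho> k" "\<rho> k < 1" "\<rho> k \<le> \<rho> (Suc k)" for k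
    by (auto simp: \<rho>_def field_simps)
  have \<rho>_lim: "\<rho> \<longlonglongrightarrow> 1"
  proof -
    have "(\<lambda>k. 1 - inverse (real (k + 2))) \<longlonglongrightarrow> 1 - 0"
      by (intro tendsto_diff tendsto_const LIMSEQ_ignore_initial_segment[OF lim_inverse_n])
    thus ?thesis by (simp add: \<rho>_def)
  qed
  \<comment> \<open>At the angle of \<open>w\<close> the limit function takes the default value
    \<open>ln 0 = 0\<close> while the approximations tend to minus infinity, so this angle is
    removed.\<close>
  define B where "B = {\<theta>\<in>{0..2*pi}. cis \<theta> \<in> {w}}"
  have B: "finite B" unfolding B_def by (rule finite_cis_preimage) auto
  define f where "f = (\<lambda>k \<theta>. 2 * ln (cmod (cis \<theta> - of_real (\<rho> k) * w)) - ln (\<rho> k))"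
  have int: "(f k has_integral - 2 * pi * ln (\<rho> k)) ({0..2*pi} - B)" for k
  proof -
    have "((\<lambda>\<theta>. ln (cmod (cis \<theta> - of_real (\<rho> k) * w))) has_integral 0) {0..2*pi}"
      using ln_cmod_minus_inside(1)[of "of_real (\<rho> k) * w" 1] \<rho>[of k] w by (simp add: norm_mult)
    from has_integral_diff[OF has_integral_mult_right[OF this, of 2] has_integral_const_real[of "ln (\<rho> k)" 0 "2*pi"]]
    have "(f k has_integral - 2 * pi * ln (\<rho> k)) {0..2*pi}" by (simp add: f_def)
    thus ?thesis using B by (subst has_integral_spike_set_eq[of _ "{0..2*pi}"]) (auto intro: negligible_subset[OF negligible_finite[OF B]])
  qed
  have id: "(cmod (cis \<theta> - of_real c * w))\<^sup>2 = (1 - c)\<^sup>2 + c * (cmod (cis \<theta> - w))\<^sup>2" for \<theta> c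
  proof -
    have gen: "(C - c * x)\<^sup>2 + (S - c * y)\<^sup>2 = (1 - c)\<^sup>2 + c * ((C - x)\<^sup>2 + (S - y)\<^sup>2)"
      if "x\<^sup>2 + y\<^sup>2 = 1" "C\<^sup>2 + S\<^sup>2 = 1" for x y C S :: real
      using that by algebra
    have "(Re w)\<^sup>2 + (Im w)\<^sup>2 = 1" using w by (metis cmod_power2 power_one)
    from gen[OF this, of "cos \<theta>" "sin \<theta>"] show ?thesis unfolding cmod_power2 by simp
  qed
  have pos: "0 < cmod (cis \<theta> - of_real (\<rho> k) * w)" for \<theta> k
  proof -
    have "cmod (of_real (\<rho> k) * w) < cmod (cis \<theta>)" using \<rho>[of k] w by (simp add: norm_mult)
    hence "cis \<theta> \<noteq> of_real (\<rho> k) * w" by (metis less_irrefl)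
    thus ?thesis by simp
  qed
  have f_eq: "f k \<theta> = ln ((1 - \<rho> k)\<^sup>2 / \<rho> k + (cmod (cis \<theta> - w))\<^sup>2)" for k \<theta>
  proof -
    have "f k \<theta> = ln ((cmod (cis \<theta> - of_real (\<rho> k) * w))\<^sup>2 / \<rho> k)"
      using pos \<rho>[of k] by (simp add: f_def ln_div ln_realpow)
    also have "(cmod (cis \<theta> - of_real (\<rho> k) * w))\<^sup>2 / \<rho> k = (1 - \<rho> k)\<^sup>2 / \<rho> k + (cmod (cis \<theta> - w))\<^sup>2"
      using \<rho>[of k] unfolding id by (simp add: field_simps)
    finally show ?thesis .
  qed
  have "(\<lambda>\<theta>. 2 * ln (cmod (cis \<theta> - w))) integrable_on ({0..2*pi} - B) \<and>
     (\<lambda>k. integral ({0..2*pi} - B) (f k)) \<longlonglongrightarrow> integral ({0..2*pi} - B) (\<lambda>\<theta>. 2 * ln (cmod (cis \<theta> - w)))"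
  proof (rule monotone_convergence_decreasing)
    show "f k integrable_on ({0..2*pi} - B)" for k using int by blast
    show "f (Suc k) \<theta> \<le> f k \<theta>" if "\<theta> \<in> {0..2*pi} - B" for k \<theta>
    proof -
      have "0 < cmod (cis \<theta> - w)" using that by (auto simp: B_def)
      moreover have "(1 - \<rho> (Suc k))\<^sup>2 / \<rho> (Suc k) \<le> (1 - \<rho> k)\<^sup>2 / \<rho> k"
        using \<rho>[of k] \<rho>[of "Suc k"] by (intro frac_le power_mono) auto
      moreover have "0 \<le> (1 - \<rho> (Suc k))\<^sup>2 / \<rho> (Suc k)" using \<rho>[of "Suc k"] by simp
      ultimately show ?thesis unfolding f_eq by (intro ln_mono) (auto simp: add_nonneg_pos)
    qed
    show "(\<lambda>k. f k \<theta>) \<longlonglongrightarrow> 2 * ln (cmod (cis \<theta> - w))" if "\<theta> \<in> {0..2*pi} - B" for \<theta>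
    proof -
      have nz: "cis \<theta> - w \<noteq> 0" using that by (auto simp: B_def)
      have "(\<lambda>k. 2 * ln (cmod (cis \<theta> - of_real (\<rho> k) * w)) - ln (\<rho> k)) \<longlonglongrightarrow> 2 * ln (cmod (cis \<theta> - of_real 1 * w)) - ln 1"
        by (intro tendsto_intros \<rho>_lim) (use nz in auto)
      thus ?thesis by (simp add: f_def)
    qed
    have "(\<lambda>k. - 2 * pi * ln (\<rho> k)) \<longlonglongrightarrow> - 2 * pi * ln 1"
      by (intro tendsto_intros \<rho>_lim) auto
    hence "bounded (range (\<lambda>k. - 2 * pi * ln (\<rho> k)))" by (rule convergent_imp_bounded)
    thus "bounded (range (\<lambda>k. integral ({0..2*pi} - B) (f k)))"
      using integral_unique[OF int] by simp
  qed
  note lim1 = this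
  have lim2: "(\<lambda>k. integral ({0..2*pi} - B) (f k)) \<longlonglongrightarrow> - 2 * pi * ln 1"
    unfolding integral_unique[OF int] by (intro tendsto_intros \<rho>_lim) auto
  have "(\<lambda>\<theta>. 2 * ln (cmod (cis \<theta> - w))) integrable_on ({0..2*pi} - B)"
      "integral ({0..2*pi} - B) (\<lambda>\<theta>. 2 * ln (cmod (cis \<theta> - w))) = 0"
    using lim1 LIMSEQ_unique[OF conjunct2[OF lim1] lim2] by simp_all
  hence "((\<lambda>\<theta>. 2 * ln (cmod (cis \<theta> - w))) has_integral 0) ({0..2*pi} - B)"
    by (simp only: has_integral_integrable_integral)
  hence "((\<lambda>\<theta>. 2 * ln (cmod (cis \<theta> - w))) has_integral 0) {0..2*pi}"
    using B by (subst has_integral_spike_set_eq[of _ "{0..2*pi} - B"]) (auto intro: negligible_subset[OF negligible_finite[OF B]])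
  from has_integral_mult_right[OF this, of "1/2"] show ?thesis by simp
qed

lemma ln_cmod_minus:
  assumes "cmod a \<le> r" "0 < r"
  shows "((\<lambda>\<theta>. ln (cmod (of_real r * cis \<theta> - a))) has_integral 2 * pi * ln r) {0..2*pi}"
    and "(\<lambda>\<theta>. ln (cmod (of_real r * cis \<theta> - a))) absolutely_integrable_on {0..2*pi}"
proof -
  have "((\<lambda>\<theta>. ln (cmod (of_real r * cis \<theta> - a))) has_integral 2 * pi * ln r) {0..2*pi} \<and>
    (\<lambda>\<theta>. ln (cmod (of_real r * cis \<theta> - a))) absolutely_integrable_on {0..2*pi}"
  proof (cases "cmod a = r")
    case False
    thus ?thesis using assms ln_cmod_minus_inside[of a r] by auto
  next
    case True
    define w where "w = a / of_real r"
    have w: "cmod w = 1" using True assms by (simp add: w_def norm_divide)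
    have fin: "finite {\<theta>\<in>{0..2*pi}. cis \<theta> \<in> {w}}" by (rule finite_cis_preimage) auto
    have "((\<lambda>\<theta>. ln r + ln (cmod (cis \<theta> - w))) has_integral 2 * pi * ln r) {0..2*pi}"
      using has_integral_add[OF has_integral_const_real[of "ln r" 0 "2*pi"] ln_cmod_minus_unit[OF w]] by simp
    hence 1: "((\<lambda>\<theta>. ln (cmod (of_real r * cis \<theta> - a))) has_integral 2 * pi * ln r) {0..2*pi}"
    proof (rule has_integral_spike_finite[OF fin, rotated])
      fix \<theta> assume "\<theta> \<in> {0..2*pi} - {\<theta>\<in>{0..2*pi}. cis \<theta> \<in> {w}}"
      hence "cis \<theta> \<noteq> w" by auto
      moreover have "of_real r * cis \<theta> - a = of_real r * (cis \<theta> - w)"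
        using assms by (simp add: w_def right_diff_distrib)
      hence "cmod (of_real r * cis \<theta> - a) = r * cmod (cis \<theta> - w)" using assms by (simp add: norm_mult)
      ultimately show "ln (cmod (of_real r * cis \<theta> - a)) = ln r + ln (cmod (cis \<theta> - w))"
        using assms by (simp add: ln_mult)
    qed
    have ub: "ln (cmod (of_real r * cis \<theta> - a)) \<le> ln (max 1 (2 * r))" for \<theta>
    proof (cases "of_real r * cis \<theta> - a = 0")
      case False
      have "cmod (of_real r * cis \<theta> - a) \<le> 2 * r"
        using norm_triangle_ineq4[of "of_real r * cis \<theta>" a] True assms by (simp add: norm_mult)
      thus ?thesis using False by (intro ln_mono) auto
    qed auto
    \<comment> \<open>An integrable function that is bounded above is a constant minus a nonnegative
      integrable one, hence absolutely integrable.\<close>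
    have "(\<lambda>\<theta>. ln (max 1 (2 * r)) - ln (cmod (of_real r * cis \<theta> - a))) absolutely_integrable_on {0..2*pi}"
      using 1 ub by (intro nonnegative_absolutely_integrable_1 integrable_diff) (auto simp: integrable_on_def)
    from set_integral_diff(1)[OF absolutely_integrable_on_const[of "{0..2*pi}" "ln (max 1 (2 * r))"] this]
    have "(\<lambda>\<theta>. ln (cmod (of_real r * cis \<theta> - a))) absolutely_integrable_on {0..2*pi}" by simp
    with 1 show ?thesis by blast
  qed
  thus "((\<lambda>\<theta>. ln (cmod (of_real r * cis \<theta> - a))) has_integral 2 * pi * ln r) {0..2*pi}"
    and "(\<lambda>\<theta>. ln (cmod (of_real r * cis \<theta> - a))) absolutely_integrable_on {0..2*pi}" by auto
qed

lemma jensen_factorized: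
  assumes G: "G holomorphic_on ball 0 R" "\<And>z. z \<in> ball 0 R \<Longrightarrow> G z \<noteq> 0" and r: "0 < r" "r < R"
    and Z: "finite Z" "Z \<subseteq> cball 0 r"
    and g: "\<And>z. cmod z = r \<Longrightarrow> g z = (\<Prod>a\<in>Z. (z - a) ^ m a) * G z"
  shows "((\<lambda>\<theta>. ln (cmod (g (of_real r * cis \<theta>)))) has_integral
            2 * pi * ((\<Sum>a\<in>Z. real (m a) * ln r) + ln (cmod (G 0)))) {0..2*pi}"
    and "(\<lambda>\<theta>. ln (cmod (g (of_real r * cis \<theta>)))) absolutely_integrable_on {0..2*pi}"
proof -
  define h where "h = (\<lambda>\<theta>. (\<Sum>a\<in>Z. real (m a) * ln (cmod (of_real r * cis \<theta> - a))) + ln (cmod (G (of_real r * cis \<theta>))))"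
  define B where "B = {\<theta>\<in>{0..2*pi}. of_real r * cis \<theta> \<in> Z}"
  have B: "finite B" unfolding B_def by (rule finite_circle_preimage) (use Z r in auto)
  have eq: "ln (cmod (g (of_real r * cis \<theta>))) = h \<theta>" if "\<theta> \<in> {0..2*pi} - B" for \<theta>
  proof -
    have c: "cmod (of_real r * cis \<theta>) = r" using r by (simp add: norm_mult)
    have nz: "of_real r * cis \<theta> - a \<noteq> 0" if "a \<in> Z" for a
      using that \<open>\<theta> \<in> {0..2*pi} - B\<close> by (auto simp: B_def)
    have "ln (cmod (g (of_real r * cis \<theta>)))
      = ln ((\<Prod>a\<in>Z. cmod (of_real r * cis \<theta> - a) ^ m a) * cmod (G (of_real r * cis \<theta>)))"
      unfolding g[OF c] by (simp add: norm_mult norm_power flip: prod_norm)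
    also have "\<dots> = ln (\<Prod>a\<in>Z. cmod (of_real r * cis \<theta> - a) ^ m a) + ln (cmod (G (of_real r * cis \<theta>)))"
      using nz Z(1) G(2)[of "of_real r * cis \<theta>"] c r by (simp add: ln_mult)
    also have "ln (\<Prod>a\<in>Z. cmod (of_real r * cis \<theta> - a) ^ m a) = (\<Sum>a\<in>Z. ln (cmod (of_real r * cis \<theta> - a) ^ m a))"
      using nz Z by (intro ln_prod) auto
    also have "\<dots> = (\<Sum>a\<in>Z. real (m a) * ln (cmod (of_real r * cis \<theta> - a)))"
      using nz by (intro sum.cong) (auto simp: ln_realpow)
    finally show ?thesis by (simp add: h_def)
  qed
  have "(h has_integral ((\<Sum>a\<in>Z. real (m a) * (2 * pi * ln r)) + 2 * pi * ln (cmod (G 0)))) {0..2*pi}"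
    unfolding h_def
  proof (rule has_integral_add)
    show "((\<lambda>\<theta>. \<Sum>a\<in>Z. real (m a) * ln (cmod (of_real r * cis \<theta> - a))) has_integral
       (\<Sum>a\<in>Z. real (m a) * (2 * pi * ln r))) {0..2*pi}"
      using Z r by (intro has_integral_sum, blast, intro has_integral_mult_right[OF ln_cmod_minus(1)]) auto
  qed (rule circle_mean_value_ln_cmod(1)[OF G(1) r(2,1) G(2)])
  note h_int = this
  have "((\<lambda>\<theta>. ln (cmod (g (of_real r * cis \<theta>)))) has_integral
      ((\<Sum>a\<in>Z. real (m a) * (2 * pi * ln r)) + 2 * pi * ln (cmod (G 0)))) {0..2*pi}"
    by (rule has_integral_spike_finite[OF B eq h_int])
  thus "((\<lambda>\<theta>. ln (cmod (g (of_real r * cis \<theta>)))) has_integral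
            2 * pi * ((\<Sum>a\<in>Z. real (m a) * ln r) + ln (cmod (G 0)))) {0..2*pi}"
    by (simp add: distrib_left sum_distrib_left mult_ac)
  have "h absolutely_integrable_on {0..2*pi}"
    unfolding h_def
  proof (rule set_integral_add(1))
    show "(\<lambda>\<theta>. \<Sum>a\<in>Z. real (m a) * ln (cmod (of_real r * cis \<theta> - a))) absolutely_integrable_on {0..2*pi}"
      using Z r by (intro absolutely_integrable_sum, blast, intro set_integrable_mult_right ln_cmod_minus(2)) auto
  qed (rule circle_mean_value_ln_cmod(2)[OF G(1) r(2,1) G(2)])
  thus "(\<lambda>\<theta>. ln (cmod (g (of_real r * cis \<theta>)))) absolutely_integrable_on {0..2*pi}"
    by (rule absolutely_integrable_spike[OF _ negligible_finite[OF B]]) (use eq in auto)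
qed

text \<open>\<open>G\<close> has no zeros in the closed disc of radius \<open>r\<close> and finitely
  many in that of radius r + 1, so a zero-free open disc of radius R > r exists. On it
  \<open>G\<close> has a holomorphic logarithm, defined past the circle of integration.\<close>

lemma entire_factor_disc:
  assumes "g holomorphic_on UNIV" "g w \<noteq> 0" "0 < r"
  obtains m R G where "G holomorphic_on UNIV" "r < R" "\<And>z. z \<in> ball 0 R \<Longrightarrow> G z \<noteq> 0"
    "\<And>z. g z = (\<Prod>a | cmod a \<le> r \<and> g a = 0. (z - a) ^ m a) * G z"
    "\<And>a. g a = 0 \<Longrightarrow> cmod a \<le> r \<Longrightarrow> 1 \<le> m a"
    "\<And>a. g a = 0 \<Longrightarrow> cmod a \<le> r \<Longrightarrow> deriv g a \<noteq> 0 \<Longrightarrow> m a = 1"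
proof -
  define Z where "Z = {a. cmod a \<le> r \<and> g a = 0}"
  have Z: "finite Z" unfolding Z_def by (rule entire_zeros_finite[OF assms(1,2)])
  obtain m G where G: "G holomorphic_on UNIV" "\<And>a. a \<in> Z \<Longrightarrow> G a \<noteq> 0"
    and g: "\<And>z. g z = (\<Prod>a\<in>Z. (z - a) ^ m a) * G z"
    using entire_factor_finite[OF assms(1,2) Z] by metis
  have nz: "G z \<noteq> 0" if "z \<in> cball 0 r" for z
    using G(2)[of z] that g[of z] unfolding Z_def by auto
  define Y where "Y = {z. cmod z \<le> r + 1 \<and> G z = 0}"
  have Y: "finite Y" unfolding Y_def
    by (rule entire_zeros_finite[OF G(1), of w]) (use g[of w] assms(2) in auto)
  define R where "R = Min (insert (r + 1) (cmod ` Y))"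
  have R: "r < R" unfolding R_def using Y nz by (subst Min_gr_iff) (auto simp: Y_def not_le[symmetric])
  have nz': "G z \<noteq> 0" if "z \<in> ball 0 R" for z
  proof
    assume "G z = 0"
    moreover have "R \<le> r + 1" unfolding R_def using Y by simp
    ultimately have "z \<in> Y" using that by (auto simp: Y_def)
    hence "R \<le> cmod z" unfolding R_def using Y by simp
    thus False using that by simp
  qed
  have m1: "1 \<le> m a" if "a \<in> Z" for a
  proof (rule ccontr)
    assume "\<not> 1 \<le> m a"
    hence "m a = 0" by simp
    moreover have "(\<Prod>b\<in>Z. (a - b) ^ m b) = 0" using g[of a] G(2)[OF that] that by (auto simp: Z_def)
    ultimately show False using Z by (auto simp: prod_zero_iff)
  qed
  have m2: "m a = 1" if "a \<in> Z" "deriv g a \<noteq> 0" for a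
  proof (rule ccontr)
    assume "m a \<noteq> 1"
    hence "2 \<le> m a" using m1[OF that(1)] by simp
    then obtain k where k: "m a = Suc (Suc k)" by (metis One_nat_def add_2_eq_Suc le_Suc_ex)
    \<comment> \<open>An exponent of at least 2 would make the derivative of \<open>g\<close> vanish
      at \<open>a\<close>.\<close>
    define H where "H = (\<lambda>z. (z - a) ^ k * (\<Prod>b\<in>Z - {a}. (z - b) ^ m b) * G z)"
    have H: "H holomorphic_on UNIV" unfolding H_def by (intro holomorphic_intros G(1))
    have "g = (\<lambda>z. (z - a)\<^sup>2 * H z)"
      unfolding fun_eq_iff g H_def prod.remove[OF Z that(1)] k by (auto simp: power2_eq_square)
    moreover have "((\<lambda>z. (z - a)\<^sup>2 * H z) has_field_derivative 0) (at a)"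
      by (rule DERIV_cong[OF DERIV_mult[OF DERIV_power[OF DERIV_diff[OF DERIV_ident DERIV_const]]
          holomorphic_derivI[OF H open_UNIV UNIV_I]]]) simp
    ultimately show False using that(2) DERIV_imp_deriv by blast
  qed
  show ?thesis
    by (rule that[OF G(1) R nz' g[unfolded Z_def]]) (assumption | (rule m1 m2; simp add: Z_def))+
qed

text \<open>The multiplicities \<open>m\<close> are specified only through the two properties that
  the later counting arguments use.\<close>

lemma jensen:
  assumes g: "g holomorphic_on UNIV" "g 0 \<noteq> 0" and r: "0 < r"
  obtains m where
    "\<And>a. g a = 0 \<Longrightarrow> cmod a \<le> r \<Longrightarrow> 1 \<le> m a"
    "\<And>a. g a = 0 \<Longrightarrow> cmod a \<le> r \<Longrightarrow> deriv g a \<noteq> 0 \<Longrightarrow> m a = (1::nat)"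
    "((\<lambda>\<theta>. ln (cmod (g (of_real r * cis \<theta>)))) has_integral
        2 * pi * (ln (cmod (g 0)) + (\<Sum>a | cmod a \<le> r \<and> g a = 0. real (m a) * ln (r / cmod a)))) {0..2*pi}"
    "(\<lambda>\<theta>. ln (cmod (g (of_real r * cis \<theta>)))) absolutely_integrable_on {0..2*pi}"
proof -
  define Z where "Z = {a. cmod a \<le> r \<and> g a = 0}"
  have Z: "finite Z" unfolding Z_def by (rule entire_zeros_finite[OF assms(1,2)])
  obtain m R G where G: "G holomorphic_on UNIV" "r < R" "\<And>z. z \<in> ball 0 R \<Longrightarrow> G z \<noteq> 0"
    and fac: "\<And>z. g z = (\<Prod>a\<in>Z. (z - a) ^ m a) * G z"
    and m: "\<And>a. g a = 0 \<Longrightarrow> cmod a \<le> r \<Longrightarrow> 1 \<le> m a"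
    "\<And>a. g a = 0 \<Longrightarrow> cmod a \<le> r \<Longrightarrow> deriv g a \<noteq> 0 \<Longrightarrow> m a = 1"
    by (rule entire_factor_disc[OF g r, folded Z_def]) (rule that; assumption)
  note J = jensen_factorized[OF holomorphic_on_subset[OF G(1) subset_UNIV] G(3) r G(2) Z _ fac]
  have sub: "Z \<subseteq> cball 0 r" by (auto simp: Z_def)
  have nz: "a \<noteq> 0" if "a \<in> Z" for a using that g(2) by (auto simp: Z_def)
  have "ln (cmod (g 0)) = ln ((\<Prod>a\<in>Z. cmod a ^ m a) * cmod (G 0))"
    unfolding fac[of 0] by (simp add: norm_mult norm_power flip: prod_norm)
  also have "\<dots> = ln (\<Prod>a\<in>Z. cmod a ^ m a) + ln (cmod (G 0))"
    using nz Z(1) G(3)[of 0] r G(2) by (simp add: ln_mult)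
  also have "ln (\<Prod>a\<in>Z. cmod a ^ m a) = (\<Sum>a\<in>Z. ln (cmod a ^ m a))"
    using nz Z by (intro ln_prod) auto
  also have "\<dots> = (\<Sum>a\<in>Z. real (m a) * ln (cmod a))"
    using nz by (intro sum.cong) (auto simp: ln_realpow)
  finally have "(\<Sum>a\<in>Z. real (m a) * ln r) + ln (cmod (G 0))
      = ln (cmod (g 0)) + ((\<Sum>a\<in>Z. real (m a) * ln r) - (\<Sum>a\<in>Z. real (m a) * ln (cmod a)))"
    by simp
  also have "(\<Sum>a\<in>Z. real (m a) * ln r) - (\<Sum>a\<in>Z. real (m a) * ln (cmod a)) = (\<Sum>a\<in>Z. real (m a) * ln (r / cmod a))"
    unfolding sum_subtractf[symmetric] using nz r by (intro sum.cong) (auto simp: ln_div right_diff_distrib)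
  finally show ?thesis using J[OF _ sub] m by (intro that[of m, folded Z_def]) simp_all
qed

section \<open>Logarithmic derivatives and polynomial coefficients\<close>

text \<open>2 pi times the Nevanlinna proximity function of \<open>g\<close>; without the
  normalisation it compares directly with the integral in Jensen's formula.\<close>

definition proximity_integral :: "(complex \<Rightarrow> complex) \<Rightarrow> real \<Rightarrow> real" where
  "proximity_integral g r = integral {0..2*pi} (\<lambda>\<theta>. ln (max 1 (cmod (g (of_real r * cis \<theta>)))))"

lemma ln_max_one_continuous:
  assumes "continuous_on UNIV g"
  shows "continuous_on S (\<lambda>\<theta>. ln (max 1 (cmod (g (of_real r * cis \<theta>)))))"
  by (intro continuous_intros continuous_on_compose2[OF assms]) auto

lemma ln_max_one_integrable:
  assumes "g holomorphic_on UNIV"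
  shows "(\<lambda>\<theta>. ln (max 1 (cmod (g (of_real r * cis \<theta>))))) integrable_on {0..2*pi}"
  by (intro integrable_continuous_real ln_max_one_continuous holomorphic_on_imp_continuous_on assms)

text \<open>Converts an upper bound for the mean of ln+ together with Jensen's lower bound for the
  mean of ln into a bound for the mean of |ln|. At x = 0 it rests on the convention
  \<open>ln 0 = 0\<close>.\<close>

lemma abs_ln_eq: "\<bar>ln x\<bar> = 2 * ln (max 1 x) - ln x" if "0 \<le> x" for x :: real
  using that by (cases "1 \<le> x"; cases "x = 0") (auto simp: max_def abs_if)

lemma ln_le_ln_max_one: "ln x \<le> ln (max 1 x)" if "0 \<le> x" for x :: real
  using abs_ln_eq[OF that] by linarith

text \<open>The Schwarz formula for the derivative: on the circle the conjugate of \<open>L\<close> is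
  orthogonal to the Cauchy kernel.\<close>

lemma deriv_eq_integral_Re:
  assumes L: "L holomorphic_on ball 0 R" and r: "0 < r" "r < R" and z: "cmod z < r"
  shows "((\<lambda>\<theta>. of_real (Re (L (of_real r * cis \<theta>))) * (of_real r * cis \<theta> / (of_real r * cis \<theta> - z)\<^sup>2))
           has_integral of_real pi * deriv L z) {0..2*pi}"
proof -
  define w where "w \<theta> = of_real r * cis \<theta>" for \<theta>
  have cw: "cmod (w \<theta>) = r" "w \<theta> \<noteq> 0" "w \<theta> - z \<noteq> 0" for \<theta> using r z by (auto simp: w_def norm_mult)
  have cont: "continuous_on (cball 0 r) L"
    using L r by (intro holomorphic_on_imp_continuous_on holomorphic_on_subset[OF L]) auto
  have hol: "L holomorphic_on ball 0 r" by (rule holomorphic_on_subset[OF L]) (use r in auto)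
  note C = Cauchy_derivative_integral_circlepath[OF cont hol, of z]
  have "((\<lambda>u. L u / (u - z)^2) has_contour_integral (2 * of_real pi * \<i> * deriv L z)) (circlepath 0 r)"
    using C z by (simp add: has_contour_integral_integral DERIV_imp_deriv)
  hence "((\<lambda>t. L (w t) / (w t - z)\<^sup>2 * r * \<i> * cis t) has_integral (2 * of_real pi * \<i> * deriv L z)) {0..2*pi}"
    unfolding circlepath_def w_def by (subst (asm) has_contour_integral_part_circlepath_iff) auto
  from has_integral_mult_right[OF this, of "- \<i>"]
  have 1: "((\<lambda>t. L (w t) * (w t / (w t - z)\<^sup>2)) has_integral (2 * of_real pi * deriv L z)) {0..2*pi}"
    by (simp add: w_def mult_ac)
  \<comment> \<open>On the circle cnj w = r^2 / w, so \<open>cnj (H w)\<close> is cnj (L w) times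
    the kernel of Cauchy's formula for the derivative. The factor \<open>u\<close> gives H 0 = 0, so
    its mean vanishes, and adding it replaces \<open>L\<close> by 2 Re L.\<close>
  define H where "H = (\<lambda>u. L u * (of_real r ^ 2 * u / (of_real r ^ 2 - cnj z * u)\<^sup>2))"
  \<comment> \<open>The kernel in \<open>H\<close> has its pole at the reflection of
    \<open>z\<close> in the circle, of modulus r^2 / |z| > r.\<close>
  define S where "S = (if z = 0 then R else min R (r\<^sup>2 / cmod z))"
  have S: "r < S" using r z by (auto simp: S_def field_simps power2_eq_square)
  have nz: "of_real r ^ 2 - cnj z * u \<noteq> 0" if "u \<in> ball 0 S" for u
  proof
    assume "of_real r ^ 2 - cnj z * u = 0"
    hence "cmod (of_real r ^ 2) = cmod (cnj z * u)" by simp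
    hence "r\<^sup>2 = cmod z * cmod u" by (simp add: norm_mult norm_power)
    thus False using that r by (auto simp: S_def field_simps split: if_splits)
  qed
  have "H holomorphic_on ball 0 S" unfolding H_def
    by (intro holomorphic_intros holomorphic_on_subset[OF L]) (use nz in \<open>auto simp: S_def\<close>)
  from circle_mean_value[OF this, of r] have "((\<lambda>t. H (w t)) has_integral 0) {0..2*pi}"
    using r S by (simp add: w_def H_def cball_subset_ball_iff)
  from has_integral_linear[OF this bounded_linear_cnj]
  have 2: "((\<lambda>t. cnj (H (w t))) has_integral 0) {0..2*pi}" by (simp add: o_def)
  have eq: "cnj (H (w t)) = cnj (L (w t)) * (w t / (w t - z)\<^sup>2)" for t
  proof -
    have cn: "cnj (w t) = of_real r ^ 2 / w t"
      using cw[of t] complex_norm_square[of "w t"] by (simp add: field_simps)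
    have "of_real r ^ 2 - z * (of_real r ^ 2 / w t) = of_real r ^ 2 * (w t - z) / w t"
      using cw(2)[of t] by (simp add: field_simps)
    hence "cnj (H (w t)) = cnj (L (w t)) * (of_real r ^ 2 * (of_real r ^ 2 / w t) / (of_real r ^ 2 * (w t - z) / w t)\<^sup>2)"
      by (simp add: H_def cn)
    also have "of_real r ^ 2 * (of_real r ^ 2 / w t) / (of_real r ^ 2 * (w t - z) / w t)\<^sup>2 = w t / (w t - z)\<^sup>2"
    proof -
      have kern: "K * (K / u) / (K * v / u)\<^sup>2 = u / v\<^sup>2" if "K \<noteq> 0" "u \<noteq> 0" "v \<noteq> 0" for K u v :: complex
        using that by (simp add: field_simps power2_eq_square)
      show ?thesis by (rule kern) (use cw(2,3)[of t] r in auto)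
    qed
    finally show ?thesis .
  qed
  have "((\<lambda>t. L (w t) * (w t / (w t - z)\<^sup>2) + cnj (H (w t))) has_integral (2 * of_real pi * deriv L z + 0)) {0..2*pi}"
    by (rule has_integral_add[OF 1 2])
  moreover have "a * k + cnj a * k = 2 * (of_real (Re a) * k)" for a k
    by (simp only: distrib_right[symmetric] complex_add_cnj) simp
  ultimately have "((\<lambda>t. 2 * (of_real (Re (L (w t))) * (w t / (w t - z)\<^sup>2))) has_integral (2 * of_real pi * deriv L z)) {0..2*pi}"
    unfolding eq by (simp only: add_0_right)
  from has_integral_mult_right[OF this, of "1/2"] show ?thesis by (simp add: w_def)
qed

text \<open>For |z| \<le> 3/4 r the kernel is at most r / (r/4)^2. The bound up to 3/4 r, not just r
  / 2, leaves room for a Cauchy estimate of the second derivative on |z| \<le> r / 2.\<close>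

lemma norm_deriv_le_integral_Re:
  assumes L: "L holomorphic_on ball 0 R" and r: "0 < r" "r < R" and z: "cmod z \<le> 3/4 * r"
  shows "cmod (deriv L z) \<le> 16 / (pi * r) * integral {0..2*pi} (\<lambda>\<theta>. \<bar>Re (L (of_real r * cis \<theta>))\<bar>)"
proof -
  define w where "w \<theta> = of_real r * cis \<theta>" for \<theta>
  have cw: "cmod (w \<theta>) = r" for \<theta> using r by (auto simp: w_def norm_mult)
  have z': "cmod z < r" using z r by linarith
  note I = deriv_eq_integral_Re[OF L r z', folded w_def]
  have cont: "continuous_on {0..2*pi} (\<lambda>\<theta>. \<bar>Re (L (w \<theta>))\<bar>)"
    unfolding w_def
    by (intro continuous_intros continuous_on_compose2[OF holomorphic_on_imp_continuous_on[OF L]])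
       (use r in \<open>auto simp: norm_mult\<close>)
  have "cmod (integral {0..2*pi} (\<lambda>\<theta>. of_real (Re (L (w \<theta>))) * (w \<theta> / (w \<theta> - z)\<^sup>2)))
     \<le> integral {0..2*pi} (\<lambda>\<theta>. 16 / r * \<bar>Re (L (w \<theta>))\<bar>)"
  proof (rule integral_norm_bound_integral)
    show "(\<lambda>\<theta>. of_real (Re (L (w \<theta>))) * (w \<theta> / (w \<theta> - z)\<^sup>2)) integrable_on {0..2*pi}"
      using I by blast
    show "(\<lambda>\<theta>. 16 / r * \<bar>Re (L (w \<theta>))\<bar>) integrable_on {0..2*pi}"
      by (rule integrable_continuous_real[OF continuous_on_mult_left[OF cont]])
    fix \<theta>
    have "r / 4 \<le> cmod (w \<theta> - z)" using norm_triangle_ineq2[of "w \<theta>" z] z cw[of \<theta>] by linarith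
    hence "(r / 4)\<^sup>2 \<le> (cmod (w \<theta> - z))\<^sup>2" using r by (intro power_mono) auto
    hence "r / (cmod (w \<theta> - z))\<^sup>2 \<le> r / (r / 4)\<^sup>2" using r
      by (intro divide_left_mono) (auto intro!: mult_pos_pos simp: less_le_trans[OF _ \<open>(r / 4)\<^sup>2 \<le> _\<close>])
    also have "\<dots> = 16 / r" using r by (simp add: power2_eq_square)
    finally show "cmod (of_real (Re (L (w \<theta>))) * (w \<theta> / (w \<theta> - z)\<^sup>2)) \<le> 16 / r * \<bar>Re (L (w \<theta>))\<bar>"
      using mult_right_mono[of "r / (cmod (w \<theta> - z))\<^sup>2" "16 / r" "\<bar>Re (L (w \<theta>))\<bar>"]
      by (simp add: norm_mult norm_divide norm_power cw mult_ac)
  qed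
  also have "integral {0..2*pi} (\<lambda>\<theta>. of_real (Re (L (w \<theta>))) * (w \<theta> / (w \<theta> - z)\<^sup>2)) = of_real pi * deriv L z"
    using I by (rule integral_unique)
  finally have "pi * cmod (deriv L z) \<le> 16 / r * integral {0..2*pi} (\<lambda>\<theta>. \<bar>Re (L (w \<theta>))\<bar>)"
    by (simp add: norm_mult)
  hence "cmod (deriv L z) \<le> 16 / r * integral {0..2*pi} (\<lambda>\<theta>. \<bar>Re (L (w \<theta>))\<bar>) / pi"
    using pos_le_divide_eq[OF pi_gt_zero, of "cmod (deriv L z)"] by (metis mult.commute)
  thus ?thesis unfolding w_def by (simp add: mult_ac)
qed

text \<open>Pigeonhole: among equally spaced radii, one more than there are points, each point is
  too close to at most one, so some radius is free.\<close>

lemma circle_avoiding_points: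
  fixes r :: real
  assumes "finite Z" "0 < r"
  obtains \<rho> where "r / 4 \<le> \<rho>" "\<rho> \<le> r / 2"
    "\<And>a :: complex. a \<in> Z \<Longrightarrow> r / (8 * (real (card Z) + 1)) \<le> \<bar>\<rho> - cmod a\<bar>"
proof -
  define N where "N = card Z + 1"
  define x where "x = (\<lambda>i::nat. r / 4 + real i * (r / (4 * real N)))"
  define d where "d = r / (8 * real N)"
  have N: "0 < real N" by (simp add: N_def)
  have "\<exists>i\<in>{..<N}. \<forall>a\<in>Z. d \<le> \<bar>x i - cmod a\<bar>"
  proof (rule ccontr)
    assume "\<not> ?thesis"
    hence "\<forall>i\<in>{..<N}. \<exists>a\<in>Z. \<bar>x i - cmod a\<bar> < d" by (auto simp: not_le)
    then obtain h where h: "\<And>i. i < N \<Longrightarrow> h i \<in> Z" "\<And>i. i < N \<Longrightarrow> \<bar>x i - cmod (h i)\<bar> < d"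
      by (metis lessThan_iff)
    have "inj_on h {..<N}"
    proof (rule inj_onI)
      fix i j assume ij: "i \<in> {..<N}" "j \<in> {..<N}" "h i = h j"
      have "\<bar>x i - x j\<bar> < 2 * d" using h(2)[of i] h(2)[of j] ij by auto
      also have "x i - x j = (real i - real j) * (2 * d)" using N by (simp add: x_def d_def field_simps)
      finally have "\<bar>real i - real j\<bar> * (2 * d) < 1 * (2 * d)"
        using assms N by (simp add: abs_mult d_def)
      moreover have "0 < 2 * d" using assms N by (simp add: d_def)
      ultimately have "\<bar>real i - real j\<bar> < 1" by (simp only: mult_less_cancel_right_pos)
      thus "i = j" by linarith
    qed
    hence "N \<le> card Z" using card_inj_on_le[of h "{..<N}" Z] h(1) assms by auto
    thus False by (simp add: N_def)
  qed
  then obtain i where i: "i < N" "\<And>a. a \<in> Z \<Longrightarrow> d \<le> \<bar>x i - cmod a\<bar>" by auto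
  have "real i * (r / (4 * real N)) \<le> real N * (r / (4 * real N))"
    using i assms by (intro mult_right_mono) auto
  moreover have "real N * (r / (4 * real N)) = r / 4" using N by simp
  ultimately have "x i \<le> r / 2" unfolding x_def by linarith
  moreover have "r / 4 \<le> x i" using assms by (simp add: x_def)
  moreover have "d = r / (8 * (real (card Z) + 1))" by (simp add: d_def N_def)
  ultimately show ?thesis using i(2) that[of "x i"] by metis
qed

text \<open>In the disc \<open>g\<close> is the product of the z - a times exp L. Jensen's formula
  at radius 2 r counts the zeros, the mean of |Re L| bounds L', and a radius away from the zeros
  bounds the rational part. \<open>X\<close> majorises \<open>r\<close> and all data, so each
  estimate is a numerical constant, generously chosen, times a power of \<open>X\<close>.\<close>

lemma log_derivative_on_circle:
  assumes g: "g holomorphic_on UNIV" "g 0 \<noteq> 0" and simple: "\<And>a. g a = 0 \<Longrightarrow> deriv g a \<noteq> 0"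
    and r: "1 \<le> r" and X: "r \<le> X" "\<bar>ln (cmod (g 0))\<bar> \<le> X"
    and I: "proximity_integral g r \<le> X" "proximity_integral g (2 * r) \<le> X"
  obtains \<rho> where "r / 4 \<le> \<rho>" "\<rho> \<le> r / 2"
    "\<And>z. cmod z = \<rho> \<Longrightarrow> g z \<noteq> 0"
    "\<And>z. cmod z = \<rho> \<Longrightarrow> cmod (deriv g z / g z) \<le> 2000 * X ^ 2"
    "\<And>z. cmod z = \<rho> \<Longrightarrow> cmod (deriv (deriv g) z / g z) \<le> 5000000 * X ^ 4"
proof -
  define w where "w \<theta> = of_real r * cis \<theta>" for \<theta>
  define Z where "Z = {a. cmod a \<le> r \<and> g a = 0}"
  define n where "n = card Z"
  have r0: "0 < r" using r by simp
  have Z: "finite Z" unfolding Z_def by (rule entire_zeros_finite[OF g])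
  have Z2: "finite {a. cmod a \<le> 2 * r \<and> g a = 0}" by (rule entire_zeros_finite[OF g])
  have nz0: "a \<noteq> 0" if "g a = 0" for a using that g(2) by auto
  have upper: "integral {0..2*pi} (\<lambda>\<theta>. ln (cmod (g (of_real s * cis \<theta>)))) \<le> proximity_integral g s"
    if "(\<lambda>\<theta>. ln (cmod (g (of_real s * cis \<theta>)))) integrable_on {0..2*pi}" for s
    unfolding proximity_integral_def
    by (intro integral_le that ln_max_one_integrable g ln_le_ln_max_one) auto
  text \<open>Jensen's formula on the doubled circle bounds the number of zeros.\<close>
  have n: "real n \<le> 2 * X"
  proof -
    obtain m where m: "\<And>a. g a = 0 \<Longrightarrow> cmod a \<le> 2 * r \<Longrightarrow> 1 \<le> m a"
      and J: "((\<lambda>\<theta>. ln (cmod (g (of_real (2 * r) * cis \<theta>)))) has_integral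
        2 * pi * (ln (cmod (g 0)) + (\<Sum>a | cmod a \<le> 2 * r \<and> g a = 0. real (m a) * ln (2 * r / cmod a)))) {0..2*pi}"
      by (rule jensen[OF g, of "2 * r"]) (use r0 in auto)
    \<comment> \<open>A zero in the inner disc contributes at least ln 2 to Jensen's sum for the
      doubled radius.\<close>
    have each: "ln 2 \<le> real (m a) * ln (2 * r / cmod a)" if "a \<in> Z" for a
    proof -
      have "2 \<le> 2 * r / cmod a" using that nz0[of a] by (auto simp: Z_def field_simps)
      hence "ln 2 \<le> ln (2 * r / cmod a)" by (intro ln_mono) auto
      moreover have "1 \<le> real (m a)" using m[of a] that r0 by (auto simp: Z_def)
      ultimately show ?thesis using mult_mono[of 1 "real (m a)" "ln 2" "ln (2 * r / cmod a)"] by simp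
    qed
    have "real n * ln 2 \<le> (\<Sum>a\<in>Z. real (m a) * ln (2 * r / cmod a))"
      unfolding n_def using sum_bounded_below[of Z "ln 2", OF each] by simp
    also have "\<dots> \<le> (\<Sum>a | cmod a \<le> 2 * r \<and> g a = 0. real (m a) * ln (2 * r / cmod a))"
    proof (rule sum_mono2[OF Z2])
      fix b assume "b \<in> {a. cmod a \<le> 2 * r \<and> g a = 0} - Z"
      thus "0 \<le> real (m b) * ln (2 * r / cmod b)" using nz0[of b]
        by (intro mult_nonneg_nonneg ln_ge_zero) (auto simp: field_simps)
    qed (use r0 in \<open>auto simp: Z_def\<close>)
    finally have a1: "real n * ln 2 \<le> (\<Sum>a | cmod a \<le> 2 * r \<and> g a = 0. real (m a) * ln (2 * r / cmod a))" .
    define T where "T = (\<Sum>a | cmod a \<le> 2 * r \<and> g a = 0. real (m a) * ln (2 * r / cmod a))"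
    have "2 * pi * (ln (cmod (g 0)) + T) \<le> X"
      using upper[of "2 * r"] I(2) J integral_unique[OF J] unfolding T_def by force
    moreover have "2 * pi * (- X) \<le> 2 * pi * ln (cmod (g 0))" using X by (intro mult_left_mono) auto
    ultimately have a2: "2 * pi * T \<le> X + 2 * pi * X" by (simp add: distrib_left)
    have "X \<le> pi * X / 3" using pi_gt3 X r by simp
    hence "2 * pi * T \<le> 2 * pi * (7/6 * X)" using a2 by linarith
    hence a3: "T \<le> 7/6 * X" using mult_le_cancel_left_pos[of "2 * pi" T "7/6 * X"] by simp
    \<comment> \<open>7/12 lies below ln 2, and 7/6 is twice 7/12; this is where the bound 2 X comes
      from.\<close>
    have "real n * (7/12) \<le> real n * ln 2" using ln2_ge_two_thirds by (intro mult_left_mono) auto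
    thus ?thesis using a1 a3 unfolding T_def by linarith
  qed
  obtain m R G where G: "G holomorphic_on UNIV" "r < R" "\<And>z. z \<in> ball 0 R \<Longrightarrow> G z \<noteq> 0"
    and fac0: "\<And>z. g z = (\<Prod>a\<in>Z. (z - a) ^ m a) * G z"
    and m: "\<And>a. g a = 0 \<Longrightarrow> cmod a \<le> r \<Longrightarrow> deriv g a \<noteq> 0 \<Longrightarrow> m a = 1"
    by (rule entire_factor_disc[OF g r0, folded Z_def]) (rule that; assumption)
  have fac: "g z = (\<Prod>a\<in>Z. z - a) * G z" for z
  proof -
    have "(\<Prod>a\<in>Z. (z - a) ^ m a) = (\<Prod>a\<in>Z. z - a)"
      by (intro prod.cong refl) (use m simple in \<open>auto simp: Z_def\<close>)
    thus ?thesis using fac0[of z] by simp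
  qed
  obtain L where L: "L holomorphic_on ball 0 R" "\<And>z. z \<in> ball 0 R \<Longrightarrow> exp (L z) = G z"
    using holomorphic_logarithm_exists[OF convex_ball open_ball holomorphic_on_subset[OF G(1) subset_UNIV], of 0 R 0] G r0
    by (metis centre_in_ball less_trans)
  have ReL: "Re (L z) = ln (cmod (G z))" if "z \<in> ball 0 R" for z
    using L(2)[OF that] by (metis ln_exp norm_exp_eq_Re)
  have w_in: "w \<theta> \<in> ball 0 R" and cw: "cmod (w \<theta>) = r" for \<theta> using G r0 by (auto simp: w_def norm_mult)
  define B where "B = {\<theta>\<in>{0..2*pi}. w \<theta> \<in> Z}"
  have B: "finite B" unfolding B_def w_def by (rule finite_circle_preimage[OF Z r0])
  obtain m' where J: "((\<lambda>\<theta>. ln (cmod (g (w \<theta>)))) has_integral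
        2 * pi * (ln (cmod (g 0)) + (\<Sum>a\<in>Z. real (m' a) * ln (r / cmod a)))) {0..2*pi}"
    unfolding w_def Z_def by (rule jensen[OF g r0]) blast
  have Jge: "- (2 * pi * X) \<le> integral {0..2*pi} (\<lambda>\<theta>. ln (cmod (g (w \<theta>))))"
  proof -
    have "0 \<le> (\<Sum>a\<in>Z. real (m' a) * ln (r / cmod a))"
      using nz0 by (intro sum_nonneg mult_nonneg_nonneg ln_ge_zero) (auto simp: Z_def field_simps)
    hence "- X \<le> ln (cmod (g 0)) + (\<Sum>a\<in>Z. real (m' a) * ln (r / cmod a))" using X by linarith
    hence "2 * pi * (- X) \<le> 2 * pi * (ln (cmod (g 0)) + (\<Sum>a\<in>Z. real (m' a) * ln (r / cmod a)))"
      by (intro mult_left_mono) auto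
    thus ?thesis using integral_unique[OF J] by simp
  qed
  have g_int: "((\<lambda>\<theta>. 2 * ln (max 1 (cmod (g (w \<theta>)))) - ln (cmod (g (w \<theta>)))) has_integral
      2 * proximity_integral g r - integral {0..2*pi} (\<lambda>\<theta>. ln (cmod (g (w \<theta>))))) {0..2*pi}"
    unfolding proximity_integral_def w_def[symmetric]
    by (intro has_integral_diff has_integral_mult_right integrable_integral)
       (use ln_max_one_integrable[OF g(1), of r] J in \<open>auto simp: w_def integrable_on_def\<close>)
  \<comment> \<open>The integrand majorises |ln |w - a||, because |w - a| \<le> 2 r, and its
    integral is known exactly.\<close>
  have a_int: "((\<lambda>\<theta>. 2 * ln (2 * r) - ln (cmod (w \<theta> - a))) has_integral
      2 * pi * (2 * ln (2 * r)) - 2 * pi * ln r) {0..2*pi}" if "a \<in> Z" for a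
    using has_integral_diff[OF has_integral_const_real[of "2 * ln (2 * r)" 0 "2*pi"] ln_cmod_minus(1)[of a r]] that r0
    by (simp add: Z_def w_def)
  define BB where "BB = integral {0..2*pi} (\<lambda>\<theta>. \<bar>Re (L (w \<theta>))\<bar>)"
  have BB: "BB \<le> 64 * X\<^sup>2"
  proof -
    have "BB \<le> (2 * proximity_integral g r - integral {0..2*pi} (\<lambda>\<theta>. ln (cmod (g (w \<theta>)))))
        + (\<Sum>a\<in>Z. 2 * pi * (2 * ln (2 * r)) - 2 * pi * ln r)"
      unfolding BB_def
    proof (rule has_integral_le)
      show "((\<lambda>\<theta>. \<bar>Re (L (w \<theta>))\<bar>) has_integral integral {0..2*pi} (\<lambda>\<theta>. \<bar>Re (L (w \<theta>))\<bar>)) ({0..2*pi} - B)"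
      proof -
        have "continuous_on {0..2*pi} (\<lambda>\<theta>. \<bar>Re (L (w \<theta>))\<bar>)"
          unfolding w_def
          by (intro continuous_intros continuous_on_compose2[OF holomorphic_on_imp_continuous_on[OF L(1)]])
             (use w_in in \<open>auto simp: w_def\<close>)
        hence "((\<lambda>\<theta>. \<bar>Re (L (w \<theta>))\<bar>) has_integral integral {0..2*pi} (\<lambda>\<theta>. \<bar>Re (L (w \<theta>))\<bar>)) {0..2*pi}"
          by (intro integrable_integral integrable_continuous_real)
        thus ?thesis using B by (subst has_integral_spike_set_eq[of _ "{0..2*pi}"]) (auto intro: negligible_subset[OF negligible_finite[OF B]])
      qed
      have "((\<lambda>\<theta>. (2 * ln (max 1 (cmod (g (w \<theta>)))) - ln (cmod (g (w \<theta>)))) + (\<Sum>a\<in>Z. 2 * ln (2 * r) - ln (cmod (w \<theta> - a))))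
         has_integral (2 * proximity_integral g r - integral {0..2*pi} (\<lambda>\<theta>. ln (cmod (g (w \<theta>)))))
        + (\<Sum>a\<in>Z. 2 * pi * (2 * ln (2 * r)) - 2 * pi * ln r)) {0..2*pi}"
        by (rule has_integral_add[OF g_int has_integral_sum[OF Z a_int]])
      thus "((\<lambda>\<theta>. (2 * ln (max 1 (cmod (g (w \<theta>)))) - ln (cmod (g (w \<theta>)))) + (\<Sum>a\<in>Z. 2 * ln (2 * r) - ln (cmod (w \<theta> - a))))
         has_integral (2 * proximity_integral g r - integral {0..2*pi} (\<lambda>\<theta>. ln (cmod (g (w \<theta>)))))
        + (\<Sum>a\<in>Z. 2 * pi * (2 * ln (2 * r)) - 2 * pi * ln r)) ({0..2*pi} - B)"
        using B by (subst has_integral_spike_set_eq[of _ "{0..2*pi}"]) (auto intro: negligible_subset[OF negligible_finite[OF B]])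
      fix \<theta> assume "\<theta> \<in> {0..2*pi} - B"
      hence nz: "w \<theta> - a \<noteq> 0" if "a \<in> Z" for a using that by (auto simp: B_def)
      have "ln (cmod (g (w \<theta>))) = ln ((\<Prod>a\<in>Z. cmod (w \<theta> - a)) * cmod (G (w \<theta>)))"
        unfolding fac by (simp add: norm_mult flip: prod_norm)
      also have "\<dots> = ln (\<Prod>a\<in>Z. cmod (w \<theta> - a)) + ln (cmod (G (w \<theta>)))"
        using nz Z G(3)[OF w_in[of \<theta>]] by (simp add: ln_mult)
      also have "ln (\<Prod>a\<in>Z. cmod (w \<theta> - a)) = (\<Sum>a\<in>Z. ln (cmod (w \<theta> - a)))"
        using nz Z by (intro ln_prod) auto
      finally have "Re (L (w \<theta>)) = ln (cmod (g (w \<theta>))) - (\<Sum>a\<in>Z. ln (cmod (w \<theta> - a)))"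
        using ReL[OF w_in[of \<theta>]] by simp
      hence "\<bar>Re (L (w \<theta>))\<bar> \<le> \<bar>ln (cmod (g (w \<theta>)))\<bar> + (\<Sum>a\<in>Z. \<bar>ln (cmod (w \<theta> - a))\<bar>)"
        using sum_abs[of "\<lambda>a. ln (cmod (w \<theta> - a))" Z] by linarith
      also have "\<bar>ln (cmod (g (w \<theta>)))\<bar> = 2 * ln (max 1 (cmod (g (w \<theta>)))) - ln (cmod (g (w \<theta>)))"
        by (rule abs_ln_eq) simp
      also have "(\<Sum>a\<in>Z. \<bar>ln (cmod (w \<theta> - a))\<bar>) \<le> (\<Sum>a\<in>Z. 2 * ln (2 * r) - ln (cmod (w \<theta> - a)))"
      proof (rule sum_mono)
        fix a assume "a \<in> Z"
        have "cmod (w \<theta> - a) \<le> 2 * r" using norm_triangle_ineq4[of "w \<theta>" a] cw[of \<theta>] \<open>a \<in> Z\<close> by (simp add: Z_def)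
        hence "ln (max 1 (cmod (w \<theta> - a))) \<le> ln (2 * r)" using r by (intro ln_mono) auto
        thus "\<bar>ln (cmod (w \<theta> - a))\<bar> \<le> 2 * ln (2 * r) - ln (cmod (w \<theta> - a))"
          using abs_ln_eq[of "cmod (w \<theta> - a)"] by simp
      qed
      finally show "\<bar>Re (L (w \<theta>))\<bar> \<le> (2 * ln (max 1 (cmod (g (w \<theta>)))) - ln (cmod (g (w \<theta>)))) + (\<Sum>a\<in>Z. 2 * ln (2 * r) - ln (cmod (w \<theta> - a)))"
        by simp
    qed
    also have "(\<Sum>a\<in>Z. 2 * pi * (2 * ln (2 * r)) - 2 * pi * ln r) \<le> real n * (8 * pi * X)"
    proof -
      have "ln (2 * r) \<le> 2 * X" using ln_le_minus_one[of "2 * r"] r X by linarith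
      hence "2 * pi * (2 * ln (2 * r)) \<le> 2 * pi * (2 * (2 * X))" by (intro mult_left_mono) auto
      moreover have "0 \<le> 2 * pi * ln r" using r by simp
      moreover have "2 * pi * (2 * (2 * X)) = 8 * pi * X" by simp
      ultimately have "2 * pi * (2 * ln (2 * r)) - 2 * pi * ln r \<le> 8 * pi * X" by linarith
      thus ?thesis unfolding n_def by (simp add: mult_left_mono)
    qed
    also have "real n * (8 * pi * X) \<le> (2 * X) * (8 * pi * X)" using n X r by (intro mult_right_mono) auto
    also have "(2 * X) * (8 * pi * X) \<le> 52 * X\<^sup>2"
    proof -
      have "16 * pi \<le> 52" using pi_less_4 pi_approx by simp
      hence "16 * pi * X\<^sup>2 \<le> 52 * X\<^sup>2" by (intro mult_right_mono) auto
      thus ?thesis by (simp add: power2_eq_square)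
    qed
    also have "2 * proximity_integral g r - integral {0..2*pi} (\<lambda>\<theta>. ln (cmod (g (w \<theta>)))) \<le> 12 * X\<^sup>2"
    proof -
      have "2 * pi * X \<le> 10 * X" using X r pi_less_4 pi_approx by (intro mult_right_mono) auto
      hence "2 * proximity_integral g r - integral {0..2*pi} (\<lambda>\<theta>. ln (cmod (g (w \<theta>)))) \<le> 12 * X"
        using Jge I(1) by linarith
      also have "12 * X \<le> 12 * X\<^sup>2" using X r by (simp add: power2_eq_square)
      finally show ?thesis .
    qed
    finally show ?thesis by simp
  qed
  have BB0: "0 \<le> BB" unfolding BB_def by (intro integral_nonneg) (auto intro!: integrable_continuous_real continuous_intros
      continuous_on_compose2[OF holomorphic_on_imp_continuous_on[OF L(1)]] simp: w_def w_in[unfolded w_def] norm_mult r0 G(2) abs_of_pos)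
  have X1: "1 \<le> X" using X r by linarith
  have XX: "X \<le> X\<^sup>2" "X\<^sup>2 \<le> X^3" "X^3 \<le> X^4" using X1 by (auto intro!: power_increasing[of 1 2, simplified] power_increasing)
  have dL: "cmod (deriv L z) \<le> 400 * X\<^sup>2" if "cmod z \<le> 3/4 * r" for z
  proof -
    have "cmod (deriv L z) \<le> 16 / (pi * r) * BB"
      unfolding BB_def w_def by (rule norm_deriv_le_integral_Re[OF L(1) r0 G(2) that])
    also have "\<dots> \<le> 16 / 3 * (64 * X\<^sup>2)"
    proof (rule mult_mono[OF _ BB])
      have "3 * 1 \<le> pi * r" using pi_gt3 r by (intro mult_mono) auto
      thus "16 / (pi * r) \<le> 16 / 3" by (intro divide_left_mono) auto
    qed (use BB0 in auto)
    also have "\<dots> \<le> 400 * X\<^sup>2" by simp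
    finally show ?thesis .
  qed
  have hol_dL: "deriv L holomorphic_on ball 0 R" by (intro holomorphic_deriv L) auto
  have ddL: "cmod (deriv (deriv L) z) \<le> 1600 * X\<^sup>2" if "cmod z \<le> r / 2" for z
  proof -
    have sub: "cball z (r / 4) \<subseteq> ball 0 R"
    proof
      fix u assume "u \<in> cball z (r / 4)"
      hence "cmod u \<le> cmod z + r / 4" using norm_triangle_ineq[of z "u - z"] by (simp add: dist_norm norm_minus_commute)
      thus "u \<in> ball 0 R" using that G r0 by simp
    qed
    have "cmod ((deriv ^^ 1) (deriv L) z) \<le> fact 1 * (400 * X\<^sup>2) / (r / 4) ^ 1"
    proof (rule Cauchy_inequality)
      show "deriv L holomorphic_on ball z (r / 4)" using sub by (intro holomorphic_on_subset[OF hol_dL]) auto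
      show "continuous_on (cball z (r / 4)) (deriv L)"
        using sub by (intro holomorphic_on_imp_continuous_on holomorphic_on_subset[OF hol_dL])
      fix x assume "cmod (z - x) = r / 4"
      hence "cmod x \<le> cmod z + r / 4" using norm_triangle_ineq4[of z "z - x"] by simp
      thus "cmod (deriv L x) \<le> 400 * X\<^sup>2" using that r0 by (intro dL) auto
    qed (use r0 in auto)
    also have "\<dots> = 1600 * X\<^sup>2 / r" by simp
    also have "\<dots> \<le> 1600 * X\<^sup>2 / 1" using r by (intro divide_left_mono) auto
    finally show ?thesis by simp
  qed
  obtain \<rho> where \<rho>: "r / 4 \<le> \<rho>" "\<rho> \<le> r / 2" "\<And>a. a \<in> Z \<Longrightarrow> r / (8 * (real n + 1)) \<le> \<bar>\<rho> - cmod a\<bar>"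
    using circle_avoiding_points[OF Z r0] unfolding n_def by metis
  define \<delta> where "\<delta> = r / (8 * (real n + 1))"
  have \<delta>: "0 < \<delta>" using r0 by (simp add: \<delta>_def)
  have inv_\<delta>: "1 / \<delta> \<le> 24 * X"
  proof -
    have "1 / \<delta> = 8 * (real n + 1) / r" by (simp add: \<delta>_def)
    also have "\<dots> \<le> 8 * (real n + 1) / 1" using r by (intro divide_left_mono) auto
    finally show ?thesis using n X1 by simp
  qed
  have far: "\<delta> \<le> cmod (z - a)" if "cmod z = \<rho>" "a \<in> Z" for z a
    using \<rho>(3)[OF that(2)] norm_triangle_ineq3[of z a] that unfolding \<delta>_def by linarith
  have near: "1 / cmod (z - a) \<le> 24 * X" if "cmod z = \<rho>" "a \<in> Z" for z a
  proof -
    have "1 / cmod (z - a) \<le> 1 / \<delta>" using far[OF that] \<delta> by (intro frac_le) auto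
    thus ?thesis using inv_\<delta> by simp
  qed
  \<comment> \<open>\<open>F\<close> is g' / g off the zeros and \<open>F1\<close> its derivative,
    so g'' / g = F^2 + F1.\<close>
  define F where "F = (\<lambda>z. (\<Sum>a\<in>Z. 1 / (z - a)) + deriv L z)"
  define F1 where "F1 = (\<lambda>z. (\<Sum>a\<in>Z. - 1 / (z - a)\<^sup>2) + deriv (deriv L) z)"
  define U where "U = ball 0 R - Z"
  have U: "open U" unfolding U_def by (intro open_Diff finite_imp_closed Z) auto
  have dg: "deriv g z = g z * F z" if "z \<in> U" for z
  proof -
    have z: "z \<in> ball 0 R" "\<And>a. a \<in> Z \<Longrightarrow> z - a \<noteq> 0" using that by (auto simp: U_def)
    have 1: "((\<lambda>z. \<Prod>a\<in>Z. z - a) has_field_derivative ((\<Prod>a\<in>Z. z - a) * (\<Sum>a\<in>Z. 1 / (z - a)))) (at z)"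
      by (rule has_field_derivative_prod') (use z in \<open>auto intro!: derivative_eq_intros\<close>)
    have 2: "((\<lambda>z. exp (L z)) has_field_derivative (exp (L z) * deriv L z)) (at z)"
      by (intro DERIV_fun_exp holomorphic_derivI[OF L(1)]) (use z in auto)
    have "((\<lambda>z. (\<Prod>a\<in>Z. z - a) * exp (L z)) has_field_derivative
        ((\<Prod>a\<in>Z. z - a) * exp (L z) * F z)) (at z)"
      by (rule DERIV_cong[OF DERIV_mult[OF 1 2]]) (simp add: F_def algebra_simps)
    hence "(g has_field_derivative ((\<Prod>a\<in>Z. z - a) * exp (L z) * F z)) (at z)"
      by (rule has_field_derivative_transform_within_open[of _ _ _ "ball 0 R"])
         (use z L(2) in \<open>auto simp: fac\<close>)
    thus ?thesis using L(2)[OF z(1)] by (simp add: DERIV_imp_deriv fac)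
  qed
  have dF: "(F has_field_derivative F1 z) (at z)" if "z \<in> U" for z
  proof -
    have z: "z \<in> ball 0 R" "\<And>a. a \<in> Z \<Longrightarrow> z - a \<noteq> 0" using that by (auto simp: U_def)
    have "((\<lambda>z. 1 / (z - a)) has_field_derivative - 1 / (z - a)\<^sup>2) (at z)" if "a \<in> Z" for a
      using z(2)[OF that] by (auto intro!: derivative_eq_intros simp: power2_eq_square)
    thus ?thesis unfolding F_def F1_def
      by (intro DERIV_add DERIV_sum holomorphic_derivI[OF hol_dL]) (use z in auto)
  qed
  have ddg: "deriv (deriv g) z = g z * (F z ^ 2 + F1 z)" if "z \<in> U" for z
  proof -
    have "((\<lambda>z. g z * F z) has_field_derivative (deriv g z * F z + F1 z * g z)) (at z)"
      by (intro DERIV_mult holomorphic_derivI[OF g(1)] dF that) auto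
    hence "(deriv g has_field_derivative (deriv g z * F z + F1 z * g z)) (at z)"
      by (rule has_field_derivative_transform_within_open[OF _ U that]) (simp add: dg)
    thus ?thesis using dg[OF that] by (simp add: DERIV_imp_deriv algebra_simps power2_eq_square)
  qed
  have zU: "z \<in> U" "g z \<noteq> 0" "cmod z \<le> r / 2" if "cmod z = \<rho>" for z
  proof -
    have "z \<notin> Z" using far[OF that, of z] \<delta> by auto
    moreover have "cmod z \<le> r" using that \<rho> r0 by linarith
    ultimately show "z \<in> U" "g z \<noteq> 0" using G by (auto simp: U_def Z_def)
  qed (use that \<rho> in auto)
  have Fb: "cmod (F z) \<le> 2000 * X\<^sup>2" if "cmod z = \<rho>" for z
  proof -
    have "cmod (\<Sum>a\<in>Z. 1 / (z - a)) \<le> real n * (24 * X)"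
      unfolding n_def using near[OF that] by (intro sum_norm_bound) (auto simp: norm_divide)
    also have "\<dots> \<le> 2 * X * (24 * X)" using n X1 by (intro mult_right_mono) auto
    finally have "cmod (\<Sum>a\<in>Z. 1 / (z - a)) \<le> 48 * X\<^sup>2" by (simp add: power2_eq_square)
    moreover have "cmod (deriv L z) \<le> 400 * X\<^sup>2" using zU(3)[OF that] r0 by (intro dL) auto
    ultimately have "cmod (F z) \<le> 448 * X\<^sup>2" unfolding F_def by (intro norm_triangle_le) auto
    thus ?thesis using zero_le_power2[of X] by linarith
  qed
  have F1b: "cmod (F1 z) \<le> 2800 * X^3" if "cmod z = \<rho>" for z
  proof -
    have "cmod (- 1 / (z - a)\<^sup>2) \<le> (24 * X)\<^sup>2" if "a \<in> Z" for a
      using power_mono[OF near[OF \<open>cmod z = \<rho>\<close> that], of 2] by (simp add: norm_divide norm_power power_one_over)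
    hence "cmod (\<Sum>a\<in>Z. - 1 / (z - a)\<^sup>2) \<le> real n * (24 * X)\<^sup>2"
      unfolding n_def by (intro sum_norm_bound) auto
    also have "\<dots> \<le> 2 * X * (24 * X)\<^sup>2" using n by (intro mult_right_mono) auto
    finally have "cmod (\<Sum>a\<in>Z. - 1 / (z - a)\<^sup>2) \<le> 1152 * X^3" by (simp add: power2_eq_square power3_eq_cube)
    moreover have "cmod (deriv (deriv L) z) \<le> 1600 * X^3" using ddL[OF zU(3)[OF that]] XX by linarith
    moreover have "0 \<le> X^3" using X1 by simp
    ultimately show ?thesis unfolding F1_def by (intro norm_triangle_le) linarith
  qed
  show ?thesis
  proof (rule that[OF \<rho>(1,2) zU(2)])
    fix z assume z: "cmod z = \<rho>"
    show "cmod (deriv g z / g z) \<le> 2000 * X ^ 2" using dg[OF zU(1)[OF z]] zU(2)[OF z] Fb[OF z] by simp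
    have "cmod (F z ^ 2) \<le> (2000 * X\<^sup>2)\<^sup>2" unfolding norm_power by (intro power_mono Fb z) auto
    hence "cmod (F z ^ 2 + F1 z) \<le> 4000000 * X^4 + 2800 * X^3"
      using F1b[OF z] by (intro norm_triangle_le add_mono) (auto simp: power_mult_distrib)
    also have "\<dots> \<le> 5000000 * X^4" using XX X1 zero_le_power[of X 4] by linarith
    finally show "cmod (deriv (deriv g) z / g z) \<le> 5000000 * X ^ 4"
      using ddg[OF zU(1)[OF z]] zU(2)[OF z] by simp
  qed
qed


section \<open>From bounds on circles to a polynomial coefficient\<close>

lemma cmod_poly_le_power:
  fixes p :: "complex poly"
  assumes "cmod z \<le> r" "1 \<le> r"
  shows "cmod (poly p z) \<le> (\<Sum>i\<le>degree p. cmod (coeff p i)) * r ^ degree p"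
proof -
  have "cmod (poly p z) \<le> (\<Sum>i\<le>degree p. cmod (coeff p i) * cmod z ^ i)"
    unfolding poly_altdef by (rule order_trans[OF norm_sum]) (simp add: norm_mult norm_power)
  also have "\<dots> \<le> (\<Sum>i\<le>degree p. cmod (coeff p i) * r ^ degree p)"
  proof (intro sum_mono mult_left_mono)
    fix i assume "i \<in> {..degree p}"
    have "cmod z ^ i \<le> r ^ i" using assms by (intro power_mono) auto
    also have "\<dots> \<le> r ^ degree p" using assms \<open>i \<in> _\<close> by (intro power_increasing) auto
    finally show "cmod z ^ i \<le> r ^ degree p" .
  qed auto
  finally show ?thesis by (simp add: sum_distrib_right)
qed

lemma entire_poly_growth_imp_poly:
  assumes "Q holomorphic_on UNIV" "\<And>z. A \<le> cmod z \<Longrightarrow> cmod (Q z) \<le> B * cmod z ^ n"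
  shows "\<exists>R. Q = poly R"
proof -
  have "Q z = poly (\<Sum>k\<le>n. monom ((deriv ^^ k) Q 0 / fact k) k) z" for z
    using Liouville_polynomial[OF assms] by (simp add: poly_sum poly_monom)
  thus ?thesis by blast
qed

text \<open>One good circle per range of radii is enough: the maximum principle carries the
  resulting bound for an entire coefficient into the interior.\<close>

definition log_derivs_poly_bounded where
  "log_derivs_poly_bounded g \<longleftrightarrow> (\<exists>D M. 0 \<le> D \<and> (\<forall>r\<ge>1. \<exists>\<rho>. r / 4 \<le> \<rho> \<and> \<rho> \<le> r / 2 \<and>
     (\<forall>z. cmod z = \<rho> \<longrightarrow> g z \<noteq> 0 \<and> cmod (deriv g z / g z) \<le> D * r ^ M \<and>
        cmod (deriv (deriv g) z / g z) \<le> D * r ^ M)))"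

lemma log_derivs_poly_bounded_nonzero:
  assumes g: "g holomorphic_on UNIV" "g 0 \<noteq> 0" and simple: "\<And>a. g a = 0 \<Longrightarrow> deriv g a \<noteq> 0"
    and C: "\<And>r. 1 \<le> r \<Longrightarrow> proximity_integral g r \<le> C * r ^ K"
  shows "log_derivs_poly_bounded g"
proof -
  \<comment> \<open>The factor 2^K pays for using the growth bound at the radius 2 r.\<close>
  define A where "A = 1 + \<bar>ln (cmod (g 0))\<bar> + \<bar>C\<bar> * 2 ^ K"
  have A: "1 \<le> A" "\<bar>ln (cmod (g 0))\<bar> \<le> A" "\<bar>C\<bar> * 2 ^ K \<le> A" by (auto simp: A_def)
  have "\<exists>\<rho>. r / 4 \<le> \<rho> \<and> \<rho> \<le> r / 2 \<and>
     (\<forall>z. cmod z = \<rho> \<longrightarrow> g z \<noteq> 0 \<and> cmod (deriv g z / g z) \<le> (5000000 * A ^ 4) * r ^ (4 * (K + 1)) \<and>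
        cmod (deriv (deriv g) z / g z) \<le> (5000000 * A ^ 4) * r ^ (4 * (K + 1)))" if r: "1 \<le> r" for r
  proof -
    \<comment> \<open>The additional power of \<open>r\<close> ensures r \<le> X.\<close>
    define X where "X = A * r ^ (K + 1)"
    have rK: "1 \<le> r ^ K" "1 \<le> r ^ (K + 1)" "r \<le> r ^ (K + 1)" "r ^ K \<le> r ^ (K + 1)"
      using r by (auto intro: self_le_power power_increasing simp del: power_Suc)
    have X: "r \<le> X" using mult_mono[OF A(1) rK(3)] A r by (simp add: X_def)
    have X2: "\<bar>ln (cmod (g 0))\<bar> \<le> X" using mult_mono[OF A(2) rK(2)] A by (simp add: X_def)
    have "C * r ^ K \<le> \<bar>C\<bar> * 2 ^ K * r ^ K"
    proof -
      have "C \<le> \<bar>C\<bar> * 1" by simp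
      also have "\<dots> \<le> \<bar>C\<bar> * 2 ^ K" by (intro mult_left_mono) auto
      finally show ?thesis using rK by (intro mult_right_mono) auto
    qed
    moreover have "C * (2 * r) ^ K \<le> \<bar>C\<bar> * 2 ^ K * r ^ K"
      unfolding power_mult_distrib mult.assoc[symmetric] using r by (intro mult_right_mono) auto
    moreover have "\<bar>C\<bar> * 2 ^ K * r ^ K \<le> X"
      unfolding X_def using A rK by (intro mult_mono) auto
    ultimately have X3: "proximity_integral g r \<le> X" "proximity_integral g (2 * r) \<le> X"
      using C[of r] C[of "2 * r"] r by linarith+
    obtain \<rho> where \<rho>: "r / 4 \<le> \<rho>" "\<rho> \<le> r / 2"
      "\<And>z. cmod z = \<rho> \<Longrightarrow> g z \<noteq> 0"
      "\<And>z. cmod z = \<rho> \<Longrightarrow> cmod (deriv g z / g z) \<le> 2000 * X ^ 2"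
      "\<And>z. cmod z = \<rho> \<Longrightarrow> cmod (deriv (deriv g) z / g z) \<le> 5000000 * X ^ 4"
      using log_derivative_on_circle[OF g simple r X X2 X3] by metis
    have "1 \<le> X" using X r by linarith
    hence "X ^ 2 \<le> X ^ 4" by (intro power_increasing) auto
    moreover have "0 \<le> X ^ 4" using \<open>1 \<le> X\<close> by simp
    ultimately have "2000 * X ^ 2 \<le> 5000000 * X ^ 4" by linarith
    moreover have "5000000 * X ^ 4 = (5000000 * A ^ 4) * r ^ (4 * (K + 1))"
      unfolding X_def power_mult_distrib power_mult[symmetric] by (simp add: mult.commute)
    ultimately have *: "2000 * X ^ 2 \<le> (5000000 * A ^ 4) * r ^ (4 * (K + 1))"
      "5000000 * X ^ 4 = (5000000 * A ^ 4) * r ^ (4 * (K + 1))" by linarith+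
    show ?thesis
    proof (intro exI[of _ \<rho>] conjI allI impI \<rho>(1,2))
      fix z assume z: "cmod z = \<rho>"
      show "g z \<noteq> 0" by (rule \<rho>(3)[OF z])
      show "cmod (deriv g z / g z) \<le> (5000000 * A ^ 4) * r ^ (4 * (K + 1))"
        using \<rho>(4)[OF z] *(1) by linarith
      show "cmod (deriv (deriv g) z / g z) \<le> (5000000 * A ^ 4) * r ^ (4 * (K + 1))"
        using \<rho>(5)[OF z] *(2) by linarith
    qed
  qed
  moreover have "0 \<le> 5000000 * A ^ 4" using A by simp
  ultimately show ?thesis unfolding log_derivs_poly_bounded_def by blast
qed

text \<open>Jensen's formula was used with g 0 \<noteq> 0. A zero at the origin is simple, and G = g
  / z satisfies |G| \<le> |g| for |z| \<ge> 1, so the growth bound passes to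
  \<open>G\<close>.\<close>

lemma log_derivs_poly_bounded:
  assumes g: "g holomorphic_on UNIV" "g w \<noteq> 0" and simple: "\<And>a. g a = 0 \<Longrightarrow> deriv g a \<noteq> 0"
    and C: "\<And>r. 1 \<le> r \<Longrightarrow> proximity_integral g r \<le> C * r ^ K"
  shows "log_derivs_poly_bounded g"
proof (cases "g 0 = 0")
  case False
  thus ?thesis using log_derivs_poly_bounded_nonzero assms by blast
next
  case True
  obtain n G where G: "G holomorphic_on UNIV" "G 0 \<noteq> 0" "\<And>z. g z = (z - 0) ^ n * G z"
    using entire_factor_at[OF g] by metis
  have dG: "(G has_field_derivative deriv G z) (at z)" for z
    by (rule holomorphic_derivI[OF G(1)]) auto
  have ddG: "(deriv G has_field_derivative deriv (deriv G) z) (at z)" for z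
    by (rule holomorphic_derivI[OF holomorphic_deriv[OF G(1)]]) auto
  have "n \<noteq> 0" using True G(2) G(3)[of 0] by auto
  have "n = 1"
  proof (rule ccontr)
    assume "n \<noteq> 1"
    then obtain k where k: "n = Suc (Suc k)" using \<open>n \<noteq> 0\<close> by (metis One_nat_def not0_implies_Suc)
    have "g = (\<lambda>z. z ^ n * G z)" using G(3) by auto
    moreover have "((\<lambda>z. z ^ n * G z) has_field_derivative 0) (at 0)"
      by (rule DERIV_cong[OF DERIV_mult[OF DERIV_power[OF DERIV_ident] dG]]) (simp add: k)
    ultimately show False using simple[OF True] DERIV_imp_deriv by blast
  qed
  hence gG: "g = (\<lambda>z. z * G z)" using G(3) by auto
  have dg: "deriv g z = G z + z * deriv G z" for z
    unfolding gG by (rule DERIV_imp_deriv, rule DERIV_cong[OF DERIV_mult[OF DERIV_ident dG]]) simp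
  have ddg: "deriv (deriv g) z = 2 * deriv G z + z * deriv (deriv G) z" for z
  proof -
    have "deriv g = (\<lambda>z. G z + z * deriv G z)" using dg by auto
    thus ?thesis
      by simp (rule DERIV_imp_deriv, rule DERIV_cong[OF DERIV_add[OF dG DERIV_mult[OF DERIV_ident ddG]]], simp)
  qed
  have "log_derivs_poly_bounded G"
  proof (rule log_derivs_poly_bounded_nonzero[OF G(1,2)])
    fix a assume "G a = 0"
    thus "deriv G a \<noteq> 0" using simple[of a] dg[of a] by (auto simp: gG)
  next
    fix r :: real assume r: "1 \<le> r"
    have "proximity_integral G r \<le> proximity_integral g r"
      unfolding proximity_integral_def
    proof (intro integral_le ln_max_one_integrable G g)
      fix \<theta>
      have "cmod (G (of_real r * cis \<theta>)) \<le> cmod (g (of_real r * cis \<theta>))"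
        using mult_right_mono[OF r, of "cmod (G (of_real r * cis \<theta>))"] r by (simp add: gG norm_mult)
      thus "ln (max 1 (cmod (G (of_real r * cis \<theta>)))) \<le> ln (max 1 (cmod (g (of_real r * cis \<theta>))))"
        by (intro ln_mono) auto
    qed
    thus "proximity_integral G r \<le> C * r ^ K" using C[OF r] by simp
  qed
  then obtain D M where D: "0 \<le> D" and DM: "\<And>r. 1 \<le> r \<Longrightarrow> \<exists>\<rho>. r / 4 \<le> \<rho> \<and> \<rho> \<le> r / 2 \<and>
     (\<forall>z. cmod z = \<rho> \<longrightarrow> G z \<noteq> 0 \<and> cmod (deriv G z / G z) \<le> D * r ^ M \<and>
        cmod (deriv (deriv G) z / G z) \<le> D * r ^ M)"
    unfolding log_derivs_poly_bounded_def by blast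
  \<comment> \<open>On the circle |1/z| \<le> 4. The identities g'/g = 1/z + G'/G and g''/g = 2
    (1/z) G'/G + G''/G give 4 + D and 8 D + D, both covered by 4 + 9 D.\<close>
  have "\<exists>\<rho>. r / 4 \<le> \<rho> \<and> \<rho> \<le> r / 2 \<and>
     (\<forall>z. cmod z = \<rho> \<longrightarrow> g z \<noteq> 0 \<and> cmod (deriv g z / g z) \<le> (4 + 9 * D) * r ^ M \<and>
        cmod (deriv (deriv g) z / g z) \<le> (4 + 9 * D) * r ^ M)" if r: "1 \<le> r" for r
  proof -
    obtain \<rho> where \<rho>: "r / 4 \<le> \<rho>" "\<rho> \<le> r / 2" "\<And>z. cmod z = \<rho> \<Longrightarrow> G z \<noteq> 0"
      "\<And>z. cmod z = \<rho> \<Longrightarrow> cmod (deriv G z / G z) \<le> D * r ^ M"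
      "\<And>z. cmod z = \<rho> \<Longrightarrow> cmod (deriv (deriv G) z / G z) \<le> D * r ^ M"
      using DM[OF r] by blast
    have rM: "1 \<le> r ^ M" using r by simp
    have "g z \<noteq> 0 \<and> cmod (deriv g z / g z) \<le> (4 + 9 * D) * r ^ M \<and>
        cmod (deriv (deriv g) z / g z) \<le> (4 + 9 * D) * r ^ M" if z: "cmod z = \<rho>" for z
    proof -
      have z0: "z \<noteq> 0" using z \<rho>(1) r by auto
      have gz: "g z = z * G z" by (simp add: gG)
      have iz: "cmod (1 / z) \<le> 4" using z \<rho>(1) r by (simp add: norm_divide field_simps)
      have "deriv g z / g z = 1 / z + deriv G z / G z"
        using z0 \<rho>(3)[OF z] unfolding dg gz by (simp add: field_simps)
      hence "cmod (deriv g z / g z) \<le> 4 + D * r ^ M"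
        using iz \<rho>(4)[OF z] norm_triangle_ineq[of "1 / z" "deriv G z / G z"] by simp
      moreover have "4 + D * r ^ M \<le> (4 + 9 * D) * r ^ M"
      proof -
        have "0 \<le> D * r ^ M" using rM D by simp
        moreover have "(4 + 9 * D) * r ^ M = 4 * r ^ M + 9 * (D * r ^ M)" by (simp add: algebra_simps)
        ultimately show ?thesis using rM by linarith
      qed
      moreover have "deriv (deriv g) z / g z = 2 * (1 / z) * (deriv G z / G z) + deriv (deriv G) z / G z"
        using z0 \<rho>(3)[OF z] unfolding ddg gz by (simp add: field_simps)
      hence "cmod (deriv (deriv g) z / g z) \<le> 2 * cmod (1 / z) * cmod (deriv G z / G z) + cmod (deriv (deriv G) z / G z)"
        using norm_triangle_ineq[of "2 * (1 / z) * (deriv G z / G z)" "deriv (deriv G) z / G z"]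
        by (simp only: norm_mult norm_numeral)
      moreover have "2 * cmod (1 / z) * cmod (deriv G z / G z) \<le> 2 * 4 * (D * r ^ M)"
        using iz \<rho>(4)[OF z] by (intro mult_mono) auto
      moreover have "2 * 4 * (D * r ^ M) + D * r ^ M \<le> (4 + 9 * D) * r ^ M" using rM by (simp add: algebra_simps)
      moreover have "g z \<noteq> 0" using z0 \<rho>(3)[OF z] by (simp add: gz)
      ultimately show ?thesis using \<rho>(5)[OF z] by linarith
    qed
    thus ?thesis using \<rho>(1,2) by blast
  qed
  moreover have "0 \<le> 4 + 9 * D" using D by simp
  ultimately show ?thesis unfolding log_derivs_poly_bounded_def by blast
qed

text \<open>Solving the equation for \<open>Q\<close> on a good circle bounds it there by a power of
  \<open>r\<close>, hence also inside; Liouville's theorem concludes.\<close>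

lemma ode_coefficient_is_poly:
  assumes g: "g holomorphic_on UNIV" "g w \<noteq> 0" and simple: "\<And>a. g a = 0 \<Longrightarrow> deriv g a \<noteq> 0"
    and C: "\<And>r. 1 \<le> r \<Longrightarrow> proximity_integral g r \<le> C * r ^ K"
    and Q: "Q holomorphic_on UNIV"
    and ode: "\<And>z. poly P z * deriv (deriv g) z - poly P1 z * deriv g z + Q z * g z = 0"
  shows "\<exists>R. Q = poly R"
proof -
  obtain D M where D: "0 \<le> D" and DM: "\<And>r. 1 \<le> r \<Longrightarrow> \<exists>\<rho>. r / 4 \<le> \<rho> \<and> \<rho> \<le> r / 2 \<and>
     (\<forall>z. cmod z = \<rho> \<longrightarrow> g z \<noteq> 0 \<and> cmod (deriv g z / g z) \<le> D * r ^ M \<and>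
        cmod (deriv (deriv g) z / g z) \<le> D * r ^ M)"
    using log_derivs_poly_bounded[OF g simple C] unfolding log_derivs_poly_bounded_def by blast
  define S where "S = (\<lambda>p. \<Sum>i\<le>degree p. cmod (coeff p i))"
  define d where "d = max (degree P) (degree P1)"
  have S0: "0 \<le> S p" for p unfolding S_def by (intro sum_nonneg) auto
  have bound: "cmod (Q z) \<le> (S P + S P1) * D * 4 ^ (d + M) * cmod z ^ (d + M)" if z: "1 \<le> cmod z" for z
  proof -
    \<comment> \<open>Places \<open>z\<close> inside every circle of radius at least r / 4.\<close>
    define r where "r = 4 * cmod z"
    have r: "1 \<le> r" using z by (simp add: r_def)
    obtain \<rho> where \<rho>: "r / 4 \<le> \<rho>" "\<rho> \<le> r / 2" "\<And>z. cmod z = \<rho> \<Longrightarrow> g z \<noteq> 0"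
      "\<And>z. cmod z = \<rho> \<Longrightarrow> cmod (deriv g z / g z) \<le> D * r ^ M"
      "\<And>z. cmod z = \<rho> \<Longrightarrow> cmod (deriv (deriv g) z / g z) \<le> D * r ^ M"
      using DM[OF r] by blast
    have pb: "cmod (poly p u) \<le> S p * r ^ d" if "cmod u = \<rho>" "degree p \<le> d" for p u
    proof -
      have "cmod (poly p u) \<le> S p * r ^ degree p"
        unfolding S_def by (rule cmod_poly_le_power) (use that \<rho> r in auto)
      also have "\<dots> \<le> S p * r ^ d" using r that S0 by (intro mult_left_mono power_increasing) auto
      finally show ?thesis .
    qed
    have circ: "cmod (Q u) \<le> (S P + S P1) * D * r ^ (d + M)" if u: "cmod u = \<rho>" for u
    proof -
      have "Q u = poly P1 u * (deriv g u / g u) - poly P u * (deriv (deriv g) u / g u)"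
        using ode[of u] \<rho>(3)[OF u] by (simp add: field_simps add_eq_0_iff2)
      hence "cmod (Q u) \<le> cmod (poly P1 u) * cmod (deriv g u / g u) + cmod (poly P u) * cmod (deriv (deriv g) u / g u)"
        using norm_triangle_ineq4 by (metis norm_mult)
      also have "\<dots> \<le> (S P1 * r ^ d) * (D * r ^ M) + (S P * r ^ d) * (D * r ^ M)"
        using S0 r by (intro add_mono mult_mono pb u \<rho>(4)[OF u] \<rho>(5)[OF u]) (auto simp: d_def)
      finally show ?thesis by (simp add: algebra_simps power_add)
    qed
    have "cmod (Q z) \<le> (S P + S P1) * D * r ^ (d + M)"
    proof (rule maximum_modulus_frontier[where S = "cball 0 \<rho>" and f = Q])
      show "Q holomorphic_on interior (cball 0 \<rho>)" using Q holomorphic_on_subset by blast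
      show "continuous_on (closure (cball 0 \<rho>)) Q"
        using Q holomorphic_on_imp_continuous_on continuous_on_subset by blast
      show "z \<in> cball 0 \<rho>" using \<rho>(1) by (simp add: r_def)
      show "cmod (Q u) \<le> (S P + S P1) * D * r ^ (d + M)" if "u \<in> frontier (cball 0 \<rho>)" for u
        using that \<rho>(1) r by (intro circ) (simp add: frontier_cball)
    qed auto
    thus ?thesis by (simp add: r_def power_mult_distrib mult_ac)
  qed
  from entire_poly_growth_imp_poly[OF Q bound] show ?thesis .
qed

section \<open>Linear equations with polynomial coefficients\<close>

lemma nonzero_at_infinity: "\<forall>\<^sub>F z :: complex in at_infinity. z \<noteq> 0"
  unfolding eventually_at_infinity by (intro exI[of _ 1]) auto

lemma poly_over_power_tendsto:
  fixes p :: "complex poly"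
  assumes "degree p \<le> m"
  shows "((\<lambda>z. poly p z / z ^ m) \<longlongrightarrow> coeff p m) at_infinity"
proof (cases "degree p = m")
  case True
  thus ?thesis using poly_divide_tendsto_aux[of p] by simp
next
  case False
  hence m: "degree p < m" using assms by simp
  have "((\<lambda>z. poly p z / z ^ degree p * inverse (z ^ (m - degree p))) \<longlongrightarrow> lead_coeff p * 0) at_infinity"
    by (intro tendsto_mult poly_divide_tendsto_aux filterlim_compose[OF tendsto_inverse_0]
         filterlim_power_at_infinity filterlim_ident) (use m in auto)
  moreover have "\<forall>\<^sub>F z in at_infinity. poly p z / z ^ degree p * inverse (z ^ (m - degree p)) = poly p z / z ^ m"
    using nonzero_at_infinity
  proof eventually_elim
    case (elim z)
    have "z ^ m = z ^ degree p * z ^ (m - degree p)" using m by (simp flip: power_add)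
    thus ?case using elim by (simp add: field_simps)
  qed
  ultimately show ?thesis using m by (simp add: coeff_eq_0 Lim_transform_eventually)
qed

lemma poly_nonzero_at_infinity:
  fixes p :: "complex poly"
  assumes "p \<noteq> 0"
  shows "\<forall>\<^sub>F z in at_infinity. poly p z \<noteq> 0"
proof -
  have "finite {z. poly p z = 0}" using assms by (rule poly_roots_finite)
  then obtain B where "\<forall>z\<in>{z. poly p z = 0}. cmod z \<le> B" using finite_imp_bounded bounded_iff by metis
  thus ?thesis unfolding eventually_at_infinity by (intro exI[of _ "B + 1"]) force
qed

section \<open>Infinity as a regular singular point\<close>

locale poly_ode =
  fixes P R :: "complex poly"
  assumes P_nz: "P \<noteq> 0"
begin

definition solution :: "(complex \<Rightarrow> complex) \<Rightarrow> bool" where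
  "solution g \<longleftrightarrow> g holomorphic_on UNIV \<and> (\<exists>z. g z \<noteq> 0) \<and>
     (\<forall>z. poly P z * deriv (deriv g) z - poly (pderiv P) z * deriv g z + poly R z * g z = 0)"

definition A where "A z = poly (pderiv P) z / poly P z"
definition B where "B z = - (poly R z / poly P z)"

lemma solution_ode:
  assumes "solution g" "poly P z \<noteq> 0"
  shows "deriv (deriv g) z = A z * deriv g z + B z * g z"
proof -
  have "poly P z * deriv (deriv g) z - poly (pderiv P) z * deriv g z = - (poly R z * g z)"
    using assms unfolding solution_def
    by (simp add: add_eq_0_iff2)
  hence "poly P z * deriv (deriv g) z = poly (pderiv P) z * deriv g z - poly R z * g z"
    by (simp add: algebra_simps)
  thus ?thesis using assms(2) by (simp add: A_def B_def field_simps)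
qed

lemma solution_DERIV:
  assumes "solution g"
  shows "(g has_field_derivative deriv g z) (at z)"
    and "(deriv g has_field_derivative deriv (deriv g) z) (at z)"
  using assms holomorphic_derivI[of g UNIV] holomorphic_derivI[of "deriv g" UNIV] holomorphic_deriv[of g UNIV]
  unfolding solution_def by auto

text \<open>The degree of z P' does not exceed that of \<open>P\<close>; \<open>pCons 0\<close> is
  multiplication by z.\<close>

lemma zA_bounded: "\<exists>L\<ge>0. \<forall>\<^sub>F z in at_infinity. cmod (z * A z) \<le> L"
proof -
  have deg: "degree (pCons 0 (pderiv P)) \<le> degree P"
  proof (cases "pderiv P = 0")
    case False
    hence "degree P \<noteq> 0" by (simp add: pderiv_eq_0_iff)
    thus ?thesis using False by (simp add: degree_pderiv)
  qed simp
  have "((\<lambda>z. (poly (pCons 0 (pderiv P)) z / z ^ degree P) / (poly P z / z ^ degree P)) \<longlongrightarrow>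
      coeff (pCons 0 (pderiv P)) (degree P) / coeff P (degree P)) at_infinity"
    by (intro tendsto_divide poly_over_power_tendsto deg) (use P_nz in auto)
  hence "((\<lambda>z. cmod ((poly (pCons 0 (pderiv P)) z / z ^ degree P) / (poly P z / z ^ degree P))) \<longlongrightarrow>
      cmod (coeff (pCons 0 (pderiv P)) (degree P) / coeff P (degree P))) at_infinity"
    by (rule tendsto_norm)
  hence "\<forall>\<^sub>F z in at_infinity. cmod ((poly (pCons 0 (pderiv P)) z / z ^ degree P) / (poly P z / z ^ degree P))
     < cmod (coeff (pCons 0 (pderiv P)) (degree P) / coeff P (degree P)) + 1"
    by (rule order_tendstoD) simp
  moreover note nonzero_at_infinity
  ultimately have "\<forall>\<^sub>F z in at_infinity. cmod (z * A z) \<le> cmod (coeff (pCons 0 (pderiv P)) (degree P) / coeff P (degree P)) + 1"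
    by eventually_elim (simp add: A_def)
  thus ?thesis by (intro exI conjI) (auto intro: add_nonneg_nonneg)
qed

lemma at_infinity_radius:
  assumes "\<forall>\<^sub>F z :: complex in at_infinity. Q z"
  obtains r where "1 \<le> r" "\<And>z. r \<le> cmod z \<Longrightarrow> Q z"
proof -
  obtain b where "\<And>z. b \<le> cmod z \<Longrightarrow> Q z" using assms unfolding eventually_at_infinity by blast
  thus ?thesis using that[of "max 1 b"] by simp
qed

text \<open>If \<open>Q / P = O(z\<^sup>-\<^sup>2)\<close>, infinity is a regular singular point: substituting \<open>z = e\<^sup>t\<close>
  gives an equation with bounded coefficients.\<close>

lemma regular_singular_imp_poly:
  assumes deg: "R = 0 \<or> degree R + 2 \<le> degree P" and g: "solution g"
  shows "\<exists>p. g = poly p"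
proof -
  obtain L where L: "0 \<le> L" "\<forall>\<^sub>F z in at_infinity. cmod (z * A z) \<le> L" using zA_bounded by blast
  define R2 where "R2 = pCons 0 (pCons 0 R)"
  have deg2: "degree R2 \<le> degree P" unfolding R2_def using deg by (auto simp: degree_pCons_eq_if)
  define c where "c = coeff R2 (degree P) / coeff P (degree P)"
  have "((\<lambda>z. cmod ((poly R2 z / z ^ degree P) / (poly P z / z ^ degree P))) \<longlongrightarrow> cmod c) at_infinity"
    unfolding c_def by (intro tendsto_norm tendsto_divide poly_over_power_tendsto deg2) (use P_nz in auto)
  hence "\<forall>\<^sub>F z in at_infinity. cmod ((poly R2 z / z ^ degree P) / (poly P z / z ^ degree P)) < cmod c + 1"
    by (rule order_tendstoD) simp
  moreover note nonzero_at_infinity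
  ultimately have "\<forall>\<^sub>F z in at_infinity. cmod (z * A z) \<le> L \<and> cmod (z\<^sup>2 * B z) \<le> cmod c + 1 \<and> poly P z \<noteq> 0"
    using L(2) poly_nonzero_at_infinity[OF P_nz]
    by eventually_elim (simp add: B_def R2_def power2_eq_square mult.assoc)
  then obtain r where r: "1 \<le> r" "\<And>z. r \<le> cmod z \<Longrightarrow> cmod (z * A z) \<le> L \<and> cmod (z\<^sup>2 * B z) \<le> cmod c + 1 \<and> poly P z \<noteq> 0"
    by (rule at_infinity_radius) (rule that; assumption)
  \<comment> \<open>L + 1 instead of \<open>L\<close>, because differentiating z g' along z = e^t
    produces an extra term z g'.\<close>
  define k where "k = 1 + (cmod c + 1) + 2 * (L + 1)"
  have k: "0 \<le> k" using L by (simp add: k_def add_nonneg_nonneg)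
  \<comment> \<open>The supremum over the whole starting circle lets one constant serve all
    rays.\<close>
  define M where "M = (SUP z\<in>sphere 0 r. (cmod (g z))\<^sup>2 + (cmod (z * deriv g z))\<^sup>2)"
  have hol: "g holomorphic_on UNIV" "deriv g holomorphic_on UNIV"
    using g holomorphic_deriv[of g UNIV] unfolding solution_def by auto
  have cont: "continuous_on (sphere 0 r) (\<lambda>z. (cmod (g z))\<^sup>2 + (cmod (z * deriv g z))\<^sup>2)"
    by (intro continuous_intros holomorphic_on_imp_continuous_on[OF holomorphic_on_subset[OF hol(1)]]
          holomorphic_on_imp_continuous_on[OF holomorphic_on_subset[OF hol(2)]]) auto
  have M: "(cmod (g z))\<^sup>2 + (cmod (z * deriv g z))\<^sup>2 \<le> M" if "cmod z = r" for z
    unfolding M_def using that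
    by (intro cSUP_upper compact_imp_bounded[THEN bounded_imp_bdd_above] compact_continuous_image[OF cont]) auto
  have growth: "(cmod (g z))\<^sup>2 \<le> M * (cmod z / r) powr k" if z: "r \<le> cmod z" for z
  proof -
    define u where "u = sgn z"
    have z0: "z \<noteq> 0" using z r by auto
    have u: "cmod u = 1" using z0 by (simp add: u_def norm_sgn)
    define w where "w t = of_real (exp t) * u" for t
    have w: "cmod (w t) = exp t" for t by (simp add: w_def norm_mult u)
    have dw: "(w has_vector_derivative w t) (at t)" for t
      unfolding w_def[abs_def] by (auto intro!: derivative_eq_intros simp: scaleR_conv_of_real)
    have "(cmod (g (w (ln (cmod z)))))\<^sup>2 + (cmod (w (ln (cmod z)) * deriv g (w (ln (cmod z)))))\<^sup>2
       \<le> ((cmod (g (w (ln r))))\<^sup>2 + (cmod (w (ln r) * deriv g (w (ln r))))\<^sup>2) * exp ((1 + (cmod c + 1) + 2 * (L + 1)) * (ln (cmod z) - ln r))"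
    proof (rule second_order_energy_bound[where a = "\<lambda>t. w t * A (w t) + 1" and b = "\<lambda>t. (w t)\<^sup>2 * B (w t)"
         and ?G1.0 = "\<lambda>t. w t * deriv g (w t)"])
      fix t assume t: "ln r \<le> t" "t \<le> ln (cmod z)"
      have wr: "r \<le> cmod (w t)" using t r w by (metis exp_le_cancel_iff exp_ln less_le_trans zero_less_one)
      show "((\<lambda>t. g (w t)) has_vector_derivative w t * deriv g (w t)) (at t)"
        using field_vector_diff_chain_at[OF dw solution_DERIV(1)[OF g]] by (simp add: o_def)
      have "((\<lambda>t. w t * deriv g (w t)) has_vector_derivative (w t * (w t * deriv (deriv g) (w t)) + w t * deriv g (w t))) (at t)"
        using field_vector_diff_chain_at[OF dw solution_DERIV(2)[OF g]]
        by (intro has_vector_derivative_mult dw) (simp add: o_def)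
      moreover have "w t * (w t * deriv (deriv g) (w t)) + w t * deriv g (w t) =
          (w t * A (w t) + 1) * (w t * deriv g (w t)) + (w t)\<^sup>2 * B (w t) * g (w t)"
        using solution_ode[OF g, of "w t"] r(2)[OF wr] by (simp add: algebra_simps power2_eq_square)
      ultimately show "((\<lambda>t. w t * deriv g (w t)) has_vector_derivative
         (w t * A (w t) + 1) * (w t * deriv g (w t)) + (w t)\<^sup>2 * B (w t) * g (w t)) (at t)" by simp
      show "cmod (w t * A (w t) + 1) \<le> L + 1"
        using r(2)[OF wr] norm_triangle_ineq[of "w t * A (w t)" 1] by simp
      show "cmod ((w t)\<^sup>2 * B (w t)) \<le> cmod c + 1" using r(2)[OF wr] by simp
    qed (use z r z0 in \<open>simp add: ln_le_cancel_iff\<close>)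
    moreover have "w (ln (cmod z)) = z" using z0 by (simp add: w_def u_def sgn_eq)
    moreover have "cmod (w (ln r)) = r" using w r by simp
    moreover have "exp (k * (ln (cmod z) - ln r)) = (cmod z / r) powr k"
      using z0 r by (simp add: powr_def ln_div mult.commute)
    ultimately have "(cmod (g z))\<^sup>2 \<le> ((cmod (g (w (ln r))))\<^sup>2 + (cmod (w (ln r) * deriv g (w (ln r))))\<^sup>2) * (cmod z / r) powr k"
      unfolding k_def by (smt (verit) zero_le_power2)
    also have "\<dots> \<le> M * (cmod z / r) powr k"
      by (intro mult_right_mono M) (use w r in auto)
    finally show ?thesis .
  qed
  have M0: "0 \<le> M" using M[of "of_real r"] r by (smt (verit) norm_of_real zero_le_power2)
  obtain N :: nat where N: "k \<le> real N" using real_arch_simple by blast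
  have "cmod (g z) \<le> (M + 1) * cmod z ^ N" if z: "r \<le> cmod z" for z
  proof -
    have "(cmod z / r) powr k \<le> cmod z powr k"
      using divide_left_mono[OF r(1), of "cmod z"] r z k by (intro powr_mono2) auto
    also have "\<dots> \<le> cmod z powr real N" using r z N by (intro powr_mono) auto
    also have "\<dots> = cmod z ^ N" using r z by (subst powr_realpow) auto
    finally have "(cmod (g z))\<^sup>2 \<le> M * cmod z ^ N" using growth[OF z] M0 by (meson mult_left_mono order_trans)
    \<comment> \<open>A crude way to reach a square: y \<le> y^2 for y = (M + 1) |z|^N \<ge>
      1.\<close>
    also have "M * cmod z ^ N \<le> (M + 1) * cmod z ^ N * ((M + 1) * cmod z ^ N)"
    proof -
      have "1 \<le> cmod z ^ N" using r z by simp
      hence "1 * 1 \<le> (M + 1) * cmod z ^ N" using M0 by (intro mult_mono) auto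
      hence "(M + 1) * cmod z ^ N * 1 \<le> (M + 1) * cmod z ^ N * ((M + 1) * cmod z ^ N)" by (intro mult_left_mono) auto
      thus ?thesis by (simp add: algebra_simps) (smt (verit) zero_le_power norm_ge_zero)
    qed
    finally have "(cmod (g z))\<^sup>2 \<le> ((M + 1) * cmod z ^ N)\<^sup>2" by (simp only: power2_eq_square)
    thus ?thesis by (rule power2_le_imp_le) (use M0 in auto)
  qed
  thus ?thesis by (rule entire_poly_growth_imp_poly[OF hol(1)])
qed

end

section \<open>Sectors and rays at an irregular singular point\<close>

locale poly_ode_irregular = poly_ode +
  assumes R_nz: "R \<noteq> 0" and deg: "degree P < degree R + 2"
begin

definition n where "n = degree R + 2 - degree P"
definition \<rho> where "\<rho> = real n / 2"
text \<open>Chosen so that z^2 B(z) is asymptotic to K \<rho>^2 z^n; after the substitution by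
  \<open>sector\<close> the coefficient of \<open>G\<close> then tends to \<beta>^n K.\<close>

definition K where "K = - (lead_coeff R / lead_coeff P) / of_real (\<rho>\<^sup>2)"

lemma n_pos: "1 \<le> n" using deg by (simp add: n_def)
lemma \<rho>_pos: "0 < \<rho>" using n_pos by (simp add: \<rho>_def)
lemma K_nz: "K \<noteq> 0" using R_nz P_nz \<rho>_pos by (simp add: K_def)

lemma B_asymp: "((\<lambda>z. z\<^sup>2 * B z / z ^ n) \<longlongrightarrow> K * of_real (\<rho>\<^sup>2)) at_infinity"
proof -
  have "((\<lambda>z. - ((poly R z / z ^ degree R) / (poly P z / z ^ degree P))) \<longlongrightarrow> - (lead_coeff R / lead_coeff P)) at_infinity"
    by (intro tendsto_minus tendsto_divide poly_over_power_tendsto) (use P_nz in auto)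
  moreover have "\<forall>\<^sub>F z in at_infinity. - ((poly R z / z ^ degree R) / (poly P z / z ^ degree P)) = z\<^sup>2 * B z / z ^ n"
    using nonzero_at_infinity
  proof eventually_elim
    case (elim z)
    have "z ^ n * z ^ degree P = z\<^sup>2 * z ^ degree R" using deg by (simp add: n_def flip: power_add)
    hence "z ^ degree P / z ^ degree R = z\<^sup>2 / z ^ n" using elim by (simp add: field_simps)
    moreover have "(poly R z / z ^ degree R) / (poly P z / z ^ degree P) = poly R z / poly P z * (z ^ degree P / z ^ degree R)"
      by simp
    ultimately show ?case by (simp only: B_def) simp
  qed
  ultimately have "((\<lambda>z. z\<^sup>2 * B z / z ^ n) \<longlongrightarrow> - (lead_coeff R / lead_coeff P)) at_infinity"
    by (rule Lim_transform_eventually)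
  thus ?thesis using \<rho>_pos by (simp add: K_def)
qed

text \<open>The sector around the direction of \<open>\<beta>\<close>, parametrised by the right half-plane.\<close>

definition sector :: "complex \<Rightarrow> complex \<Rightarrow> complex" where
  "sector \<beta> w = \<beta> * w powr of_real (1 / \<rho>)"

text \<open>Since n / \<rho> = 2, the n-th power of the fractional power is an honest
  square.\<close>

lemma sector_power: "w \<noteq> 0 \<Longrightarrow> sector \<beta> w ^ n = \<beta> ^ n * w\<^sup>2"
proof -
  assume w: "w \<noteq> 0"
  have "(w powr of_real (1 / \<rho>)) ^ n = exp (of_nat n * (of_real (1 / \<rho>) * Ln w))"
    using w by (simp only: powr_def exp_of_nat_mult if_False)
  also have "of_nat n * (of_real (1 / \<rho>) * Ln w) = 2 * Ln w"
    using n_pos by (simp add: \<rho>_def)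
  also have "exp (2 * Ln w) = w\<^sup>2" using w by (simp add: exp_double)
  finally show ?thesis by (simp add: sector_def power_mult_distrib)
qed

lemma cmod_sector: "cmod (sector \<beta> w) = cmod \<beta> * cmod w powr (1 / \<rho>)"
  unfolding sector_def norm_mult by (subst norm_powr_real_powr') auto

lemma sector_nz: "\<beta> \<noteq> 0 \<Longrightarrow> w \<noteq> 0 \<Longrightarrow> sector \<beta> w \<noteq> 0"
  by (simp add: sector_def powr_def)

lemma DERIV_sector:
  assumes "0 < Re w"
  shows "(sector \<beta> has_field_derivative sector \<beta> w / (of_real \<rho> * w)) (at w)"
proof -
  have w: "w \<noteq> 0" "w \<notin> \<real>\<^sub>\<le>\<^sub>0" using assms by (auto simp: complex_nonpos_Reals_iff)
  have "((\<lambda>w. \<beta> * exp (of_real (1 / \<rho>) * Ln w)) has_field_derivative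
      \<beta> * (exp (of_real (1 / \<rho>) * Ln w) * (of_real (1 / \<rho>) * (1 / w)))) (at w)"
    using w by (auto intro!: derivative_eq_intros simp: divide_inverse)
  moreover have "\<beta> * (exp (of_real (1 / \<rho>) * Ln w) * (of_real (1 / \<rho>) * (1 / w))) = sector \<beta> w / (of_real \<rho> * w)"
    using w by (simp add: sector_def powr_def)
  ultimately have "((\<lambda>w. \<beta> * exp (of_real (1 / \<rho>) * Ln w)) has_field_derivative sector \<beta> w / (of_real \<rho> * w)) (at w)"
    by (simp only:)
  thus ?thesis
    by (rule has_field_derivative_transform_within_open[where S = "{w. 0 < Re w}"])
       (use assms in \<open>auto simp: sector_def powr_def open_halfspace_Re_gt\<close>)
qed

definition G where "G g \<beta> w = g (sector \<beta> w)"
definition G1 where "G1 g \<beta> w = deriv g (sector \<beta> w) * (sector \<beta> w / (of_real \<rho> * w))"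
definition ca where "ca \<beta> w = sector \<beta> w * A (sector \<beta> w) / (of_real \<rho> * w) + of_real (1 / \<rho> - 1) / w"
text \<open>Written so that \<open>B_asymp\<close> applies to the first quotient. By
  \<open>sector_power\<close> it is z^2 B(z) / (\<rho> w)^2 with z =
  \<open>sector \<beta> w\<close>.\<close>

definition cb where "cb \<beta> w = (sector \<beta> w)\<^sup>2 * B (sector \<beta> w) / sector \<beta> w ^ n * \<beta> ^ n / of_real (\<rho>\<^sup>2)"

lemma DERIV_G:
  assumes "solution g" "0 < Re w"
  shows "(G g \<beta> has_field_derivative G1 g \<beta> w) (at w)"
  unfolding G_def[abs_def] G1_def
  using DERIV_chain2[OF solution_DERIV(1)[OF assms(1)] DERIV_sector[OF assms(2)]] by simp

lemma DERIV_G1: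
  assumes g: "solution g" and w: "0 < Re w" and \<beta>: "\<beta> \<noteq> 0" and P: "poly P (sector \<beta> w) \<noteq> 0"
  shows "(G1 g \<beta> has_field_derivative ca \<beta> w * G1 g \<beta> w + cb \<beta> w * G g \<beta> w) (at w)"
proof -
  define z where "z = sector \<beta> w"
  have w0: "w \<noteq> 0" using w by auto
  have z0: "z \<noteq> 0" using sector_nz[OF \<beta> w0] by (simp add: z_def)
  have \<rho>0: "complex_of_real \<rho> \<noteq> 0" using \<rho>_pos by simp
  have 1: "((\<lambda>w. deriv g (sector \<beta> w)) has_field_derivative deriv (deriv g) z * (z / (of_real \<rho> * w))) (at w)"
    unfolding z_def using DERIV_chain2[OF solution_DERIV(2)[OF g] DERIV_sector[OF w]] by simp
  have 2: "((\<lambda>w. sector \<beta> w / (of_real \<rho> * w)) has_field_derivative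
      (z / (of_real \<rho> * w) * (of_real \<rho> * w) - z * of_real \<rho>) / ((of_real \<rho> * w) * (of_real \<rho> * w))) (at w)"
    unfolding z_def using w0 \<rho>0 by (auto intro!: derivative_eq_intros DERIV_sector[OF w])
  have cb: "cb \<beta> w = z\<^sup>2 * B z / (of_real \<rho> * w)\<^sup>2"
    using sector_power[OF w0, of \<beta>] \<beta> w0 \<rho>0 unfolding cb_def z_def by (simp add: field_simps power_mult_distrib)
  have "deriv (deriv g) z * (z / (of_real \<rho> * w)) * (z / (of_real \<rho> * w)) +
      (z / (of_real \<rho> * w) * (of_real \<rho> * w) - z * of_real \<rho>) / ((of_real \<rho> * w) * (of_real \<rho> * w)) * deriv g z
      = ca \<beta> w * G1 g \<beta> w + cb \<beta> w * G g \<beta> w"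
    using w0 \<rho>0 solution_ode[OF g P, folded z_def]
    unfolding cb ca_def G1_def G_def z_def[symmetric]
    by (simp add: field_simps power2_eq_square)
  with DERIV_mult[OF 1 2] show ?thesis unfolding G1_def[abs_def] z_def[symmetric] by (simp add: z_def)
qed

text \<open>The radius depends on \<beta> through |\<beta>| only. This uniformity lets
  \<open>growth_bound\<close> use a different \<beta> on each ray.\<close>

lemma coeff_bounds:
  assumes B0: "0 < B0" and e: "0 < e"
  obtains r where "1 \<le> r"
    "\<And>\<beta> w. cmod \<beta> = B0 \<Longrightarrow> 0 < Re w \<Longrightarrow> r \<le> cmod w \<Longrightarrow>
        poly P (sector \<beta> w) \<noteq> 0 \<and> cmod (ca \<beta> w) \<le> e \<and> cmod (cb \<beta> w - \<beta> ^ n * K) \<le> e"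
proof -
  obtain L where L: "0 \<le> L" "\<forall>\<^sub>F z in at_infinity. cmod (z * A z) \<le> L" using zA_bounded by blast
  \<comment> \<open>Scaled so that the factor |\<beta>|^n / \<rho>^2 turns it back into
    \<open>e\<close>.\<close>
  define d where "d = e * \<rho>\<^sup>2 / B0 ^ n"
  have d: "0 < d" using e B0 \<rho>_pos by (simp add: d_def)
  have "\<forall>\<^sub>F z in at_infinity. dist (z\<^sup>2 * B z / z ^ n) (K * of_real (\<rho>\<^sup>2)) < d"
    using tendstoD[OF B_asymp d] .
  hence "\<forall>\<^sub>F z in at_infinity. cmod (z * A z) \<le> L \<and> cmod (z\<^sup>2 * B z / z ^ n - K * of_real (\<rho>\<^sup>2)) < d \<and> poly P z \<noteq> 0"
    using L(2) poly_nonzero_at_infinity[OF P_nz] by eventually_elim (simp add: dist_norm)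
  then obtain r1 where r1: "1 \<le> r1" "\<And>z. r1 \<le> cmod z \<Longrightarrow>
      cmod (z * A z) \<le> L \<and> cmod (z\<^sup>2 * B z / z ^ n - K * of_real (\<rho>\<^sup>2)) < d \<and> poly P z \<noteq> 0"
    by (rule at_infinity_radius) (rule that; assumption)
  define M where "M = L / \<rho> + \<bar>1 / \<rho> - 1\<bar>"
  define r where "r = max 1 (max ((r1 / B0) powr \<rho>) (M / e))"
  show ?thesis
  proof (rule that[of r])
    fix \<beta> w assume \<beta>: "cmod \<beta> = B0" and w: "0 < Re w" "r \<le> cmod w"
    let ?z = "sector \<beta> w"
    have w1: "1 \<le> cmod w" "(r1 / B0) powr \<rho> \<le> cmod w" "M / e \<le> cmod w" using w by (auto simp: r_def)
    have "r1 / B0 = ((r1 / B0) powr \<rho>) powr (1 / \<rho>)" using r1 B0 \<rho>_pos by (simp add: powr_powr)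
    also have "\<dots> \<le> cmod w powr (1 / \<rho>)" using w1 \<rho>_pos by (intro powr_mono2) auto
    finally have "r1 \<le> cmod ?z" using B0 \<beta> by (simp add: cmod_sector field_simps)
    from r1(2)[OF this] have z: "cmod (?z * A ?z) \<le> L" "cmod (?z\<^sup>2 * B ?z / ?z ^ n - K * of_real (\<rho>\<^sup>2)) < d" "poly P ?z \<noteq> 0"
      by auto
    have w0: "0 < cmod w" using w1 by linarith
    have "cmod (ca \<beta> w) \<le> cmod (?z * A ?z) / (\<rho> * cmod w) + \<bar>1 / \<rho> - 1\<bar> / cmod w"
      unfolding ca_def using norm_triangle_ineq[of "?z * A ?z / (of_real \<rho> * w)" "of_real (1 / \<rho> - 1) / w"] \<rho>_pos
      by (simp add: norm_divide norm_mult del: of_real_diff of_real_divide)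
    also have "\<dots> \<le> L / (\<rho> * cmod w) + \<bar>1 / \<rho> - 1\<bar> / cmod w"
      using z(1) \<rho>_pos w0 by (intro add_right_mono divide_right_mono) auto
    also have "\<dots> = M / cmod w" using \<rho>_pos w0 by (simp add: M_def field_simps)
    also have "\<dots> \<le> e" using w1(3) w0 e by (simp add: field_simps)
    finally have 1: "cmod (ca \<beta> w) \<le> e" .
    have "cb \<beta> w - \<beta> ^ n * K = (?z\<^sup>2 * B ?z / ?z ^ n - K * of_real (\<rho>\<^sup>2)) * (\<beta> ^ n / of_real (\<rho>\<^sup>2))"
    proof -
      have "x * b / k - b * K = (x - K * k) * (b / k)" if "k \<noteq> 0" for x b k :: complex
        using that by (simp add: field_simps)
      thus ?thesis unfolding cb_def using \<rho>_pos by (metis of_real_eq_0_iff power_not_zero less_irrefl)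
    qed
    hence "cmod (cb \<beta> w - \<beta> ^ n * K) = cmod (?z\<^sup>2 * B ?z / ?z ^ n - K * of_real (\<rho>\<^sup>2)) * (B0 ^ n / \<rho>\<^sup>2)"
      by (simp add: norm_mult norm_divide norm_power \<beta>)
    also have "\<dots> \<le> d * (B0 ^ n / \<rho>\<^sup>2)" using z(2) B0 by (intro mult_right_mono) auto
    also have "\<dots> = e" using B0 \<rho>_pos by (simp add: d_def)
    finally show "poly P ?z \<noteq> 0 \<and> cmod (ca \<beta> w) \<le> e \<and> cmod (cb \<beta> w - \<beta> ^ n * K) \<le> e" using 1 z(3) by simp
  qed (simp add: r_def)
qed

lemma halfplane:
  assumes g: "solution g" and \<beta>: "\<beta> ^ n * K = 1"
  obtains R0 where "halfplane_ode (G g \<beta>) (G1 g \<beta>) (ca \<beta>) (cb \<beta>) R0"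
proof -
  have \<beta>0: "\<beta> \<noteq> 0" using \<beta> n_pos by (auto simp: power_0_left)
  hence B0: "0 < cmod \<beta>" by simp
  obtain R0 where R0: "1 \<le> R0"
    "\<And>w. 0 < Re w \<Longrightarrow> R0 \<le> cmod w \<Longrightarrow> poly P (sector \<beta> w) \<noteq> 0"
    using coeff_bounds[OF B0 zero_less_one] by metis
  have "halfplane_ode (G g \<beta>) (G1 g \<beta>) (ca \<beta>) (cb \<beta>) R0"
  proof
    fix z :: complex assume z: "0 < Re z" "R0 \<le> cmod z"
    show "(G g \<beta> has_field_derivative G1 g \<beta> z) (at z)" by (rule DERIV_G[OF g z(1)])
    show "(G1 g \<beta> has_field_derivative ca \<beta> z * G1 g \<beta> z + cb \<beta> z * G g \<beta> z) (at z)"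
      by (rule DERIV_G1[OF g z(1) \<beta>0 R0(2)[OF z]])
  next
    fix e :: real assume "0 < e"
    then obtain r where r: "1 \<le> r" "\<And>w. 0 < Re w \<Longrightarrow> r \<le> cmod w \<Longrightarrow> cmod (ca \<beta> w) \<le> e \<and> cmod (cb \<beta> w - 1) \<le> e"
      using coeff_bounds[OF B0] \<beta> by metis
    show "\<exists>R\<ge>R0. \<forall>z. 0 < Re z \<and> R \<le> cmod z \<longrightarrow> cmod (ca \<beta> z) \<le> e \<and> cmod (cb \<beta> z - 1) \<le> e"
      by (intro exI[of _ "max R0 r"]) (use r in auto)
  qed
  thus ?thesis by (rule that)
qed

text \<open>Formally the solutions behave like exp (+- sqrt (K z^n)). As \<open>csqrt\<close> has
  nonnegative real part, its real part is the larger of the two rates on the ray.\<close>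

definition dominant_on where
  "dominant_on g \<theta> \<longleftrightarrow> ((\<lambda>r. ln (cmod (g (of_real r * cis \<theta>))) / r powr \<rho>) \<longlongrightarrow> Re (csqrt (K * cis (real n * \<theta>)))) at_top"

definition recessive_on where
  "recessive_on g \<theta> \<longleftrightarrow> (\<forall>d>0. \<forall>\<^sub>F r in at_top.
      cmod (g (of_real r * cis \<theta>)) \<le> exp (- (Re (csqrt (K * cis (real n * \<theta>))) - d) * r powr \<rho>))"

text \<open>On the ray through \<beta> the number K cis (n \<theta>) is positive, so the rate takes
  its largest value.\<close>

lemma dominant_on_central:
  assumes "\<beta> ^ n * K = 1"
  shows "Re (csqrt (K * cis (real n * Arg \<beta>))) = sqrt (cmod K)"
    and "sqrt (cmod K) = cmod \<beta> powr (- \<rho>)"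
proof -
  have \<beta>0: "\<beta> \<noteq> 0" using assms n_pos by (auto simp: power_0_left)
  have "\<beta> = of_real (cmod \<beta>) * cis (Arg \<beta>)" using \<beta>0 by (simp add: cis_Arg sgn_eq)
  hence "\<beta> ^ n = of_real (cmod \<beta> ^ n) * cis (real n * Arg \<beta>)"
    by (metis Complex.DeMoivre of_real_power power_mult_distrib)
  hence "of_real (cmod \<beta> ^ n) * (K * cis (real n * Arg \<beta>)) = 1" using assms by (simp add: mult_ac)
  hence eq: "K * cis (real n * Arg \<beta>) = of_real (1 / cmod \<beta> ^ n)" using \<beta>0 by (simp add: field_simps)
  have "cmod \<beta> ^ n * cmod K = 1" using assms by (metis norm_mult norm_one norm_power)
  hence cK: "cmod K = 1 / cmod \<beta> ^ n" using \<beta>0 by (simp add: field_simps)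
  show "Re (csqrt (K * cis (real n * Arg \<beta>))) = sqrt (cmod K)"
    unfolding eq cK by (subst csqrt_of_real) auto
  have "cmod \<beta> powr (- real n) = inverse (cmod \<beta> ^ n)" using \<beta>0 by (simp add: powr_minus powr_realpow)
  hence e: "cmod K = cmod \<beta> powr (- real n)" unfolding cK by (simp add: inverse_eq_divide)
  have "sqrt (cmod K) = cmod K powr (1/2)" by (simp add: powr_half_sqrt)
  also have "\<dots> = cmod \<beta> powr (- real n * (1/2))" unfolding e by (rule powr_powr)
  also have "- real n * (1/2) = - \<rho>" by (simp add: \<rho>_def)
  finally show "sqrt (cmod K) = cmod \<beta> powr (- \<rho>)" .
qed


text \<open>\<open>csqrt (K * cis (n \<theta>))\<close> is the direction w that the ray must have in
  the half-plane, and \<beta> = cis \<theta> / w^(1/\<rho>) is then the direction of the sector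
  containing it.\<close>

lemma ray_in_sector:
  assumes pos: "0 < Re (csqrt (K * cis (real n * \<theta>)))"
  obtains \<beta> u where "\<beta> ^ n * K = 1" "cmod u = 1" "0 < Re u"
    "Re (csqrt (K * cis (real n * \<theta>))) = sqrt (cmod K) * Re u"
    "\<And>r. 0 < r \<Longrightarrow> sector \<beta> (of_real (sqrt (cmod K) * r powr \<rho>) * u) = of_real r * cis \<theta>"
proof -
  define w where "w = csqrt (K * cis (real n * \<theta>))"
  have w2: "w\<^sup>2 = K * cis (real n * \<theta>)" by (simp add: w_def)
  have cw: "cmod w = sqrt (cmod K)" by (simp add: w_def norm_mult)
  have w0: "w \<noteq> 0" using pos by (auto simp: w_def)
  define \<beta> where "\<beta> = cis \<theta> / w powr of_real (1 / \<rho>)"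
  define u where "u = w / of_real (sqrt (cmod K))"
  have sK: "0 < sqrt (cmod K)" using K_nz by simp
  have wp: "w powr of_real (1 / \<rho>) \<noteq> 0" using w0 by (simp add: powr_def)
  have "sector 1 w ^ n = w\<^sup>2" using sector_power[OF w0, of 1] by simp
  hence "(w powr of_real (1 / \<rho>)) ^ n = w\<^sup>2" by (simp add: sector_def)
  hence "\<beta> ^ n = cis (real n * \<theta>) / w\<^sup>2" by (simp add: \<beta>_def power_divide Complex.DeMoivre)
  hence 1: "\<beta> ^ n * K = 1" using K_nz by (simp add: w2)
  show ?thesis
  proof (rule that[OF 1])
    show "cmod u = 1" using sK K_nz by (simp add: u_def norm_divide cw)
    show "0 < Re u" using pos sK by (simp add: u_def w_def[symmetric])
    show "Re (csqrt (K * cis (real n * \<theta>))) = sqrt (cmod K) * Re u" using sK K_nz by (simp add: u_def w_def)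
    fix r :: real assume r: "0 < r"
    have "of_real (sqrt (cmod K) * r powr \<rho>) * u = of_real (r powr \<rho>) * w" using sK K_nz by (simp add: u_def)
    hence "sector \<beta> (of_real (sqrt (cmod K) * r powr \<rho>) * u) = \<beta> * (of_real (r powr \<rho>) powr of_real (1 / \<rho>) * w powr of_real (1 / \<rho>))"
      unfolding sector_def by (simp only:) (subst powr_times_real_left, auto)
    also have "of_real (r powr \<rho>) powr of_real (1 / \<rho>) = (of_real r :: complex)"
      using r \<rho>_pos by (subst powr_of_real) (auto simp: powr_powr)
    finally show "sector \<beta> (of_real (sqrt (cmod K) * r powr \<rho>) * u) = of_real r * cis \<theta>"
      using wp by (simp add: \<beta>_def)
  qed
qed

lemma filterlim_scaled_powr:
  assumes "0 < c"
  shows "filterlim (\<lambda>r. c * r powr \<rho>) at_top at_top"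
proof (rule filterlim_tendsto_pos_mult_at_top[OF tendsto_const assms])
  have "filterlim (\<lambda>r. exp (\<rho> * ln r)) at_top at_top"
    by (intro filterlim_compose[OF exp_at_top] filterlim_tendsto_pos_mult_at_top[OF tendsto_const \<rho>_pos] ln_at_top)
  moreover have "\<forall>\<^sub>F r in at_top. exp (\<rho> * ln r) = r powr \<rho>"
    using eventually_gt_at_top[of 0] by eventually_elim (simp add: powr_def)
  ultimately show "filterlim (\<lambda>r. r powr \<rho>) at_top at_top"
    by (rule filterlim_cong[OF refl refl, THEN iffD1, rotated])
qed

lemma central_ray:
  assumes "\<beta> ^ n * K = 1" "0 < r"
  shows "sector \<beta> (of_real (sqrt (cmod K) * r powr \<rho>) * 1) = of_real r * cis (Arg \<beta>)"
proof -
  have \<beta>0: "\<beta> \<noteq> 0" using assms n_pos by (auto simp: power_0_left)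
  have "sqrt (cmod K) * r powr \<rho> = (r / cmod \<beta>) powr \<rho>"
    using dominant_on_central(2)[OF assms(1)] \<beta>0 assms(2) by (simp add: powr_divide powr_minus field_simps)
  hence "of_real (sqrt (cmod K) * r powr \<rho>) powr (of_real (1 / \<rho>) :: complex) = of_real (r / cmod \<beta>)"
    using assms(2) \<beta>0 \<rho>_pos by (simp only:, subst powr_of_real) (auto simp: powr_powr)
  hence "sector \<beta> (of_real (sqrt (cmod K) * r powr \<rho>) * 1) = \<beta> * of_real (r / cmod \<beta>)"
    by (simp only: sector_def mult_1_right)
  also have "\<dots> = of_real r * (\<beta> / of_real (cmod \<beta>))" by simp
  also have "\<beta> / of_real (cmod \<beta>) = cis (Arg \<beta>)" using \<beta>0 by (simp add: cis_Arg sgn_eq)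
  finally show ?thesis .
qed

text \<open>The dominant alternative also records, by \<open>dominant_transfer\<close> to the
  direction 1, that the central ray of the sector is dominant. That ray yields the maximum modulus
  and the contradiction in the case of one sector.\<close>

lemma ray_dichotomy:
  assumes g: "solution g" and pos: "0 < Re (csqrt (K * cis (real n * \<theta>)))"
  shows "recessive_on g \<theta> \<or> dominant_on g \<theta> \<and> (\<exists>\<beta>. \<beta> ^ n * K = 1 \<and> dominant_on g (Arg \<beta>))"
proof -
  obtain \<beta> u where \<beta>: "\<beta> ^ n * K = 1" and u: "cmod u = 1" "0 < Re u"
    and Ku: "Re (csqrt (K * cis (real n * \<theta>))) = sqrt (cmod K) * Re u"
    and eq: "\<And>r. 0 < r \<Longrightarrow> sector \<beta> (of_real (sqrt (cmod K) * r powr \<rho>) * u) = of_real r * cis \<theta>"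
    using ray_in_sector[OF pos] by metis
  have sK: "0 < sqrt (cmod K)" using K_nz by simp
  obtain R0 where hp: "halfplane_ode (G g \<beta>) (G1 g \<beta>) (ca \<beta>) (cb \<beta>) R0" using halfplane[OF g \<beta>] .
  interpret h: halfplane_ode "G g \<beta>" "G1 g \<beta>" "ca \<beta>" "cb \<beta>" R0 by (rule hp)
  \<comment> \<open>The parameter s = sqrt |K| r^\<rho> on the half-plane ray corresponds to the
    radius \<open>r\<close> on the original ray.\<close>
  have key: "((\<lambda>r. ln (cmod (g (of_real r * cis \<phi>))) / r powr \<rho>) \<longlongrightarrow> sqrt (cmod K) * Re v) at_top"
    if v: "cmod v = 1" "0 < Re v" "h.dominant v" and
       eq: "\<And>r. 0 < r \<Longrightarrow> sector \<beta> (of_real (sqrt (cmod K) * r powr \<rho>) * v) = of_real r * cis \<phi>" for v \<phi>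
  proof -
    have "((\<lambda>r. sqrt (cmod K) * (ln (cmod (G g \<beta> (of_real (sqrt (cmod K) * r powr \<rho>) * v))) / (sqrt (cmod K) * r powr \<rho>)))
        \<longlongrightarrow> sqrt (cmod K) * Re v) at_top"
      by (intro tendsto_mult_left filterlim_compose[OF h.dominant_limit[OF v] filterlim_scaled_powr[OF sK]])
    moreover have "\<forall>\<^sub>F r in at_top. sqrt (cmod K) * (ln (cmod (G g \<beta> (of_real (sqrt (cmod K) * r powr \<rho>) * v))) / (sqrt (cmod K) * r powr \<rho>))
       = ln (cmod (g (of_real r * cis \<phi>))) / r powr \<rho>"
      using eventually_gt_at_top[of 0] by eventually_elim (use sK K_nz in \<open>simp add: G_def eq del: of_real_mult\<close>)
    ultimately show ?thesis by (rule Lim_transform_eventually)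
  qed
  show ?thesis
  proof (cases "h.dominant u")
    case True
    have "dominant_on g \<theta>" unfolding dominant_on_def Ku by (rule key[OF u True eq])
    moreover have "h.dominant 1" using h.dominant_transfer[OF u _ _ True, of 1] by simp
    hence "dominant_on g (Arg \<beta>)" unfolding dominant_on_def dominant_on_central(1)[OF \<beta>]
      using key[of 1 "Arg \<beta>"] central_ray[OF \<beta>] by simp
    ultimately show ?thesis using \<beta> by blast
  next
    case False
    have "recessive_on g \<theta>" unfolding recessive_on_def
    proof (intro allI impI)
      fix d :: real assume d: "0 < d"
      hence "0 < d / sqrt (cmod K)" using sK by simp
      from h.not_dominant_decay[OF u False this]
      have "\<forall>\<^sub>F r in at_top. cmod (G g \<beta> (of_real (sqrt (cmod K) * r powr \<rho>) * u))
         \<le> exp (- (Re u - d / sqrt (cmod K)) * (sqrt (cmod K) * r powr \<rho>))"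
        by (rule eventually_compose_filterlim[OF _ filterlim_scaled_powr[OF sK]])
      thus "\<forall>\<^sub>F r in at_top. cmod (g (of_real r * cis \<theta>))
            \<le> exp (- (Re (csqrt (K * cis (real n * \<theta>))) - d) * r powr \<rho>)"
        using eventually_gt_at_top[of 0]
      proof eventually_elim
        case (elim r)
        have exps: "- (Re u - d / sqrt (cmod K)) * (sqrt (cmod K) * r powr \<rho>) = - (sqrt (cmod K) * Re u - d) * r powr \<rho>"
          using sK K_nz by (simp add: field_simps)
        from elim(1) show ?case unfolding G_def eq[OF elim(2)] Ku exps .
      qed
    qed
    thus ?thesis by blast
  qed
qed

text \<open>Each \<open>z\<close> is reached along its own ray, with \<beta> pointing at
  \<open>z\<close>. Then \<beta>^n K has modulus 1 and any argument, and the energy estimate uses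
  the modulus alone; so the bound is uniform and includes the rays between the sectors.\<close>

lemma growth_bound:
  assumes g: "solution g" and e: "0 < e"
  obtains C r0 where "0 < C" "1 \<le> r0"
    "\<And>z. r0 \<le> cmod z \<Longrightarrow> cmod (g z) \<le> C * exp ((1 + e) * sqrt (cmod K) * cmod z powr \<rho>)"
proof -
  \<comment> \<open>The modulus of \<beta> for which |\<beta>^n K| = 1.\<close>
  define B0 where "B0 = cmod K powr (- 1 / real n)"
  have B0: "0 < B0" using K_nz by (simp add: B0_def)
  have B0n: "B0 ^ n * cmod K = 1"
  proof -
    have "B0 ^ n = B0 powr real n" using B0 by (simp add: powr_realpow)
    also have "\<dots> = cmod K powr (- 1)" using n_pos by (simp add: B0_def powr_powr)
    finally show ?thesis using K_nz by (simp add: powr_minus field_simps)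
  qed
  \<comment> \<open>Energy rate for the coefficient bounds 1 + e/2 and e/2; half of it is 1 + 3/4 e
    < 1 + e.\<close>
  define k where "k = 1 + (1 + e / 2) + 2 * (e / 2)"
  have "0 < e / 2" using e by simp
  then obtain s0 where s0: "1 \<le> s0" and cf: "\<And>\<beta> w. cmod \<beta> = B0 \<Longrightarrow> 0 < Re w \<Longrightarrow> s0 \<le> cmod w \<Longrightarrow>
        poly P (sector \<beta> w) \<noteq> 0 \<and> cmod (ca \<beta> w) \<le> e / 2 \<and> cmod (cb \<beta> w - \<beta> ^ n * K) \<le> e / 2"
    using coeff_bounds[OF B0] by metis
  define r0 where "r0 = max 1 (B0 * s0 powr (1 / \<rho>))"
  define rs where "rs = B0 * s0 powr (1 / \<rho>)"
  define F where "F z = (cmod (g z))\<^sup>2 + (cmod (deriv g z * (z / of_real (\<rho> * s0))))\<^sup>2" for z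
  define M where "M = (SUP z\<in>sphere 0 rs. F z)"
  have hol: "g holomorphic_on UNIV" "deriv g holomorphic_on UNIV"
    using g holomorphic_deriv[of g UNIV] unfolding solution_def by auto
  have cont: "continuous_on (sphere 0 rs) F"
    unfolding F_def using \<rho>_pos s0
    by (intro continuous_intros holomorphic_on_imp_continuous_on[OF holomorphic_on_subset[OF hol(1)]]
          holomorphic_on_imp_continuous_on[OF holomorphic_on_subset[OF hol(2)]]) auto
  have M: "F z \<le> M" if "cmod z = rs" for z
    unfolding M_def using that
    by (intro cSUP_upper compact_imp_bounded[THEN bounded_imp_bdd_above] compact_continuous_image[OF cont]) auto
  have M0: "0 \<le> M"
  proof -
    have "0 \<le> F (of_real rs)" by (simp add: F_def)
    also have "\<dots> \<le> M" using B0 by (intro M) (simp add: rs_def norm_mult)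
    finally show ?thesis .
  qed
  have main: "(cmod (g z))\<^sup>2 \<le> M * exp (k * (sqrt (cmod K) * cmod z powr \<rho> - s0))" if z: "r0 \<le> cmod z" for z
  proof -
    define \<beta> where "\<beta> = of_real B0 * sgn z"
    define s where "s = sqrt (cmod K) * cmod z powr \<rho>"
    have z0: "z \<noteq> 0" using z by (auto simp: r0_def)
    have \<beta>: "cmod \<beta> = B0" "\<beta> \<noteq> 0" using z0 B0 by (auto simp: \<beta>_def norm_mult norm_sgn sgn_eq_0_iff)
    have b1: "cmod (\<beta> ^ n * K) = 1" using B0n \<beta> by (simp add: norm_mult norm_power)
    have sz: "s = (cmod z / B0) powr \<rho>"
    proof -
      have "B0 powr (- \<rho>) = cmod K powr (- 1 / real n * - \<rho>)" unfolding B0_def by (rule powr_powr)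
      also have "- 1 / real n * - \<rho> = 1 / 2" using n_pos by (simp add: \<rho>_def)
      finally have "B0 powr (- \<rho>) = sqrt (cmod K)" by (simp add: powr_half_sqrt)
      thus ?thesis using B0 by (simp add: s_def powr_divide powr_minus field_simps)
    qed
    have "s0 = ((B0 * s0 powr (1 / \<rho>)) / B0) powr \<rho>" using B0 s0 \<rho>_pos by (simp add: powr_powr)
    also have "\<dots> \<le> s" unfolding sz using z B0 \<rho>_pos by (intro powr_mono2 divide_right_mono) (auto simp: r0_def)
    finally have s: "s0 \<le> s" .
    have sec: "sector \<beta> (of_real s) = z"
    proof -
      have "(of_real s :: complex) powr of_real (1 / \<rho>) = of_real (cmod z / B0)"
        unfolding sz using \<rho>_pos B0 by (subst powr_of_real) (auto simp: powr_powr)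
      thus ?thesis using B0 z0 by (simp add: sector_def \<beta>_def sgn_eq)
    qed
    have dz: "((\<lambda>t::real. of_real t :: complex) has_vector_derivative 1) (at t)" for t
      by (auto intro!: derivative_eq_intros simp: has_vector_derivative_def scaleR_conv_of_real)
    have "(cmod (G g \<beta> (of_real s)))\<^sup>2 + (cmod (G1 g \<beta> (of_real s)))\<^sup>2
      \<le> ((cmod (G g \<beta> (of_real s0)))\<^sup>2 + (cmod (G1 g \<beta> (of_real s0)))\<^sup>2) * exp ((1 + (1 + e / 2) + 2 * (e / 2)) * (s - s0))"
    proof (rule second_order_energy_bound[where a = "\<lambda>t. ca \<beta> (of_real t)" and b = "\<lambda>t. cb \<beta> (of_real t)"])
      fix t assume t: "s0 \<le> t" "t \<le> s"
      have pos: "0 < Re (complex_of_real t)" "s0 \<le> cmod (complex_of_real t)" using t s0 by auto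
      note cft = cf[OF \<beta>(1) pos]
      show "((\<lambda>t. G g \<beta> (of_real t)) has_vector_derivative G1 g \<beta> (of_real t)) (at t)"
        using field_vector_diff_chain_at[OF dz DERIV_G[OF g pos(1), of \<beta>]] by (simp add: o_def)
      show "((\<lambda>t. G1 g \<beta> (of_real t)) has_vector_derivative
          ca \<beta> (of_real t) * G1 g \<beta> (of_real t) + cb \<beta> (of_real t) * G g \<beta> (of_real t)) (at t)"
        using field_vector_diff_chain_at[OF dz DERIV_G1[OF g pos(1) \<beta>(2)]] cft by (simp add: o_def)
      show "cmod (ca \<beta> (of_real t)) \<le> e / 2" using cft by simp
      show "cmod (cb \<beta> (of_real t)) \<le> 1 + e / 2"
        using cft norm_triangle_ineq2[of "cb \<beta> (of_real t)" "\<beta> ^ n * K"] b1 by linarith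
    qed (rule s)
    moreover have "G g \<beta> (of_real s) = g z" by (simp add: G_def sec)
    moreover have "(cmod (G g \<beta> (of_real s0)))\<^sup>2 + (cmod (G1 g \<beta> (of_real s0)))\<^sup>2 = F (sector \<beta> (of_real s0))"
      by (simp add: G_def G1_def F_def)
    moreover have "F (sector \<beta> (of_real s0)) \<le> M"
      using s0 B0 by (intro M) (simp add: cmod_sector \<beta> rs_def)
    moreover have "0 \<le> (cmod (G1 g \<beta> (of_real s)))\<^sup>2" by simp
    ultimately show ?thesis unfolding k_def s_def[symmetric]
      by (smt (verit) exp_gt_zero mult_right_mono)
  qed
  have k: "k = 2 * (1 + 3/4 * e)" by (simp add: k_def)
  show ?thesis
  proof (rule that[of "sqrt M + 1" r0])
    show "0 < sqrt M + 1" using M0 by (simp add: add_nonneg_pos)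
    fix z assume z: "r0 \<le> cmod z"
    define s where "s = sqrt (cmod K) * cmod z powr \<rho>"
    have s: "0 \<le> s" by (simp add: s_def)
    have "k * (s - s0) \<le> 2 * ((1 + e) * s)"
    proof -
      have "0 \<le> k * s0" using e s0 by (simp add: k)
      moreover have "k * s \<le> 2 * (1 + e) * s" using e s unfolding k by (intro mult_right_mono) auto
      moreover have "2 * (1 + e) * s = 2 * ((1 + e) * s)" by simp
      ultimately show ?thesis unfolding right_diff_distrib by linarith
    qed
    hence "(cmod (g z))\<^sup>2 \<le> M * exp (2 * ((1 + e) * s))"
      using main[OF z, folded s_def] M0 by (smt (verit) exp_le_cancel_iff mult_left_mono)
    also have "\<dots> = (sqrt M * exp ((1 + e) * s))\<^sup>2" using M0 by (simp add: power_mult_distrib exp_double)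
    finally have "cmod (g z) \<le> sqrt M * exp ((1 + e) * s)" by (rule power2_le_imp_le) (use M0 in auto)
    also have "\<dots> \<le> (sqrt M + 1) * exp ((1 + e) * s)" by (simp add: algebra_simps)
    finally show "cmod (g z) \<le> (sqrt M + 1) * exp ((1 + e) * sqrt (cmod K) * cmod z powr \<rho>)"
      by (simp add: s_def mult.assoc)
  qed (simp add: r0_def)
qed

end

section \<open>Growth of the solutions\<close>

lemma negligible_if_countable: "countable S \<Longrightarrow> negligible (S :: real set)"
  using negligible_countable_Union[of "(\<lambda>x. {x}) ` S"] by auto

text \<open>For r \<ge> 1 the zeros, including one at the origin, can only raise the mean of ln
  |g|.\<close>

lemma entire_jensen_lower:
  assumes g: "g holomorphic_on UNIV" "g w \<noteq> 0"
  obtains C where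
    "\<And>r. 0 < r \<Longrightarrow> (\<lambda>\<theta>. ln (cmod (g (of_real r * cis \<theta>)))) absolutely_integrable_on {0..2*pi}"
    "\<And>r. 1 \<le> r \<Longrightarrow> - C \<le> integral {0..2*pi} (\<lambda>\<theta>. ln (cmod (g (of_real r * cis \<theta>))))"
proof -
  obtain k G where G: "G holomorphic_on UNIV" "G 0 \<noteq> 0" and gG: "\<And>z. g z = (z - 0) ^ k * G z"
    using entire_factor_at[OF g] by metis
  have *: "(\<lambda>\<theta>. ln (cmod (g (of_real r * cis \<theta>)))) absolutely_integrable_on {0..2*pi} \<and>
     2 * pi * ln (cmod (G 0)) + 2 * pi * (real k * ln r) \<le> integral {0..2*pi} (\<lambda>\<theta>. ln (cmod (g (of_real r * cis \<theta>))))"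
    if r: "0 < r" for r
  proof -
    define Z where "Z = {a. cmod a \<le> r \<and> G a = 0}"
    have Z: "finite Z" unfolding Z_def by (rule entire_zeros_finite[OF G])
    obtain m where J: "((\<lambda>\<theta>. ln (cmod (G (of_real r * cis \<theta>)))) has_integral
        2 * pi * (ln (cmod (G 0)) + (\<Sum>a\<in>Z. real (m a) * ln (r / cmod a)))) {0..2*pi}"
      and abs: "(\<lambda>\<theta>. ln (cmod (G (of_real r * cis \<theta>)))) absolutely_integrable_on {0..2*pi}"
      by (rule jensen[OF G r, folded Z_def]) (rule that; assumption)
    define N where "N = {\<theta>\<in>{0..2*pi}. of_real r * cis \<theta> \<in> Z}"
    have N: "finite N" unfolding N_def by (rule finite_circle_preimage[OF Z r])
    have eq: "ln (cmod (g (of_real r * cis \<theta>))) = real k * ln r + ln (cmod (G (of_real r * cis \<theta>)))"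
      if "\<theta> \<in> {0..2*pi} - N" for \<theta>
    proof -
      have "G (of_real r * cis \<theta>) \<noteq> 0" using that r by (auto simp: N_def Z_def norm_mult)
      thus ?thesis using r by (simp add: gG norm_mult norm_power ln_mult ln_realpow)
    qed
    have "((\<lambda>\<theta>. real k * ln r + ln (cmod (G (of_real r * cis \<theta>)))) has_integral
        2 * pi * (real k * ln r) + 2 * pi * (ln (cmod (G 0)) + (\<Sum>a\<in>Z. real (m a) * ln (r / cmod a)))) {0..2*pi}"
      using has_integral_add[OF has_integral_const_real[of "real k * ln r" 0 "2*pi"] J] by simp
    from has_integral_spike_finite[OF N eq this]
    have "integral {0..2*pi} (\<lambda>\<theta>. ln (cmod (g (of_real r * cis \<theta>)))) =
       2 * pi * (real k * ln r) + 2 * pi * (ln (cmod (G 0)) + (\<Sum>a\<in>Z. real (m a) * ln (r / cmod a)))"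
      by (rule integral_unique)
    moreover have "0 \<le> 2 * pi * (\<Sum>a\<in>Z. real (m a) * ln (r / cmod a))"
    proof -
      have "0 \<le> real (m a) * ln (r / cmod a)" if "a \<in> Z" for a
      proof -
        have "a \<noteq> 0" using that G(2) by (auto simp: Z_def)
        hence "1 \<le> r / cmod a" using that by (auto simp: Z_def field_simps)
        thus ?thesis by simp
      qed
      thus ?thesis by (simp add: sum_nonneg)
    qed
    moreover have "(\<lambda>\<theta>. real k * ln r + ln (cmod (G (of_real r * cis \<theta>)))) absolutely_integrable_on {0..2*pi}"
      by (intro set_integral_add absolutely_integrable_on_const abs) auto
    hence "(\<lambda>\<theta>. ln (cmod (g (of_real r * cis \<theta>)))) absolutely_integrable_on {0..2*pi}"
      by (rule absolutely_integrable_spike[OF _ negligible_finite[OF N] eq])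
    ultimately show ?thesis by (simp add: distrib_left)
  qed
  show ?thesis
  proof (rule that[of "- (2 * pi * ln (cmod (G 0)))"])
    fix r :: real assume "1 \<le> r"
    hence "0 \<le> 2 * pi * (real k * ln r)" "0 < r" by auto
    thus "- (- (2 * pi * ln (cmod (G 0)))) \<le> integral {0..2*pi} (\<lambda>\<theta>. ln (cmod (g (of_real r * cis \<theta>))))"
      using *[of r] by linarith
  qed (use * in auto)
qed

text \<open>The zeros are countably many, and each nonzero one lies on a single ray.\<close>

lemma ray_zeros_negligible:
  assumes g: "g holomorphic_on UNIV" "g w \<noteq> 0"
  shows "negligible {\<theta>\<in>{0..2*pi}. \<exists>r>0. g (of_real r * cis \<theta>) = 0}"
proof -
  have "countable (\<Union>k::nat. {z. cmod z \<le> real k \<and> g z = 0})"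
    by (rule countable_UN) (auto intro: countable_finite entire_zeros_finite[OF g])
  moreover have "{z. g z = 0} \<subseteq> (\<Union>k::nat. {z. cmod z \<le> real k \<and> g z = 0})"
    using real_arch_simple by auto
  ultimately have "countable {z. g z = 0}" by (rule countable_subset[rotated])
  hence "countable (\<Union>a\<in>{z. g z = 0}. {\<theta>\<in>{0..2*pi}. cis \<theta> \<in> {sgn a}})"
    by (rule countable_UN) (auto intro!: countable_finite finite_cis_preimage[of "{sgn _}", simplified])
  moreover have "{\<theta>\<in>{0..2*pi}. \<exists>r>0. g (of_real r * cis \<theta>) = 0} \<subseteq> (\<Union>a\<in>{z. g z = 0}. {\<theta>\<in>{0..2*pi}. cis \<theta> \<in> {sgn a}})"
  proof
    fix \<theta> assume "\<theta> \<in> {\<theta>\<in>{0..2*pi}. \<exists>r>0. g (of_real r * cis \<theta>) = 0}"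
    then obtain r where r: "\<theta> \<in> {0..2*pi}" "0 < r" "g (of_real r * cis \<theta>) = 0" by auto
    have "sgn (complex_of_real r * cis \<theta>) = cis \<theta>" using r by (simp add: sgn_eq norm_mult)
    thus "\<theta> \<in> (\<Union>a\<in>{z. g z = 0}. {\<theta>\<in>{0..2*pi}. cis \<theta> \<in> {sgn a}})"
      using r by (auto intro!: bexI[of _ "of_real r * cis \<theta>"])
  qed
  ultimately show ?thesis using countable_subset negligible_if_countable by blast
qed

section \<open>Asymptotics of the proximity integral\<close>

context poly_ode_irregular
begin

definition \<kappa> where "\<kappa> \<theta> = Re (csqrt (K * cis (real n * \<theta>)))"

lemma \<kappa>_nonneg: "0 \<le> \<kappa> \<theta>" unfolding \<kappa>_def by (rule Re_csqrt)

text \<open>\<open>csqrt\<close> jumps across the negative real axis, but its real part does not;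
  this formula exhibits the continuity.\<close>

lemma \<kappa>_eq: "\<kappa> \<theta> = sqrt ((cmod K + Re (K * cis (real n * \<theta>))) / 2)"
  by (simp only: \<kappa>_def csqrt.simps(1) norm_mult norm_cis mult_1_right)

lemma \<kappa>_continuous: "continuous_on S \<kappa>"
  unfolding \<kappa>_eq[abs_def] by (intro continuous_intros) auto

lemma \<kappa>_le: "\<kappa> \<theta> \<le> sqrt (cmod K)"
proof -
  have "Re (K * cis (real n * \<theta>)) \<le> cmod K" using complex_Re_le_cmod[of "K * cis (real n * \<theta>)"] by (simp add: norm_mult)
  thus ?thesis unfolding \<kappa>_eq by simp
qed

text \<open>\<open>\<kappa> \<theta> = 0\<close> forces K cis (n \<theta>) = -|K|, which confines
  cis \<theta> to the n-th roots of one number: these are the rays separating the sectors.\<close>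

lemma finite_\<kappa>_zero: "finite {\<theta>\<in>{0..2*pi}. \<kappa> \<theta> = 0}"
proof -
  have "cis \<theta> \<in> {z. z ^ n = - of_real (cmod K) / K}" if "\<kappa> \<theta> = 0" for \<theta>
  proof -
    define X where "X = K * cis (real n * \<theta>)"
    have X: "cmod X = cmod K" "Re X = - cmod K" using that by (auto simp: X_def \<kappa>_eq norm_mult)
    have "(cmod X)\<^sup>2 = (Re X)\<^sup>2 + (Im X)\<^sup>2" by (rule cmod_power2)
    hence "Im X = 0" using X by simp
    hence "X = - of_real (cmod K)" using X by (simp add: complex_eq_iff)
    hence "cis (real n * \<theta>) = - of_real (cmod K) / K" using K_nz by (simp add: X_def field_simps)
    thus ?thesis by (simp add: Complex.DeMoivre)
  qed
  hence "{\<theta>\<in>{0..2*pi}. \<kappa> \<theta> = 0} \<subseteq> {\<theta>\<in>{0..2*pi}. cis \<theta> \<in> {z. z ^ n = - of_real (cmod K) / K}}" by auto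
  moreover have "finite {z. z ^ n = - of_real (cmod K) / K}" using n_pos by (intro finite_nth_roots) auto
  ultimately show ?thesis using finite_cis_preimage finite_subset by blast
qed

lemma \<kappa>_integral_pos: "0 < integral {0..2*pi} \<kappa>"
proof -
  have "0 \<le> integral {0..2*pi} \<kappa>"
    by (intro integral_nonneg integrable_continuous_real \<kappa>_continuous \<kappa>_nonneg)
  moreover have "integral {0..2*pi} \<kappa> \<noteq> 0"
  proof
    assume "integral {0..2*pi} \<kappa> = 0"
    hence "\<forall>\<theta>\<in>{0..2*pi}. \<kappa> \<theta> = 0"
      using integral_eq_0_iff[OF \<kappa>_continuous, of 0 "2*pi"] \<kappa>_nonneg by simp
    hence "{0..2*pi} \<subseteq> {\<theta>\<in>{0..2*pi}. \<kappa> \<theta> = 0}" by blast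
    hence "finite {0..2*pi}" using finite_\<kappa>_zero finite_subset by blast
    thus False using infinite_Icc[of 0 "2*pi"] by simp
  qed
  ultimately show ?thesis by simp
qed

lemma ln_max_eq: "ln (max 1 x) = max 0 (ln x)" if "0 \<le> x" for x :: real
  using that by (cases "x = 0"; cases "1 \<le> x") (auto simp: max_def)

text \<open>For almost every angle, the limit of ln+ |g| / r^\<rho> on the ray.\<close>

definition growth_profile where "growth_profile g \<theta> = (if dominant_on g \<theta> then \<kappa> \<theta> else 0)"

text \<open>On a recessive ray only a lower bound for |ln |g|| is available, so the second quantity
  is truncated at \<open>\<kappa>\<close>. The truncation makes it converge on both kinds of rays
  and also supplies a majorant for dominated convergence.\<close>

lemma ray_limits:
  assumes g: "solution g" and \<theta>: "\<kappa> \<theta> \<noteq> 0" "\<And>r. 0 < r \<Longrightarrow> g (of_real r * cis \<theta>) \<noteq> 0"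
  shows "((\<lambda>r. ln (max 1 (cmod (g (of_real r * cis \<theta>)))) / r powr \<rho>) \<longlongrightarrow> growth_profile g \<theta>) at_top"
    and "((\<lambda>r. min (\<bar>ln (cmod (g (of_real r * cis \<theta>)))\<bar> / r powr \<rho>) (\<kappa> \<theta>)) \<longlongrightarrow> \<kappa> \<theta>) at_top"
proof -
  have pos: "0 < \<kappa> \<theta>" using \<theta>(1) \<kappa>_nonneg[of \<theta>] by linarith
  have "((\<lambda>r. ln (max 1 (cmod (g (of_real r * cis \<theta>)))) / r powr \<rho>) \<longlongrightarrow> growth_profile g \<theta>) at_top \<and>
    ((\<lambda>r. min (\<bar>ln (cmod (g (of_real r * cis \<theta>)))\<bar> / r powr \<rho>) (\<kappa> \<theta>)) \<longlongrightarrow> \<kappa> \<theta>) at_top"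
  proof (cases "dominant_on g \<theta>")
    case True
    hence lim: "((\<lambda>r. ln (cmod (g (of_real r * cis \<theta>))) / r powr \<rho>) \<longlongrightarrow> \<kappa> \<theta>) at_top"
      unfolding dominant_on_def \<kappa>_def .
    have "((\<lambda>r. max 0 (ln (cmod (g (of_real r * cis \<theta>))) / r powr \<rho>)) \<longlongrightarrow> max 0 (\<kappa> \<theta>)) at_top"
      by (intro tendsto_max tendsto_const lim)
    moreover have "max 0 (ln (cmod (g (of_real r * cis \<theta>))) / r powr \<rho>) = ln (max 1 (cmod (g (of_real r * cis \<theta>)))) / r powr \<rho>" for r
      by (simp add: ln_max_eq max_divide_distrib_right)
    moreover have "((\<lambda>r. min \<bar>ln (cmod (g (of_real r * cis \<theta>))) / r powr \<rho>\<bar> (\<kappa> \<theta>)) \<longlongrightarrow> min \<bar>\<kappa> \<theta>\<bar> (\<kappa> \<theta>)) at_top"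
      by (intro tendsto_min tendsto_const tendsto_rabs lim)
    ultimately show ?thesis using True pos by (simp add: growth_profile_def)
  next
    case False
    hence rec: "recessive_on g \<theta>" using ray_dichotomy[OF g] pos unfolding \<kappa>_def by blast
    have ev: "\<forall>\<^sub>F r in at_top. 0 < r \<and> cmod (g (of_real r * cis \<theta>)) \<le> exp (- (\<kappa> \<theta> - d) * r powr \<rho>)" if "0 < d" for d
      using rec that eventually_gt_at_top[of 0] unfolding recessive_on_def \<kappa>_def
      by (auto intro: eventually_conj)
    have "0 < \<kappa> \<theta> / 2" using pos by simp
    from ev[OF this] have "\<forall>\<^sub>F r in at_top. ln (max 1 (cmod (g (of_real r * cis \<theta>)))) / r powr \<rho> = 0"
    proof (rule eventually_mono)
      fix r assume "0 < r \<and> cmod (g (of_real r * cis \<theta>)) \<le> exp (- (\<kappa> \<theta> - \<kappa> \<theta> / 2) * r powr \<rho>)"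
      moreover have "exp (- (\<kappa> \<theta> - \<kappa> \<theta> / 2) * r powr \<rho>) \<le> 1" using pos by (simp add: mult_nonneg_nonneg)
      ultimately have "max 1 (cmod (g (of_real r * cis \<theta>))) = 1" by linarith
      thus "ln (max 1 (cmod (g (of_real r * cis \<theta>)))) / r powr \<rho> = 0" by simp
    qed
    hence 1: "((\<lambda>r. ln (max 1 (cmod (g (of_real r * cis \<theta>)))) / r powr \<rho>) \<longlongrightarrow> 0) at_top"
      by (rule tendsto_eventually)
    have 2: "((\<lambda>r. min (\<bar>ln (cmod (g (of_real r * cis \<theta>)))\<bar> / r powr \<rho>) (\<kappa> \<theta>)) \<longlongrightarrow> \<kappa> \<theta>) at_top"
    proof (rule tendstoI)
      fix d :: real assume d: "0 < d"
      hence "0 < d / 2" by simp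
      from ev[OF this]
      have "\<forall>\<^sub>F r in at_top. \<kappa> \<theta> - d / 2 \<le> \<bar>ln (cmod (g (of_real r * cis \<theta>)))\<bar> / r powr \<rho>"
      proof (rule eventually_mono)
        fix r assume r: "0 < r \<and> cmod (g (of_real r * cis \<theta>)) \<le> exp (- (\<kappa> \<theta> - d / 2) * r powr \<rho>)"
        hence "ln (cmod (g (of_real r * cis \<theta>))) \<le> - (\<kappa> \<theta> - d / 2) * r powr \<rho>"
          using \<theta>(2)[of r] by (metis ln_exp ln_mono zero_less_norm_iff)
        hence "(\<kappa> \<theta> - d / 2) * r powr \<rho> \<le> \<bar>ln (cmod (g (of_real r * cis \<theta>)))\<bar>" by linarith
        thus "\<kappa> \<theta> - d / 2 \<le> \<bar>ln (cmod (g (of_real r * cis \<theta>)))\<bar> / r powr \<rho>"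
          using r by (simp add: pos_le_divide_eq)
      qed
      thus "\<forall>\<^sub>F r in at_top. dist (min (\<bar>ln (cmod (g (of_real r * cis \<theta>)))\<bar> / r powr \<rho>) (\<kappa> \<theta>)) (\<kappa> \<theta>) < d"
        by eventually_elim (use d in \<open>auto simp: dist_real_def min_def\<close>)
    qed
    show ?thesis using 1 2 False by (simp add: growth_profile_def)
  qed
  thus "((\<lambda>r. ln (max 1 (cmod (g (of_real r * cis \<theta>)))) / r powr \<rho>) \<longlongrightarrow> growth_profile g \<theta>) at_top"
    and "((\<lambda>r. min (\<bar>ln (cmod (g (of_real r * cis \<theta>)))\<bar> / r powr \<rho>) (\<kappa> \<theta>)) \<longlongrightarrow> \<kappa> \<theta>) at_top" by auto
qed

lemma solution_entire: "solution g \<Longrightarrow> g holomorphic_on UNIV"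
  by (simp add: solution_def)

text \<open>Let \<open>F\<close> be the normalised integral of ln+ and \<open>E\<close> that of the
  truncated |ln|. The inequality E \<le> 2 F + o(1) becomes in the limit: the integral of
  \<open>\<kappa>\<close> is at most 2 \<tau>. Hence \<tau> > 0, whereas without any dominant
  central ray the profile would vanish almost everywhere.\<close>

theorem proximity_asymp:
  assumes g: "solution g"
  obtains \<tau> where "0 < \<tau>" "((\<lambda>r. proximity_integral g r / r powr \<rho>) \<longlongrightarrow> \<tau>) at_top"
    "\<exists>\<beta>. \<beta> ^ n * K = 1 \<and> dominant_on g (Arg \<beta>)"
proof -
  obtain w0 where w0: "g w0 \<noteq> 0" using g unfolding solution_def by blast
  note hol = solution_entire[OF g]
  define N where "N = {\<theta>\<in>{0..2*pi}. \<kappa> \<theta> = 0} \<union> {\<theta>\<in>{0..2*pi}. \<exists>r>0. g (of_real r * cis \<theta>) = 0}"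
  define S where "S = {0..2*pi} - N"
  have negN: "negligible N" unfolding N_def
    by (intro negligible_Un negligible_finite finite_\<kappa>_zero ray_zeros_negligible[OF hol w0])
  have S_eq: "integral S f = integral {0..2*pi} f" for f :: "real \<Rightarrow> real"
    unfolding S_def by (intro integral_spike_set negligible_subset[OF negN]) auto
  have S_int: "f integrable_on S \<longleftrightarrow> f integrable_on {0..2*pi}" for f :: "real \<Rightarrow> real"
    unfolding S_def by (intro integrable_spike_set_eq negligible_subset[OF negN]) auto
  have lims: "((\<lambda>r. ln (max 1 (cmod (g (of_real r * cis \<theta>)))) / r powr \<rho>) \<longlongrightarrow> growth_profile g \<theta>) at_top"
     "((\<lambda>r. min (\<bar>ln (cmod (g (of_real r * cis \<theta>)))\<bar> / r powr \<rho>) (\<kappa> \<theta>)) \<longlongrightarrow> \<kappa> \<theta>) at_top" if "\<theta> \<in> S" for \<theta>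
    using that ray_limits[OF g, of \<theta>] unfolding S_def N_def by auto
  obtain C r0 where C: "0 < C" "1 \<le> r0"
    "\<And>z. r0 \<le> cmod z \<Longrightarrow> cmod (g z) \<le> C * exp ((1 + 1) * sqrt (cmod K) * cmod z powr \<rho>)"
    using growth_bound[OF g zero_less_one] by metis
  define H where "H = \<bar>ln C\<bar> + 2 * sqrt (cmod K)"
  have H: "ln (max 1 (cmod (g (of_real r * cis \<theta>)))) / r powr \<rho> \<le> H" if "r0 \<le> r" for r \<theta>
  proof -
    have r: "1 \<le> r" "0 < r" using that C by auto
    have r\<rho>: "1 \<le> r powr \<rho>" using r \<rho>_pos by (simp add: ge_one_powr_ge_zero)
    have "cmod (g (of_real r * cis \<theta>)) \<le> C * exp (2 * sqrt (cmod K) * r powr \<rho>)"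
      using C(3)[of "of_real r * cis \<theta>"] that r by (simp add: norm_mult)
    moreover have "C * exp (2 * sqrt (cmod K) * r powr \<rho>) \<le> exp (\<bar>ln C\<bar> + 2 * sqrt (cmod K) * r powr \<rho>)"
    proof -
      have "C \<le> exp \<bar>ln C\<bar>" using C(1) by (metis abs_ge_self exp_le_cancel_iff exp_ln)
      thus ?thesis by (simp add: exp_add)
    qed
    moreover have "1 \<le> exp (\<bar>ln C\<bar> + 2 * sqrt (cmod K) * r powr \<rho>)" by simp
    ultimately have "max 1 (cmod (g (of_real r * cis \<theta>))) \<le> exp (\<bar>ln C\<bar> + 2 * sqrt (cmod K) * r powr \<rho>)" by linarith
    hence "ln (max 1 (cmod (g (of_real r * cis \<theta>)))) \<le> \<bar>ln C\<bar> + 2 * sqrt (cmod K) * r powr \<rho>"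
      by (metis ln_exp ln_mono less_max_iff_disj zero_less_one)
    also have "\<dots> \<le> H * r powr \<rho>" using mult_left_mono[OF r\<rho>, of "\<bar>ln C\<bar>"] by (simp add: H_def algebra_simps)
    finally show ?thesis using r by (subst pos_divide_le_eq) auto
  qed
  obtain CJ where CJ: "\<And>r. 0 < r \<Longrightarrow> (\<lambda>\<theta>. ln (cmod (g (of_real r * cis \<theta>)))) absolutely_integrable_on {0..2*pi}"
    "\<And>r. 1 \<le> r \<Longrightarrow> - CJ \<le> integral {0..2*pi} (\<lambda>\<theta>. ln (cmod (g (of_real r * cis \<theta>))))"
    using entire_jensen_lower[OF hol w0] by metis
  define F where "F r = integral S (\<lambda>\<theta>. ln (max 1 (cmod (g (of_real r * cis \<theta>)))) / r powr \<rho>)" for r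
  define E where "E r = integral S (\<lambda>\<theta>. min (\<bar>ln (cmod (g (of_real r * cis \<theta>)))\<bar> / r powr \<rho>) (\<kappa> \<theta>))" for r
  have F_eq: "F r = proximity_integral g r / r powr \<rho>" for r
    unfolding F_def S_eq proximity_integral_def by (simp only: integral_divide)
  have Fint: "(\<lambda>\<theta>. ln (max 1 (cmod (g (of_real r * cis \<theta>)))) / r powr \<rho>) integrable_on S" for r
    unfolding S_int by (intro integrable_on_divide ln_max_one_integrable hol)
  have Eint: "(\<lambda>\<theta>. min (\<bar>ln (cmod (g (of_real r * cis \<theta>)))\<bar> / r powr \<rho>) (\<kappa> \<theta>)) integrable_on S" if "0 < r" for r
  proof -
    have "(\<lambda>\<theta>. \<bar>ln (cmod (g (of_real r * cis \<theta>)))\<bar> / r powr \<rho>) absolutely_integrable_on {0..2*pi}"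
      using CJ(1)[OF that] by (intro set_integrable_divide set_integrable_abs) auto
    hence "(\<lambda>\<theta>. min (\<bar>ln (cmod (g (of_real r * cis \<theta>)))\<bar> / r powr \<rho>) (\<kappa> \<theta>)) absolutely_integrable_on {0..2*pi}"
      by (rule absolutely_integrable_min_1[OF _ absolutely_integrable_continuous_real[OF \<kappa>_continuous]])
    thus ?thesis unfolding S_int by (rule set_lebesgue_integral_eq_integral(1))
  qed
  \<comment> \<open>The growth bound holds from \<open>r0\<close> on; replacing r by
    \<open>max r0 r\<close> makes it valid along a whole sequence and keeps the limit.\<close>
  have tail: "((\<lambda>r. \<Phi> r) \<longlongrightarrow> L) at_top" if "((\<lambda>r. \<Phi> (max r0 r)) \<longlongrightarrow> L) at_top" for \<Phi> :: "real \<Rightarrow> real" and L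
    using that by (rule Lim_transform_eventually)
      (use eventually_ge_at_top[of r0] in \<open>eventually_elim, simp add: max_absorb2\<close>)
  have max_lim: "filterlim (\<lambda>i. max r0 (X i)) at_top sequentially" if "filterlim X at_top sequentially" for X :: "nat \<Rightarrow> real"
    using that unfolding filterlim_at_top by (auto elim!: eventually_mono simp: le_max_iff_disj)
  have F_seq: "growth_profile g integrable_on S \<and> (\<lambda>i. F (max r0 (X i))) \<longlonglongrightarrow> integral S (growth_profile g)"
    if X: "filterlim X at_top sequentially" for X :: "nat \<Rightarrow> real"
  proof -
    have const: "(\<lambda>_. H) integrable_on S" unfolding S_int by (rule integrable_const_ivl)
    have bound: "norm (ln (max 1 (cmod (g (of_real (max r0 (X k)) * cis \<theta>)))) / max r0 (X k) powr \<rho>) \<le> H" for k \<theta>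
      using H[of "max r0 (X k)" \<theta>] by (simp add: abs_of_nonneg)
    have conv: "(\<lambda>k. ln (max 1 (cmod (g (of_real (max r0 (X k)) * cis \<theta>)))) / max r0 (X k) powr \<rho>) \<longlonglongrightarrow> growth_profile g \<theta>"
      if "\<theta> \<in> S" for \<theta>
      by (rule filterlim_compose[OF lims(1)[OF that] max_lim[OF X]])
    show ?thesis unfolding F_def
      using dominated_convergence[OF Fint const bound conv] by blast
  qed
  have F_lim: "(F \<longlongrightarrow> integral S (growth_profile g)) at_top"
    by (rule tail, rule tendsto_at_topI_sequentially) (use F_seq in blast)
  have E_lim: "(E \<longlongrightarrow> integral S \<kappa>) at_top"
  proof (rule tail, rule tendsto_at_topI_sequentially)
    fix X :: "nat \<Rightarrow> real" assume X: "filterlim X at_top sequentially"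
    show "(\<lambda>i. E (max r0 (X i))) \<longlonglongrightarrow> integral S \<kappa>"
      unfolding E_def
    proof (rule dominated_convergence(2)[where h = "\<lambda>_. sqrt (cmod K)"])
      show "(\<lambda>_. sqrt (cmod K)) integrable_on S" unfolding S_int by (rule integrable_const_ivl)
      fix k :: nat and \<theta>
      show "norm (min (\<bar>ln (cmod (g (of_real (max r0 (X k)) * cis \<theta>)))\<bar> / max r0 (X k) powr \<rho>) (\<kappa> \<theta>)) \<le> sqrt (cmod K)"
        using \<kappa>_nonneg[of \<theta>] \<kappa>_le[of \<theta>] by (auto simp: min_def)
    qed (use C in \<open>auto intro!: Eint filterlim_compose[OF lims(2) max_lim[OF X]]\<close>)
  qed
  define \<tau> where "\<tau> = integral S (growth_profile g)"
  have EF: "\<forall>\<^sub>F r in at_top. E r \<le> 2 * F r + CJ / r powr \<rho>"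
    using eventually_ge_at_top[of 1]
  proof eventually_elim
    case (elim r)
    have r: "0 < r" "0 < r powr \<rho>" using elim by auto
    have ai: "(\<lambda>\<theta>. \<bar>ln (cmod (g (of_real r * cis \<theta>)))\<bar>) integrable_on {0..2*pi}"
      using CJ(1)[OF r(1)] absolutely_integrable_on_def by (metis (mono_tags, lifting) integrable_cong real_norm_def)
    have "E r \<le> integral S (\<lambda>\<theta>. \<bar>ln (cmod (g (of_real r * cis \<theta>)))\<bar> / r powr \<rho>)"
      unfolding E_def
    proof (rule integral_le[OF Eint[OF r(1)]])
      show "(\<lambda>\<theta>. \<bar>ln (cmod (g (of_real r * cis \<theta>)))\<bar> / r powr \<rho>) integrable_on S"
        unfolding S_int by (intro integrable_on_divide ai)
    qed auto
    also have "\<dots> = integral {0..2*pi} (\<lambda>\<theta>. \<bar>ln (cmod (g (of_real r * cis \<theta>)))\<bar>) / r powr \<rho>"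
      unfolding S_eq by (simp only: integral_divide)
    also have "integral {0..2*pi} (\<lambda>\<theta>. \<bar>ln (cmod (g (of_real r * cis \<theta>)))\<bar>)
       = integral {0..2*pi} (\<lambda>\<theta>. 2 * ln (max 1 (cmod (g (of_real r * cis \<theta>)))) - ln (cmod (g (of_real r * cis \<theta>))))"
      by (simp add: abs_ln_eq)
    also have "\<dots> = 2 * proximity_integral g r - integral {0..2*pi} (\<lambda>\<theta>. ln (cmod (g (of_real r * cis \<theta>))))"
      unfolding proximity_integral_def
      using ln_max_one_integrable[OF hol, of r] set_lebesgue_integral_eq_integral(1)[OF CJ(1)[OF r(1)]]
      by (subst integral_diff) auto
    also have "\<dots> / r powr \<rho> \<le> (2 * proximity_integral g r + CJ) / r powr \<rho>"
      using CJ(2)[OF elim] r by (intro divide_right_mono) auto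
    finally show ?case unfolding F_eq by (simp add: add_divide_distrib)
  qed
  have "((\<lambda>r. 2 * F r + CJ / r powr \<rho>) \<longlongrightarrow> 2 * \<tau> + 0) at_top"
    unfolding \<tau>_def
    by (intro tendsto_intros F_lim tendsto_divide_0[OF tendsto_const] filterlim_at_top_imp_at_infinity)
       (use filterlim_scaled_powr[of 1] in simp)
  from tendsto_le[OF _ this E_lim EF] have "integral S \<kappa> \<le> 2 * \<tau>" by simp
  hence \<tau>_pos: "0 < \<tau>" using \<kappa>_integral_pos unfolding S_eq by simp
  show ?thesis
  proof (rule that[OF \<tau>_pos])
    show "((\<lambda>r. proximity_integral g r / r powr \<rho>) \<longlongrightarrow> \<tau>) at_top"
      using F_lim unfolding F_eq \<tau>_def .
    show "\<exists>\<beta>. \<beta> ^ n * K = 1 \<and> dominant_on g (Arg \<beta>)"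
    proof (rule ccontr)
      assume no: "\<nexists>\<beta>. \<beta> ^ n * K = 1 \<and> dominant_on g (Arg \<beta>)"
      have "growth_profile g \<theta> = 0" if "\<theta> \<in> S" for \<theta>
      proof -
        have "0 < \<kappa> \<theta>" using that \<kappa>_nonneg[of \<theta>] by (auto simp: S_def N_def)
        hence "recessive_on g \<theta>" using ray_dichotomy[OF g, of \<theta>] no unfolding \<kappa>_def by blast
        have "\<not> dominant_on g \<theta>"
        proof
          assume dom: "dominant_on g \<theta>"
          have "\<forall>\<^sub>F r in at_top. cmod (g (of_real r * cis \<theta>)) \<le> exp (- (\<kappa> \<theta> - \<kappa> \<theta> / 2) * r powr \<rho>)"
            using \<open>recessive_on g \<theta>\<close> \<open>0 < \<kappa> \<theta>\<close> half_gt_zero unfolding recessive_on_def \<kappa>_def by blast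
          hence "\<forall>\<^sub>F r in at_top. ln (cmod (g (of_real r * cis \<theta>))) / r powr \<rho> \<le> 0"
          proof (rule eventually_mono)
            fix r assume "cmod (g (of_real r * cis \<theta>)) \<le> exp (- (\<kappa> \<theta> - \<kappa> \<theta> / 2) * r powr \<rho>)"
            moreover have "exp (- (\<kappa> \<theta> - \<kappa> \<theta> / 2) * r powr \<rho>) \<le> 1" using \<open>0 < \<kappa> \<theta>\<close> by (simp add: mult_nonneg_nonneg)
            ultimately have "cmod (g (of_real r * cis \<theta>)) \<le> 1" by linarith
            hence "ln (cmod (g (of_real r * cis \<theta>))) \<le> 0" by (cases "g (of_real r * cis \<theta>) = 0") auto
            thus "ln (cmod (g (of_real r * cis \<theta>))) / r powr \<rho> \<le> 0" by (simp add: divide_nonpos_nonneg)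
          qed
          from tendsto_upperbound[OF dom[unfolded dominant_on_def, folded \<kappa>_def] this]
          show False using \<open>0 < \<kappa> \<theta>\<close> by simp
        qed
        thus ?thesis by (simp add: growth_profile_def)
      qed
      hence "\<tau> = integral S (\<lambda>_. 0)" unfolding \<tau>_def by (intro integral_cong) auto
      thus False using \<tau>_pos by simp
    qed
  qed
qed

end

section \<open>The characteristic of \<open>P / g\<^sup>2\<close>\<close>

lemma entire_simple_zero_factor:
  assumes g: "g holomorphic_on UNIV" "g a = 0" "deriv g a \<noteq> 0"
  obtains G where "G holomorphic_on UNIV" "G a \<noteq> 0" "\<And>z. g z = (z - a) * G z"
proof -
  have "\<exists>w. g w \<noteq> 0"
  proof (rule ccontr)
    assume "\<nexists>w. g w \<noteq> 0"
    hence "g = (\<lambda>_. 0)" by auto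
    thus False using g(3) by simp
  qed
  then obtain w where "g w \<noteq> 0" by blast
  then obtain k G where G: "G holomorphic_on UNIV" "G a \<noteq> 0" "\<And>z. g z = (z - a) ^ k * G z"
    using entire_factor_at[OF g(1)] by metis
  have dG: "(G has_field_derivative deriv G a) (at a)" by (rule holomorphic_derivI[OF G(1)]) auto
  have "k \<noteq> 0" using g(2) G(2) G(3)[of a] by auto
  moreover have "k < 2"
  proof (rule ccontr)
    assume "\<not> k < 2"
    then obtain j where j: "k = Suc (Suc j)" by (metis add_2_eq_Suc le_Suc_ex not_less)
    have "g = (\<lambda>z. (z - a) ^ k * G z)" using G(3) by auto
    moreover have "((\<lambda>z. (z - a) ^ k * G z) has_field_derivative 0) (at a)"
      by (rule DERIV_cong[OF DERIV_mult[OF DERIV_power[OF DERIV_diff[OF DERIV_ident DERIV_const]] dG]]) (simp add: j)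
    ultimately show False using g(3) DERIV_imp_deriv by blast
  qed
  ultimately have "k = 1" by simp
  thus ?thesis using G that by simp
qed

text \<open>The origin is kept apart just as in \<open>nevanlinna_N\<close>, so that up to a
  constant the integral becomes the counting function of P / g^2.\<close>

lemma jensen_simple_zeros:
  assumes g: "g holomorphic_on UNIV" "g w \<noteq> 0" and simple: "\<And>a. g a = 0 \<Longrightarrow> deriv g a \<noteq> 0"
  obtains c where
    "\<And>r. 0 < r \<Longrightarrow> (\<lambda>\<theta>. ln (cmod (g (of_real r * cis \<theta>)))) absolutely_integrable_on {0..2*pi}"
    "\<And>r. 0 < r \<Longrightarrow> integral {0..2*pi} (\<lambda>\<theta>. ln (cmod (g (of_real r * cis \<theta>)))) =
       2 * pi * (c + (if g 0 = 0 then ln r else 0) + (\<Sum>a | a \<noteq> 0 \<and> cmod a \<le> r \<and> g a = 0. ln (r / cmod a)))"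
proof -
  define k where "k = (if g 0 = 0 then 1 else 0 :: nat)"
  obtain G where G: "G holomorphic_on UNIV" "G 0 \<noteq> 0" and gG: "\<And>z. g z = z ^ k * G z"
  proof (cases "g 0 = 0")
    case True
    obtain G where "G holomorphic_on UNIV" "G 0 \<noteq> 0" "\<And>z. g z = (z - 0) * G z"
      using entire_simple_zero_factor[OF g(1) True simple[OF True]] by metis
    thus ?thesis using that True by (simp add: k_def)
  qed (use that g in \<open>simp add: k_def\<close>)
  have G_simple: "deriv G a \<noteq> 0" if "G a = 0" for a
  proof
    assume d0: "deriv G a = 0"
    have dG: "(G has_field_derivative deriv G a) (at a)" by (rule holomorphic_derivI[OF G(1)]) auto
    have "g = (\<lambda>z. z ^ k * G z)" using gG by auto
    moreover have "((\<lambda>z. z ^ k * G z) has_field_derivative 0) (at a)"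
      by (rule DERIV_cong[OF DERIV_mult[OF DERIV_power[OF DERIV_ident] dG]]) (simp add: that d0)
    ultimately have "deriv g a = 0" using DERIV_imp_deriv by blast
    thus False using simple[of a] gG[of a] that by simp
  qed
  have *: "(\<lambda>\<theta>. ln (cmod (g (of_real r * cis \<theta>)))) absolutely_integrable_on {0..2*pi} \<and>
      integral {0..2*pi} (\<lambda>\<theta>. ln (cmod (g (of_real r * cis \<theta>)))) =
       2 * pi * (ln (cmod (G 0)) + (if g 0 = 0 then ln r else 0) + (\<Sum>a | a \<noteq> 0 \<and> cmod a \<le> r \<and> g a = 0. ln (r / cmod a)))"
    if r: "0 < r" for r
  proof -
    define Z where "Z = {a. cmod a \<le> r \<and> G a = 0}"
    have Z: "finite Z" unfolding Z_def by (rule entire_zeros_finite[OF G])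
    have Z_eq: "{a. a \<noteq> 0 \<and> cmod a \<le> r \<and> g a = 0} = Z"
      using G(2) by (auto simp: Z_def gG)
    obtain m where m: "\<And>a. G a = 0 \<Longrightarrow> cmod a \<le> r \<Longrightarrow> deriv G a \<noteq> 0 \<Longrightarrow> m a = (1::nat)"
      and J: "((\<lambda>\<theta>. ln (cmod (G (of_real r * cis \<theta>)))) has_integral
        2 * pi * (ln (cmod (G 0)) + (\<Sum>a\<in>Z. real (m a) * ln (r / cmod a)))) {0..2*pi}"
      and abs: "(\<lambda>\<theta>. ln (cmod (G (of_real r * cis \<theta>)))) absolutely_integrable_on {0..2*pi}"
      by (rule jensen[OF G r, folded Z_def]) (rule that; assumption)
    have sum_eq: "(\<Sum>a\<in>Z. real (m a) * ln (r / cmod a)) = (\<Sum>a\<in>Z. ln (r / cmod a))"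
      by (intro sum.cong refl) (use m G_simple in \<open>auto simp: Z_def\<close>)
    define N where "N = {\<theta>\<in>{0..2*pi}. of_real r * cis \<theta> \<in> Z}"
    have N: "finite N" unfolding N_def by (rule finite_circle_preimage[OF Z r])
    have eq: "ln (cmod (g (of_real r * cis \<theta>))) = real k * ln r + ln (cmod (G (of_real r * cis \<theta>)))"
      if "\<theta> \<in> {0..2*pi} - N" for \<theta>
    proof -
      have "G (of_real r * cis \<theta>) \<noteq> 0" using that r by (auto simp: N_def Z_def norm_mult)
      thus ?thesis using r by (simp add: gG norm_mult norm_power ln_mult ln_realpow)
    qed
    have "((\<lambda>\<theta>. real k * ln r + ln (cmod (G (of_real r * cis \<theta>)))) has_integral
        2 * pi * (real k * ln r) + 2 * pi * (ln (cmod (G 0)) + (\<Sum>a\<in>Z. ln (r / cmod a)))) {0..2*pi}"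
      using has_integral_add[OF has_integral_const_real[of "real k * ln r" 0 "2*pi"] J] by (simp add: sum_eq)
    from has_integral_spike_finite[OF N eq this]
    have "integral {0..2*pi} (\<lambda>\<theta>. ln (cmod (g (of_real r * cis \<theta>)))) =
       2 * pi * (real k * ln r) + 2 * pi * (ln (cmod (G 0)) + (\<Sum>a\<in>Z. ln (r / cmod a)))"
      by (rule integral_unique)
    moreover have "(\<lambda>\<theta>. real k * ln r + ln (cmod (G (of_real r * cis \<theta>)))) absolutely_integrable_on {0..2*pi}"
      by (intro set_integral_add absolutely_integrable_on_const abs) auto
    hence "(\<lambda>\<theta>. ln (cmod (g (of_real r * cis \<theta>)))) absolutely_integrable_on {0..2*pi}"
      by (rule absolutely_integrable_spike[OF _ negligible_finite[OF N] eq])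
    ultimately show ?thesis unfolding Z_eq by (simp add: distrib_left k_def)
  qed
  show ?thesis using * by (intro that[of "ln (cmod (G 0))"]) auto
qed

section \<open>Poles and proximity of the quotient\<close>

locale square_rep =
  fixes f g :: "complex \<Rightarrow> complex" and P :: "complex poly" and Q :: "complex \<Rightarrow> complex"
  assumes rep: "square_representation f g P Q"
begin

lemma
  g_hol: "g holomorphic_on UNIV" and Q_hol: "Q holomorphic_on UNIV" and P_nz: "P \<noteq> 0" and
  pole_iff: "is_pole f z \<longleftrightarrow> g z = 0" and simple: "g z = 0 \<Longrightarrow> deriv g z \<noteq> 0" and
  f_eq: "g z \<noteq> 0 \<Longrightarrow> f z = poly P z / (g z)\<^sup>2" and
  ode: "poly P z * deriv (deriv g) z - poly (pderiv P) z * deriv g z + Q z * g z = 0"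
  using rep unfolding square_representation_def by auto

lemma g_nonzero: "\<exists>w. g w \<noteq> 0"
proof (rule ccontr)
  assume "\<nexists>w. g w \<noteq> 0"
  hence "g = (\<lambda>_. 0)" by auto
  thus False using simple[of 0] by simp
qed

lemma g_ev_nonzero: "\<forall>\<^sub>F z in at a. g z \<noteq> 0"
proof -
  obtain w where w: "g w \<noteq> 0" using g_nonzero by blast
  show ?thesis
    using non_zero_neighbour_alt[OF g_hol open_UNIV connected_UNIV UNIV_I UNIV_I w, of a] by simp
qed

text \<open>At a common zero of \<open>P\<close> and \<open>g\<close> the equation would give P' g'
  = 0, so \<open>P\<close> would have at least a double zero there, cancelling the double zero of
  g^2 and leaving \<open>f\<close> bounded near a pole.\<close>

lemma P_nonzero_at_pole:
  assumes a: "g a = 0"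
  shows "poly P a \<noteq> 0"
proof
  assume P0: "poly P a = 0"
  hence "poly (pderiv P) a = 0" using ode[of a] simple[OF a] a by simp
  from P0 obtain P1 where P1: "P = [:- a, 1:] * P1" using poly_eq_0_iff_dvd by (metis dvdE)
  have "poly P1 a = 0" using \<open>poly (pderiv P) a = 0\<close> unfolding P1
    by (simp only: pderiv_mult poly_add poly_mult) (simp add: pderiv_pCons)
  then obtain P2 where P2: "P1 = [:- a, 1:] * P2" using poly_eq_0_iff_dvd by (metis dvdE)
  obtain G where G: "G holomorphic_on UNIV" "G a \<noteq> 0" "\<And>z. g z = (z - a) * G z"
    using entire_simple_zero_factor[OF g_hol a simple[OF a]] by metis
  have Gc: "G \<midarrow>a\<rightarrow> G a"
    using G(1) by (metis UNIV_I holomorphic_on_imp_continuous_on continuous_on_eq_continuous_at isCont_def open_UNIV)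
  have "(\<lambda>z. poly P2 z / (G z)\<^sup>2) \<midarrow>a\<rightarrow> poly P2 a / (G a)\<^sup>2"
    by (intro tendsto_intros Gc) (use G(2) in auto)
  moreover have "\<forall>\<^sub>F z in at a. poly P2 z / (G z)\<^sup>2 = f z"
    using g_ev_nonzero[of a] eventually_neq_at_within[of a a]
  proof eventually_elim
    case (elim z)
    have "poly P z = (z - a)\<^sup>2 * poly P2 z" unfolding P1 P2 by (simp add: power2_eq_square algebra_simps)
    thus ?case using elim G(3)[of z] f_eq[OF elim(1)] by (simp add: power_mult_distrib)
  qed
  ultimately have "f \<midarrow>a\<rightarrow> poly P2 a / (G a)\<^sup>2" by (rule Lim_transform_eventually)
  moreover have "filterlim f at_infinity (at a)" using pole_iff a unfolding is_pole_def by simp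
  ultimately show False using not_tendsto_and_filterlim_at_infinity[of "at a"] by auto
qed

lemma zorder_pole:
  assumes a: "g a = 0"
  shows "zorder f a = -2"
proof -
  obtain G where G: "G holomorphic_on UNIV" "G a \<noteq> 0" "\<And>z. g z = (z - a) * G z"
    using entire_simple_zero_factor[OF g_hol a simple[OF a]] by metis
  obtain d where d: "0 < d" "\<And>z. z \<noteq> a \<Longrightarrow> dist z a < d \<Longrightarrow> g z \<noteq> 0"
    using g_ev_nonzero[of a] unfolding eventually_at by blast
  have Gnz: "G z \<noteq> 0" if "z \<in> ball a d" for z
    using d(2)[of z] that G(2) G(3)[of z] by (auto simp: dist_commute)
  show ?thesis
  proof (rule zorder_eqI[of "ball a d" a "\<lambda>z. poly P z / (G z)\<^sup>2"])
    show "(\<lambda>z. poly P z / (G z)\<^sup>2) holomorphic_on ball a d"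
      by (intro holomorphic_intros holomorphic_on_subset[OF G(1)]) (use Gnz in auto)
    show "poly P a / (G a)\<^sup>2 \<noteq> 0" using P_nonzero_at_pole[OF a] G(2) by simp
    fix w assume w: "w \<in> ball a d" "w \<noteq> a"
    hence "g w \<noteq> 0" using d(2)[of w] by (simp add: dist_commute)
    thus "f w = poly P w / (G w)\<^sup>2 * (w - a) powi (-2)"
      unfolding f_eq[OF \<open>g w \<noteq> 0\<close>] G(3)[of w]
      by (simp add: power_int_minus power_mult_distrib divide_inverse)
  qed (use d in auto)
qed

lemma pole_count_eq: "pole_count f s = 2 * card {z. cmod z \<le> s \<and> g z = 0}"
proof -
  have "pole_count f s = (\<Sum>z | cmod z \<le> s \<and> g z = 0. 2)"
    unfolding pole_count_def pole_iff by (intro sum.cong) (auto simp: zorder_pole)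
  thus ?thesis by simp
qed

text \<open>A zero a \<noteq> 0 of \<open>g\<close> is counted with weight 2 from s = |a| on, and
  the integral of 1 / s from |a| to \<open>r\<close> is ln (r / |a|).\<close>

lemma nevanlinna_N_eq:
  assumes r: "0 < r"
  shows "nevanlinna_N f r = 2 * (if g 0 = 0 then ln r else 0)
      + 2 * (\<Sum>a | a \<noteq> 0 \<and> cmod a \<le> r \<and> g a = 0. ln (r / cmod a))"
proof -
  define Z where "Z = {a. a \<noteq> 0 \<and> cmod a \<le> r \<and> g a = 0}"
  obtain w where w: "g w \<noteq> 0" using g_nonzero by blast
  have fin: "finite {a. cmod a \<le> s \<and> g a = 0}" for s by (rule entire_zeros_finite[OF g_hol w])
  have Z: "finite Z" by (rule finite_subset[OF _ fin[of r]]) (auto simp: Z_def)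
  have 0: "{z. cmod z \<le> 0 \<and> g z = 0} = (if g 0 = 0 then {0} else {})" by auto
  have pc0: "real (pole_count f 0) = 2 * (if g 0 = 0 then 1 else 0)" unfolding pole_count_eq 0 by simp
  have int_a: "((\<lambda>s. if s \<in> {cmod a..r} then 1 / s else 0) has_integral ln (r / cmod a)) {0..r}" if "a \<in> Z" for a
  proof -
    have a: "0 < cmod a" "cmod a \<le> r" using that by (auto simp: Z_def)
    have "((\<lambda>s. 1 / s) has_integral (ln r - ln (cmod a))) {cmod a..r}"
    proof (rule fundamental_theorem_of_calculus[OF a(2)])
      fix x assume "x \<in> {cmod a..r}"
      hence "0 < x" using less_le_trans[OF a(1)] by simp
      thus "(ln has_vector_derivative 1 / x) (at x within {cmod a..r})"
        by (auto intro!: derivative_eq_intros simp flip: has_real_derivative_iff_has_vector_derivative)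
    qed
    moreover have "ln (r / cmod a) = ln r - ln (cmod a)" using a r by (simp add: ln_div)
    ultimately show ?thesis using a by (subst has_integral_restrict) auto
  qed
  have pc: "(real (pole_count f s) - real (pole_count f 0)) / s = (\<Sum>a\<in>Z. 2 * (if s \<in> {cmod a..r} then 1 / s else 0))"
    if s: "s \<in> {0..r}" for s
  proof -
    have "{z. cmod z \<le> s \<and> g z = 0} = {z. cmod z \<le> 0 \<and> g z = 0} \<union> {a\<in>Z. cmod a \<le> s}"
      using s by (auto simp: Z_def)
    moreover have "card ({z. cmod z \<le> 0 \<and> g z = 0} \<union> {a\<in>Z. cmod a \<le> s}) =
        card {z. cmod z \<le> 0 \<and> g z = 0} + card {a\<in>Z. cmod a \<le> s}"
      by (intro card_Un_disjoint fin finite_subset[OF _ Z]) (auto simp: Z_def)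
    ultimately have "real (pole_count f s) - real (pole_count f 0) = 2 * real (card {a\<in>Z. cmod a \<le> s})"
      unfolding pole_count_eq by simp
    also have "real (card {a\<in>Z. cmod a \<le> s}) = (\<Sum>a\<in>Z. if cmod a \<le> s then 1 else 0)"
      using Z by (simp add: sum.If_cases Int_def)
    finally have "(real (pole_count f s) - real (pole_count f 0)) / s = (\<Sum>a\<in>Z. 2 * ((if cmod a \<le> s then 1 else 0) / s))"
      by (simp add: sum_distrib_left sum_divide_distrib)
    also have "\<dots> = (\<Sum>a\<in>Z. 2 * (if s \<in> {cmod a..r} then 1 / s else 0))"
      using s by (intro sum.cong) auto
    finally show ?thesis .
  qed
  have "((\<lambda>s. \<Sum>a\<in>Z. 2 * (if s \<in> {cmod a..r} then 1 / s else 0)) has_integral (\<Sum>a\<in>Z. 2 * ln (r / cmod a))) {0..r}"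
    by (intro has_integral_sum Z has_integral_mult_right int_a)
  hence "((\<lambda>s. (real (pole_count f s) - real (pole_count f 0)) / s) has_integral (\<Sum>a\<in>Z. 2 * ln (r / cmod a))) {0..r}"
    by (rule has_integral_eq[rotated]) (simp add: pc)
  thus ?thesis unfolding nevanlinna_N_def pc0 Z_def[symmetric]
    by (simp add: integral_unique sum_distrib_left)
qed

text \<open>\<open>P\<close> behaves like its leading term, so its presence changes the
  characteristic by O(ln r) only.\<close>

lemma cmod_P_circle:
  obtains C r0 where "1 \<le> r0" "0 \<le> C"
    "\<And>z. r0 \<le> cmod z \<Longrightarrow> poly P z \<noteq> 0 \<and> \<bar>ln (cmod (poly P z))\<bar> \<le> C * (1 + ln (cmod z))"
proof -
  define d where "d = degree P"
  define c where "c = cmod (lead_coeff P)"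
  have c: "0 < c" using P_nz by (simp add: c_def)
  have "((\<lambda>z. cmod (poly P z / z ^ d)) \<longlongrightarrow> c) at_infinity"
    unfolding d_def c_def by (intro tendsto_norm poly_divide_tendsto_aux)
  from order_tendstoD[OF this] c
  have "\<forall>\<^sub>F z in at_infinity. c / 2 < cmod (poly P z / z ^ d)" "\<forall>\<^sub>F z in at_infinity. cmod (poly P z / z ^ d) < 2 * c"
    by (metis field_sum_of_halves less_add_same_cancel1 half_gt_zero, metis mult_2 less_add_same_cancel1)
  hence "\<forall>\<^sub>F z in at_infinity. c / 2 < cmod (poly P z / z ^ d) \<and> cmod (poly P z / z ^ d) < 2 * c"
    by (rule eventually_conj)
  then obtain b where b: "\<And>z. b \<le> cmod z \<Longrightarrow> c / 2 < cmod (poly P z / z ^ d) \<and> cmod (poly P z / z ^ d) < 2 * c"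
    unfolding eventually_at_infinity by blast
  define C where "C = \<bar>ln (c / 2)\<bar> + \<bar>ln (2 * c)\<bar> + real d"
  show ?thesis
  proof (rule that[of "max 1 b" C])
    fix z assume z: "max 1 b \<le> cmod z"
    hence zz: "1 \<le> cmod z" "z \<noteq> 0" and bz: "c / 2 < cmod (poly P z / z ^ d)" "cmod (poly P z / z ^ d) < 2 * c"
      using b[of z] by auto
    define y where "y = cmod (poly P z / z ^ d)"
    have y: "0 < y" using bz(1) c unfolding y_def by linarith
    have P0: "poly P z \<noteq> 0" using y by (auto simp: y_def)
    have "cmod (poly P z) = y * cmod z ^ d" using zz by (simp add: y_def norm_divide norm_power)
    hence "ln (cmod (poly P z)) = ln y + real d * ln (cmod z)" using y zz by (simp add: ln_mult ln_realpow)
    moreover have "ln (c / 2) \<le> ln y" "ln y \<le> ln (2 * c)" using bz y c unfolding y_def[symmetric] by (auto intro: ln_mono)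
    moreover have l: "0 \<le> ln (cmod z)" using zz by simp
    moreover have "0 \<le> real d * ln (cmod z)" using l by simp
    ultimately have "\<bar>ln (cmod (poly P z))\<bar> \<le> \<bar>ln (c / 2)\<bar> + \<bar>ln (2 * c)\<bar> + real d * ln (cmod z)" by linarith
    also have "\<dots> \<le> C * (1 + ln (cmod z))"
    proof -
      have "0 \<le> (\<bar>ln (c / 2)\<bar> + \<bar>ln (2 * c)\<bar>) * ln (cmod z)" using l by simp
      thus ?thesis unfolding C_def by (simp add: algebra_simps)
    qed
    finally show "poly P z \<noteq> 0 \<and> \<bar>ln (cmod (poly P z))\<bar> \<le> C * (1 + ln (cmod z))" using P0 by simp
  qed (auto simp: C_def)
qed

text \<open>Jensen's formula for \<open>g\<close> turns the characteristic of \<open>P / g\<^sup>2\<close> into that of \<open>g\<^sup>2\<close>.\<close>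

lemma nevanlinna_T_approx:
  obtains C r0 where "1 \<le> r0" "0 \<le> C"
    "\<And>r. r0 \<le> r \<Longrightarrow> \<bar>nevanlinna_T f r - proximity_integral g r / pi\<bar> \<le> C * (1 + ln r)"
proof -
  obtain w where w: "g w \<noteq> 0" using g_nonzero by blast
  obtain c where ai: "\<And>r. 0 < r \<Longrightarrow> (\<lambda>\<theta>. ln (cmod (g (of_real r * cis \<theta>)))) absolutely_integrable_on {0..2*pi}"
   and J: "\<And>r. 0 < r \<Longrightarrow> integral {0..2*pi} (\<lambda>\<theta>. ln (cmod (g (of_real r * cis \<theta>)))) =
       2 * pi * (c + (if g 0 = 0 then ln r else 0) + (\<Sum>a | a \<noteq> 0 \<and> cmod a \<le> r \<and> g a = 0. ln (r / cmod a)))"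
    by (rule jensen_simple_zeros[OF g_hol w simple]) (assumption, (rule that; assumption))
  obtain CP r0 where CP: "1 \<le> r0" "0 \<le> CP"
    "\<And>z. r0 \<le> cmod z \<Longrightarrow> poly P z \<noteq> 0 \<and> \<bar>ln (cmod (poly P z))\<bar> \<le> CP * (1 + ln (cmod z))"
    using cmod_P_circle by metis
  have main: "\<bar>nevanlinna_T f r - proximity_integral g r / pi\<bar> \<le> (2 * \<bar>c\<bar> + 2 * CP) * (1 + ln r)" if r: "r0 \<le> r" for r
  proof -
    have r0: "0 < r" "1 \<le> r" using r CP by auto
    define z where "z \<theta> = of_real r * cis \<theta>" for \<theta>
    have cz: "cmod (z \<theta>) = r" for \<theta> using r0 by (simp add: z_def norm_mult)
    have Pz: "poly P (z \<theta>) \<noteq> 0" "\<bar>ln (cmod (poly P (z \<theta>)))\<bar> \<le> CP * (1 + ln r)" for \<theta>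
      using CP(3)[of "z \<theta>"] r cz by auto
    define N where "N = {\<theta>\<in>{0..2*pi}. z \<theta> \<in> {a. cmod a \<le> r \<and> g a = 0}}"
    have N: "finite N" unfolding N_def z_def by (rule finite_circle_preimage[OF entire_zeros_finite[OF g_hol w] r0(1)])
    have gz: "g (z \<theta>) \<noteq> 0" if "\<theta> \<in> {0..2*pi} - N" for \<theta> using that cz by (auto simp: N_def)
    define L where "L = integral {0..2*pi} (\<lambda>\<theta>. ln (cmod (g (z \<theta>))))"
    have L_int: "((\<lambda>\<theta>. ln (cmod (g (z \<theta>)))) has_integral L) {0..2*pi}"
      unfolding L_def z_def by (rule integrable_integral[OF set_lebesgue_integral_eq_integral(1)[OF ai[OF r0(1)]]])
    \<comment> \<open>From ln+ s = ln+ (1/s) + ln s with s = |P| / |g|^2. The part \<open>u\<close>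
      is continuous since \<open>P\<close> has no zeros on the circle; the singular part -2 ln |g|
      is governed by Jensen's formula.\<close>
    define u where "u \<theta> = ln (max 1 ((cmod (g (z \<theta>)))\<^sup>2 / cmod (poly P (z \<theta>)))) + ln (cmod (poly P (z \<theta>)))" for \<theta>
    have u_cont: "continuous_on {0..2*pi} u"
      unfolding u_def z_def
      by (intro continuous_intros continuous_on_compose2[OF holomorphic_on_imp_continuous_on[OF g_hol]])
         (use Pz in \<open>auto simp: z_def\<close>)
    define U where "U = integral {0..2*pi} u"
    have U_int: "(u has_integral U) {0..2*pi}" unfolding U_def
      by (intro integrable_integral integrable_continuous_real u_cont)
    have lf: "ln (max 1 (norm (f (z \<theta>)))) = u \<theta> - 2 * ln (cmod (g (z \<theta>)))" if "\<theta> \<in> {0..2*pi} - N" for \<theta>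
    proof -
      define x y where "x = cmod (g (z \<theta>))" and "y = cmod (poly P (z \<theta>))"
      have xy: "0 < x" "0 < y" using gz[OF that] Pz by (auto simp: x_def y_def)
      have "norm (f (z \<theta>)) = y / x\<^sup>2" using f_eq[OF gz[OF that]] by (simp add: x_def y_def norm_divide norm_power)
      moreover have "max 1 (y / x\<^sup>2) = max 1 (x\<^sup>2 / y) * (y / x\<^sup>2)" using xy by (auto simp: max_def field_simps)
      moreover have "ln (max 1 (x\<^sup>2 / y) * (y / x\<^sup>2)) = ln (max 1 (x\<^sup>2 / y)) + ln (y / x\<^sup>2)"
        using xy by (intro ln_mult_pos) auto
      ultimately have "ln (max 1 (norm (f (z \<theta>)))) = ln (max 1 (x\<^sup>2 / y)) + ln (y / x\<^sup>2)"
        by simp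
      also have "ln (y / x\<^sup>2) = ln y - 2 * ln x" using xy by (simp add: ln_div ln_realpow)
      finally show ?thesis by (simp add: u_def x_def y_def)
    qed
    have "((\<lambda>\<theta>. u \<theta> - 2 * ln (cmod (g (z \<theta>)))) has_integral (U - 2 * L)) {0..2*pi}"
      by (intro has_integral_diff U_int has_integral_mult_right L_int)
    from has_integral_spike_finite[OF N lf this]
    have "integral {0..2*pi} (\<lambda>\<theta>. ln (max 1 (norm (f (z \<theta>))))) = U - 2 * L" by (rule integral_unique)
    hence m: "nevanlinna_m f r = (U - 2 * L) / (2 * pi)" by (simp add: nevanlinna_m_def z_def)
    \<comment> \<open>The terms L / pi of \<open>m\<close> and \<open>N\<close> cancel in the
      characteristic.\<close>
    have N_eq: "nevanlinna_N f r = L / pi - 2 * c"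
      using nevanlinna_N_eq[OF r0(1)] J[OF r0(1)] unfolding L_def z_def by simp
    define I where "I = proximity_integral g r"
    have I_int: "((\<lambda>\<theta>. 2 * ln (max 1 (cmod (g (z \<theta>))))) has_integral 2 * I) {0..2*pi}"
      unfolding I_def proximity_integral_def z_def
      by (intro has_integral_mult_right integrable_integral ln_max_one_integrable g_hol)
    have close: "\<bar>u \<theta> - 2 * ln (max 1 (cmod (g (z \<theta>))))\<bar> \<le> 2 * CP * (1 + ln r)" for \<theta>
    proof -
      define x y where "x = cmod (g (z \<theta>))" and "y = cmod (poly P (z \<theta>))"
      have xy: "0 \<le> x" "0 < y" using Pz by (auto simp: x_def y_def)
      have gen: "ln (max 1 (s * t)) \<le> ln (max 1 s) + \<bar>ln t\<bar>" if "0 \<le> s" "0 < t" for s t :: real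
      proof -
        have "t \<le> exp \<bar>ln t\<bar>" using that by (metis abs_ge_self exp_le_cancel_iff exp_ln)
        hence "s * t \<le> max 1 s * exp \<bar>ln t\<bar>" using that by (intro mult_mono) auto
        moreover have "1 \<le> max 1 s * exp \<bar>ln t\<bar>" using mult_mono[of 1 "max 1 s" 1 "exp \<bar>ln t\<bar>"] by simp
        ultimately have "ln (max 1 (s * t)) \<le> ln (max 1 s * exp \<bar>ln t\<bar>)" by (intro ln_mono) auto
        also have "ln (max 1 s * exp \<bar>ln t\<bar>) = ln (max 1 s) + ln (exp \<bar>ln t\<bar>)" by (intro ln_mult_pos) auto
        finally show ?thesis by simp
      qed
      have sq: "ln (max 1 (x\<^sup>2)) = 2 * ln (max 1 x)"
      proof -
        have "max 1 (x\<^sup>2) = (max 1 x)\<^sup>2"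
        proof (cases "1 \<le> x")
          case True
          thus ?thesis using one_le_power[OF True, of 2] by (simp add: max_def)
        next
          case False
          thus ?thesis using power_le_one[of x 2] xy by (simp add: max_def)
        qed
        thus ?thesis by (simp add: ln_realpow)
      qed
      have 1: "ln (max 1 (x\<^sup>2 / y)) \<le> 2 * ln (max 1 x) + \<bar>ln y\<bar>"
        using gen[of "x\<^sup>2" "1 / y"] xy sq by (simp add: ln_div)
      have 2: "2 * ln (max 1 x) \<le> ln (max 1 (x\<^sup>2 / y)) + \<bar>ln y\<bar>"
        using gen[of "x\<^sup>2 / y" y] xy sq by simp
      have "\<bar>u \<theta> - 2 * ln (max 1 x)\<bar> \<le> 2 * \<bar>ln y\<bar>"
        using 1 2 by (simp add: u_def x_def y_def abs_le_iff) linarith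
      thus ?thesis using Pz(2)[of \<theta>] unfolding x_def y_def by linarith
    qed
    have "\<bar>U - 2 * I\<bar> \<le> 2 * CP * (1 + ln r) * (2 * pi)"
    proof -
      have "((\<lambda>\<theta>. u \<theta> - 2 * ln (max 1 (cmod (g (z \<theta>))))) has_integral (U - 2 * I)) {0..2*pi}"
        by (rule has_integral_diff[OF U_int I_int])
      moreover have "0 \<le> 2 * CP * (1 + ln r)" using CP(2) r0 by simp
      ultimately have "norm (U - 2 * I) \<le> 2 * CP * (1 + ln r) * Henstock_Kurzweil_Integration.content {0..2*pi}"
        by (intro has_integral_bound_real[of _ "{}"]) (use close in auto)
      thus ?thesis by simp
    qed
    hence "\<bar>(U - 2 * I) / (2 * pi)\<bar> \<le> 2 * CP * (1 + ln r)" by (simp add: abs_divide pos_divide_le_eq)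
    moreover have "nevanlinna_T f r - I / pi = (U - 2 * I) / (2 * pi) - 2 * c"
      unfolding nevanlinna_T_def m N_eq by (simp add: diff_divide_distrib)
    ultimately have "\<bar>nevanlinna_T f r - I / pi\<bar> \<le> 2 * CP * (1 + ln r) + 2 * \<bar>c\<bar>" by linarith
    also have "\<dots> \<le> (2 * \<bar>c\<bar> + 2 * CP) * (1 + ln r)"
    proof -
      have "0 \<le> 2 * \<bar>c\<bar> * ln r" using r0 by simp
      thus ?thesis by (simp add: algebra_simps)
    qed
    finally show ?thesis unfolding I_def .
  qed
  show ?thesis
    by (rule that[OF CP(1) _ main]) (use CP(2) in auto)
qed

lemma nevanlinna_T_entire: "nevanlinna_T g r = proximity_integral g r / (2 * pi)"
proof -
  have "\<not> is_pole g z" for z using not_is_pole_holomorphic[OF open_UNIV UNIV_I g_hol] by blast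
  hence "pole_count g s = 0" for s by (simp add: pole_count_def)
  thus ?thesis unfolding nevanlinna_T_def nevanlinna_N_def nevanlinna_m_def proximity_integral_def by simp
qed

end

section \<open>Partial fractions\<close>

lemma linear_powers_prod_dvd:
  fixes p :: "nat \<Rightarrow> complex" and N :: "complex poly"
  assumes "finite A" "inj_on p A" "\<And>j. j \<in> A \<Longrightarrow> [:- p j, 1:] ^ \<alpha> j dvd N"
  shows "(\<Prod>j\<in>A. [:- p j, 1:] ^ \<alpha> j) dvd N"
  using assms
proof (induction A)
  case (insert b A)
  show ?case
  proof (cases "N = 0")
    case False
    have "(\<Prod>j\<in>A. [:- p j, 1:] ^ \<alpha> j) dvd N" using insert by auto
    then obtain M where M: "N = (\<Prod>j\<in>A. [:- p j, 1:] ^ \<alpha> j) * M" by (rule dvdE)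
    have "poly (\<Prod>j\<in>A. [:- p j, 1:] ^ \<alpha> j) (p b) \<noteq> 0"
      using insert by (auto simp: poly_prod)
    hence "order (p b) (\<Prod>j\<in>A. [:- p j, 1:] ^ \<alpha> j) = 0" by (rule order_0I)
    hence "order (p b) N = order (p b) M" using False M order_mult by (metis add_0)
    moreover have "\<alpha> b \<le> order (p b) N" using insert.prems(2)[of b] False by (simp add: order_divides)
    ultimately have "[:- p b, 1:] ^ \<alpha> b dvd M" by (simp add: order_divides)
    hence "[:- p b, 1:] ^ \<alpha> b * (\<Prod>j\<in>A. [:- p j, 1:] ^ \<alpha> j) dvd M * (\<Prod>j\<in>A. [:- p j, 1:] ^ \<alpha> j)"
      by (rule mult_dvd_mono) simp
    thus ?thesis using insert.hyps M by (simp add: mult.commute)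
  qed simp
qed simp

context square_rep
begin

text \<open>Dividing the equation by P g gives R / P = (P'/P)(g'/g) - g''/g. As g(p_j) \<noteq> 0,
  this has at p_j at most a simple pole, with residue \<open>A j\<close>. So once the simple
  fractions are subtracted, the numerator \<open>N\<close> is divisible by each power and hence by
  \<open>P\<close>.\<close>

lemma partial_fractions:
  fixes p :: "nat \<Rightarrow> complex" and \<alpha> :: "nat \<Rightarrow> nat"
  assumes QR: "Q = poly R" and inj: "inj_on p {1..n}" and \<alpha>: "\<And>j. j \<in> {1..n} \<Longrightarrow> 0 < \<alpha> j"
    and P: "P = (\<Prod>j=1..n. [:- p j, 1:] ^ \<alpha> j)"
  shows "\<exists>S. \<forall>z. z \<notin> p ` {1..n} \<longrightarrow> poly R z / poly P z = poly S z +
              (\<Sum>j=1..n. of_nat (\<alpha> j) * (deriv g (p j) / g (p j)) * (1 / (z - p j)))"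
proof -
  define A where "A j = of_nat (\<alpha> j) * (deriv g (p j) / g (p j))" for j
  define C where "C j = (\<Prod>i\<in>{1..n} - {j}. [:- p i, 1:] ^ \<alpha> i)" for j
  define D where "D j = [:- p j, 1:] ^ (\<alpha> j - 1) * C j" for j
  have P_C: "P = [:- p j, 1:] ^ \<alpha> j * C j" if "j \<in> {1..n}" for j
    unfolding P C_def using that by (subst prod.remove[of _ j]) auto
  have P_D: "P = [:- p j, 1:] * D j" if "j \<in> {1..n}" for j
  proof -
    have "0 < \<alpha> j" by (rule \<alpha>[OF that])
    then obtain b where b: "\<alpha> j = Suc b" by (cases "\<alpha> j") auto
    show ?thesis using P_C[OF that] unfolding D_def b by (simp only: power_Suc diff_Suc_1 mult.assoc)
  qed
  have p_neq: "p j \<noteq> p i" if "j \<in> {1..n}" "i \<in> {1..n} - {j}" for i j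
    using inj_onD[OF inj, of i j] that by auto
  have C_nz: "poly (C j) (p j) \<noteq> 0" if "j \<in> {1..n}" for j
    using p_neq[OF that] by (auto simp: C_def poly_prod)
  have root: "poly P z = 0 \<longleftrightarrow> z \<in> p ` {1..n}" for z
    unfolding P using \<alpha> by (auto simp: poly_prod image_iff)
  define N where "N = R - (\<Sum>j=1..n. smult (A j) (D j))"
  have N_eq: "poly N z / poly P z = poly R z / poly P z - (\<Sum>j=1..n. A j / (z - p j))" if "z \<notin> p ` {1..n}" for z
  proof -
    have "poly (D j) z / poly P z = 1 / (z - p j)" if "j \<in> {1..n}" for j
    proof -
      have "poly P z = (z - p j) * poly (D j) z" using arg_cong[OF P_D[OF that], of "\<lambda>q. poly q z"] by (simp add: algebra_simps)
      moreover have "poly P z \<noteq> 0" using root \<open>z \<notin> _\<close> by blast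
      ultimately show ?thesis by auto
    qed
    hence "A j * poly (D j) z / poly P z = A j / (z - p j)" if "j \<in> {1..n}" for j
      using that by (metis mult.right_neutral times_divide_eq_right)
    hence "(\<Sum>j=1..n. A j * poly (D j) z / poly P z) = (\<Sum>j=1..n. A j / (z - p j))"
      by (intro sum.cong refl) blast
    thus ?thesis by (simp add: N_def poly_sum diff_divide_distrib sum_divide_distrib)
  qed
  have "[:- p j, 1:] ^ \<alpha> j dvd N" if j: "j \<in> {1..n}" for j
  proof (rule ccontr)
    assume ndvd: "\<not> [:- p j, 1:] ^ \<alpha> j dvd N"
    define a where "a = p j"
    define k where "k = order a N"
    have N0: "N \<noteq> 0" and k: "k < \<alpha> j" using ndvd by (auto simp: order_divides k_def a_def not_le)
    obtain M where M: "N = [:- a, 1:] ^ k * M" "\<not> [:- a, 1:] dvd M"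
      using order_decomp[OF N0, of a] unfolding k_def by blast
    have Ma: "poly M a \<noteq> 0" using M(2) by (simp add: poly_eq_0_iff_dvd)
    have ga: "g a \<noteq> 0" using P_nonzero_at_pole[of a] root[of a] j by (auto simp: a_def)
    have g_lim: "(\<lambda>z. deriv g z / g z) \<midarrow>a\<rightarrow> deriv g a / g a" "(\<lambda>z. deriv (deriv g) z / g z) \<midarrow>a\<rightarrow> deriv (deriv g) a / g a"
      "g \<midarrow>a\<rightarrow> g a"
    proof -
      have c: "h \<midarrow>a\<rightarrow> h a" if "h holomorphic_on UNIV" for h
        using that by (metis UNIV_I holomorphic_on_imp_continuous_on continuous_on_eq_continuous_at isCont_def open_UNIV)
      have h1: "deriv g holomorphic_on UNIV" by (intro holomorphic_deriv g_hol) auto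
      have h2: "deriv (deriv g) holomorphic_on UNIV" by (intro holomorphic_deriv h1) auto
      show "(\<lambda>z. deriv g z / g z) \<midarrow>a\<rightarrow> deriv g a / g a" "(\<lambda>z. deriv (deriv g) z / g z) \<midarrow>a\<rightarrow> deriv (deriv g) a / g a"
        "g \<midarrow>a\<rightarrow> g a"
        by (intro tendsto_divide c g_hol h1 h2 ga)+
    qed
    have ev: "\<forall>\<^sub>F z in at a. z \<noteq> a \<and> g z \<noteq> 0 \<and> z \<notin> p ` {1..n}"
    proof -
      have "open (- (p ` {1..n} - {a}))" by (intro open_Compl finite_imp_closed) auto
      hence "\<forall>\<^sub>F z in at a. z \<in> - (p ` {1..n} - {a})" by (rule eventually_at_in_open') auto
      thus ?thesis using g_ev_nonzero[of a] eventually_neq_at_within[of a a] by eventually_elim auto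
    qed
    have Pz: "poly P z = (z - a) ^ \<alpha> j * poly (C j) z" for z
      using arg_cong[OF P_C[OF j], of "\<lambda>q. poly q z"] by (simp add: a_def poly_power)
    \<comment> \<open>The multiplication by z - a avoids the exponent \<alpha> j - 1.\<close>
    have P'z: "poly (pderiv P) z * (z - a) = (z - a) ^ \<alpha> j * (of_nat (\<alpha> j) * poly (C j) z + (z - a) * poly (pderiv (C j)) z)" for z
    proof -
      obtain b where b: "\<alpha> j = Suc b" using \<alpha>[OF j] by (cases "\<alpha> j") auto
      have "pderiv P = smult (of_nat (Suc b)) ([:- a, 1:] ^ b) * pderiv [:- a, 1:] * C j + [:- a, 1:] ^ Suc b * pderiv (C j)"
        unfolding P_C[OF j] a_def[symmetric] b by (simp only: pderiv_mult pderiv_power_Suc) (simp add: algebra_simps)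
      hence "poly (pderiv P) z = of_nat (Suc b) * (z - a) ^ b * poly (C j) z + (z - a) ^ Suc b * poly (pderiv (C j)) z"
        by (simp only: poly_add poly_mult poly_smult poly_power) (simp add: pderiv_pCons)
      thus ?thesis unfolding b by (simp only:) (simp add: algebra_simps)
    qed
    have Cj: "poly (C j) a \<noteq> 0" using C_nz[OF j] by (simp add: a_def)
    have Clim: "(\<lambda>z. poly q z) \<midarrow>a\<rightarrow> poly q a" for q :: "complex poly" by (intro tendsto_intros)
    have l1: "(\<lambda>z. (of_nat (\<alpha> j) + (z - a) * poly (pderiv (C j)) z / poly (C j) z) * (deriv g z / g z) - (z - a) * (deriv (deriv g) z / g z))
       \<midarrow>a\<rightarrow> (of_nat (\<alpha> j) + (a - a) * poly (pderiv (C j)) a / poly (C j) a) * (deriv g a / g a) - (a - a) * (deriv (deriv g) a / g a)"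
      by (intro tendsto_diff tendsto_mult tendsto_add tendsto_divide tendsto_const tendsto_ident_at Clim g_lim(1,2) Cj)
    have evC: "\<forall>\<^sub>F z in at a. poly (C j) z \<noteq> 0"
      using order_tendstoD(1)[OF tendsto_norm[OF Clim[of "C j"]], of 0] Cj by (auto elim: eventually_mono)
    have "(\<lambda>z. (z - a) * (poly R z / poly P z)) \<midarrow>a\<rightarrow> A j"
    proof (rule Lim_transform_eventually)
      show "\<forall>\<^sub>F z in at a. (of_nat (\<alpha> j) + (z - a) * poly (pderiv (C j)) z / poly (C j) z) * (deriv g z / g z) - (z - a) * (deriv (deriv g) z / g z)
         = (z - a) * (poly R z / poly P z)"
        using ev evC
      proof eventually_elim
        case (elim z)
        have P0: "poly P z \<noteq> 0" using elim root by blast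
        have "poly R z = (poly (pderiv P) z * deriv g z - poly P z * deriv (deriv g) z) / g z"
          using ode[of z] elim unfolding QR by (simp add: field_simps add_eq_0_iff2)
        note Rz = this
        have "(z - a) * (poly R z / poly P z) = (poly (pderiv P) z * (z - a)) / poly P z * (deriv g z / g z) - (z - a) * (deriv (deriv g) z / g z)"
        proof -
          have gen: "v * ((p1 * d - q * dd) / h / q) = p1 * v / q * (d / h) - v * (dd / h)"
            if "q \<noteq> 0" "h \<noteq> 0" for v p1 d q dd h :: complex
            using that by (simp add: field_simps)
          show ?thesis unfolding Rz by (rule gen) (use P0 elim in auto)
        qed
        also have "(poly (pderiv P) z * (z - a)) / poly P z = of_nat (\<alpha> j) + (z - a) * poly (pderiv (C j)) z / poly (C j) z"
          unfolding P'z Pz using elim by (simp add: field_simps)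
        finally show ?case by simp
      qed
      show "(\<lambda>z. (of_nat (\<alpha> j) + (z - a) * poly (pderiv (C j)) z / poly (C j) z) * (deriv g z / g z) - (z - a) * (deriv (deriv g) z / g z)) \<midarrow>a\<rightarrow> A j"
        using l1 by (simp add: A_def a_def)
    qed
    moreover have "(\<lambda>z. (z - a) * (\<Sum>i=1..n. A i / (z - p i))) \<midarrow>a\<rightarrow> A j"
    proof (rule Lim_transform_eventually)
      have "(\<lambda>z. A j + (z - a) * (\<Sum>i\<in>{1..n} - {j}. A i / (z - p i))) \<midarrow>a\<rightarrow> A j + (a - a) * (\<Sum>i\<in>{1..n} - {j}. A i / (a - p i))"
        by (intro tendsto_intros) (use p_neq[OF j] in \<open>auto simp: a_def\<close>)
      thus "(\<lambda>z. A j + (z - a) * (\<Sum>i\<in>{1..n} - {j}. A i / (z - p i))) \<midarrow>a\<rightarrow> A j" by simp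
      show "\<forall>\<^sub>F z in at a. A j + (z - a) * (\<Sum>i\<in>{1..n} - {j}. A i / (z - p i)) = (z - a) * (\<Sum>i=1..n. A i / (z - p i))"
        using eventually_neq_at_within[of a a]
      proof eventually_elim
        case (elim z)
        show ?case using elim j by (subst (2) sum.remove[of _ j]) (auto simp: a_def distrib_left)
      qed
    qed
    ultimately have "(\<lambda>z. (z - a) * (poly R z / poly P z) - (z - a) * (\<Sum>i=1..n. A i / (z - p i))) \<midarrow>a\<rightarrow> A j - A j"
      by (rule tendsto_diff)
    \<comment> \<open>The subtraction is exact because k < \<alpha> j. The product tends to 0, yet
      it equals M / C_j, which has a nonzero limit.\<close>
    hence "(\<lambda>z. (z - a) ^ (\<alpha> j - k - 1) * ((z - a) * (poly R z / poly P z) - (z - a) * (\<Sum>i=1..n. A i / (z - p i)))) \<midarrow>a\<rightarrow> (a - a) ^ (\<alpha> j - k - 1) * (A j - A j)"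
      by (rule tendsto_mult[OF tendsto_power[OF tendsto_diff[OF tendsto_ident_at tendsto_const]]])
    moreover have "\<forall>\<^sub>F z in at a. (z - a) ^ (\<alpha> j - k - 1) * ((z - a) * (poly R z / poly P z) - (z - a) * (\<Sum>i=1..n. A i / (z - p i))) = poly M z / poly (C j) z"
      using ev evC
    proof eventually_elim
      case (elim z)
      have "(z - a) * (poly R z / poly P z) - (z - a) * (\<Sum>i=1..n. A i / (z - p i)) = (z - a) * (poly N z / poly P z)"
        using N_eq[of z] elim by (simp add: right_diff_distrib)
      moreover have "poly N z = (z - a) ^ k * poly M z" by (simp add: M(1) poly_power)
      moreover have "(z - a) ^ (\<alpha> j - k - 1) * (z - a) * (z - a) ^ k = (z - a) ^ \<alpha> j"
      proof -
        have "\<alpha> j = (\<alpha> j - k - 1) + 1 + k" using k by simp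
        thus ?thesis by (metis power_add power_one_right)
      qed
      hence "(z - a) ^ (\<alpha> j - k - 1) * ((z - a) * ((z - a) ^ k * poly M z / ((z - a) ^ \<alpha> j * poly (C j) z)))
        = (z - a) ^ \<alpha> j * poly M z / ((z - a) ^ \<alpha> j * poly (C j) z)"
        by (simp add: mult.assoc[symmetric])
      ultimately show ?case using elim by (simp add: Pz)
    qed
    ultimately have "(\<lambda>z. poly M z / poly (C j) z) \<midarrow>a\<rightarrow> (a - a) ^ (\<alpha> j - k - 1) * (A j - A j)"
      by (rule Lim_transform_eventually)
    moreover have "(\<lambda>z. poly M z / poly (C j) z) \<midarrow>a\<rightarrow> poly M a / poly (C j) a"
      by (intro tendsto_divide Clim Cj)
    ultimately have "poly M a / poly (C j) a = (a - a) ^ (\<alpha> j - k - 1) * (A j - A j)"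
      using LIM_unique by blast
    thus False using Ma Cj by simp
  qed
  hence "P dvd N" unfolding P by (intro linear_powers_prod_dvd inj) auto
  then obtain S where S: "N = P * S" by (rule dvdE)
  show ?thesis
  proof (intro exI[of _ S] allI impI)
    fix z assume z: "z \<notin> p ` {1..n}"
    hence "poly P z \<noteq> 0" using root by blast
    hence "poly N z / poly P z = poly S z" by (simp add: S)
    thus "poly R z / poly P z = poly S z + (\<Sum>j=1..n. of_nat (\<alpha> j) * (deriv g (p j) / g (p j)) * (1 / (z - p j)))"
      using N_eq[OF z] by (simp add: A_def diff_eq_eq)
  qed
qed

end

section \<open>Series of double poles\<close>

lemma entire_imp_analytic: "g holomorphic_on UNIV \<Longrightarrow> g analytic_on S"
  by (rule analytic_on_subset[of g UNIV]) (simp_all add: analytic_on_open)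

lemma double_pole_times_square:
  fixes v :: complex
  assumes "v \<noteq> 0"
  shows "(a / v\<^sup>2 + h) * (v * x)\<^sup>2 = (a + v\<^sup>2 * h) * x\<^sup>2"
  using assms by (simp add: field_simps power2_eq_square)

section \<open>The series and its primitive\<close>

locale double_pole_series =
  fixes c t :: "nat \<Rightarrow> complex" and f :: "complex \<Rightarrow> complex"
  assumes c_nz: "\<And>n. c n \<noteq> 0"
    and t_distinct: "inj t"
    and t_lim: "filterlim (\<lambda>n. norm (t n)) at_top sequentially"
    and summ: "summable (\<lambda>n. if t n = 0 then 0 else norm (c n) / (norm (t n))\<^sup>2)"
    and f_def: "\<And>z. z \<notin> range t \<Longrightarrow> f z = (\<Sum>n. c n / (z - t n)\<^sup>2)"
begin

text \<open>Points tending to infinity do not accumulate. An arbitrary index set is allowed because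
  the series is also used with one index left out.\<close>

lemma closed_subset_range: "closed (t ` N)"
proof -
  have lim: "filterlim t at_infinity sequentially"
    using t_lim by (rule filterlim_norm_at_top_imp_at_infinity)
  have "\<not> z islimpt (range t)" for z
  proof
    assume "z islimpt (range t)"
    then obtain r :: "nat \<Rightarrow> nat" where r: "strict_mono r" "(t \<circ> r) \<longlonglongrightarrow> z"
      using islimpt_range_imp_convergent_subsequence by metis
    moreover have "filterlim (t \<circ> r) at_infinity sequentially"
      unfolding o_def by (rule filterlim_compose[OF lim filterlim_subseq[OF r(1)]])
    ultimately show False
      by (meson not_tendsto_and_filterlim_at_infinity trivial_limit_sequentially)
  qed
  hence "\<not> z islimpt (t ` N)" for z using islimpt_subset[of z "t ` N" "range t"] by blast
  thus ?thesis unfolding closed_limpt by blast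
qed

text \<open>The correction 1 / t_n turns 1 / (z - t_n) into z / ((z - t_n) t_n), which decays like
  |t_n|^-2 as the summability hypothesis demands.\<close>

definition prim_term where "prim_term n z = - c n * (1 / (z - t n) + (if t n = 0 then 0 else 1 / t n))"

text \<open>The Mittag-Leffler series of a primitive, with the terms outside \<open>N\<close> left out.\<close>

lemma partial_primitive:
  fixes N :: "nat set"
  obtains F F' where "\<And>z. z \<notin> t ` N \<Longrightarrow> (\<lambda>n. if n \<in> N then prim_term n z else 0) sums F z"
    "\<And>z. z \<notin> t ` N \<Longrightarrow> (\<lambda>n. if n \<in> N then c n / (z - t n)\<^sup>2 else 0) sums F' z"
    "\<And>z. z \<notin> t ` N \<Longrightarrow> (F has_field_derivative F' z) (at z)"
proof -
  have "\<exists>F F'. \<forall>z\<in>- (t ` N). (\<lambda>n. if n \<in> N then prim_term n z else 0) sums F z \<and>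
     (\<lambda>n. if n \<in> N then c n / (z - t n)\<^sup>2 else 0) sums F' z \<and> (F has_field_derivative F' z) (at z)"
  proof (rule series_and_derivative_comparison_local)
    show "open (- (t ` N))" using closed_subset_range by auto
    show "((\<lambda>z. if n \<in> N then prim_term n z else 0) has_field_derivative (if n \<in> N then c n / (z - t n)\<^sup>2 else 0)) (at z)"
      if z: "z \<in> - (t ` N)" for n z
    proof (cases "n \<in> N")
      case True
      hence "z - t n \<noteq> 0" using z by auto
      hence "(prim_term n has_field_derivative c n / (z - t n)\<^sup>2) (at z)"
        unfolding prim_term_def[abs_def] by (auto intro!: derivative_eq_intros simp: power2_eq_square)
      thus ?thesis using True by simp
    qed simp
    show "\<exists>d h. 0 < d \<and> summable h \<and> (\<forall>\<^sub>F n in sequentially. \<forall>y\<in>ball x d \<inter> - (t ` N). norm (if n \<in> N then prim_term n y else 0) \<le> h n)" for x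
    proof (intro exI conjI)
      define R where "R = cmod x + 1"
      have R: "0 < R" by (simp add: R_def add_nonneg_pos)
      show "(0::real) < 1" by simp
      show "summable (\<lambda>n. 2 * R * (if t n = 0 then 0 else norm (c n) / (norm (t n))\<^sup>2))"
        by (intro summable_mult summ)
      \<comment> \<open>Once |t_n| \<ge> 2 R, every y with |y| \<le> R satisfies |y - t_n| \<ge>
        |t_n| / 2.\<close>
      have "\<forall>\<^sub>F n in sequentially. 2 * R \<le> cmod (t n)" using t_lim unfolding filterlim_at_top by blast
      thus "\<forall>\<^sub>F n in sequentially. \<forall>y\<in>ball x 1 \<inter> - (t ` N). norm (if n \<in> N then prim_term n y else 0)
          \<le> 2 * R * (if t n = 0 then 0 else norm (c n) / (norm (t n))\<^sup>2)"
      proof eventually_elim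
        case (elim n)
        have t0: "t n \<noteq> 0" using elim R by auto
        show ?case
        proof
          fix y assume y: "y \<in> ball x 1 \<inter> - (t ` N)"
          have yR: "cmod y \<le> R" using y norm_triangle_ineq[of x "y - x"] by (simp add: R_def dist_norm norm_minus_commute)
          have far: "cmod (t n) / 2 \<le> cmod (y - t n)"
            using norm_triangle_ineq2[of "t n" y] elim yR by (simp add: norm_minus_commute)
          have yt: "y - t n \<noteq> 0" using far t0 by (metis half_gt_zero norm_zero not_less zero_less_norm_iff)
          have "1 / (y - t n) + 1 / t n = y / ((y - t n) * t n)" using yt t0 by (simp add: field_simps)
          hence "cmod (prim_term n y) = cmod (c n) * (cmod y / (cmod (y - t n) * cmod (t n)))"
            using t0 by (simp add: prim_term_def norm_mult norm_divide)
          also have "cmod y / (cmod (y - t n) * cmod (t n)) \<le> R / (cmod (t n) / 2 * cmod (t n))"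
            using yR far t0 R by (intro frac_le mult_right_mono) auto
          also have "\<dots> = 2 * R / (cmod (t n))\<^sup>2" by (simp add: power2_eq_square)
          finally have "cmod (prim_term n y) \<le> cmod (c n) * (2 * R / (cmod (t n))\<^sup>2)" by (simp add: mult_left_mono)
          thus "norm (if n \<in> N then prim_term n y else 0)
             \<le> 2 * R * (if t n = 0 then 0 else norm (c n) / (norm (t n))\<^sup>2)"
            using t0 R by (simp add: mult.commute)
        qed
      qed
    qed
  qed
  then obtain F F' where *: "\<forall>z\<in>- (t ` N). (\<lambda>n. if n \<in> N then prim_term n z else 0) sums F z \<and>
     (\<lambda>n. if n \<in> N then c n / (z - t n)\<^sup>2 else 0) sums F' z \<and> (F has_field_derivative F' z) (at z)"
    by blast
  show ?thesis by (rule that[of F F']) (use * in blast)+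
qed

text \<open>The series without the index \<open>m\<close> is regular at t_m, and adding the term
  back shows a simple pole. A single-valued primitive exists because the residues of
  \<open>f\<close> vanish.\<close>

lemma primitive_exists:
  obtains F where "\<And>z. z \<notin> range t \<Longrightarrow> (F has_field_derivative f z) (at z)"
    "\<And>m. \<exists>H r. 0 < r \<and> H holomorphic_on ball (t m) r \<and>
        (\<forall>z\<in>ball (t m) r - {t m}. z \<notin> range t \<and> F z = H z - c m / (z - t m))"
proof -
  obtain F F' where F: "\<And>z. z \<notin> range t \<Longrightarrow> (\<lambda>n. prim_term n z) sums F z"
    "\<And>z. z \<notin> range t \<Longrightarrow> (\<lambda>n. c n / (z - t n)\<^sup>2) sums F' z"
    "\<And>z. z \<notin> range t \<Longrightarrow> (F has_field_derivative F' z) (at z)"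
    using partial_primitive[of UNIV] by auto
  show ?thesis
  proof (rule that[of F])
    show "(F has_field_derivative f z) (at z)" if z: "z \<notin> range t" for z
      using F(3)[OF z] f_def[OF z] F(2)[OF z] sums_unique by metis
    fix m :: nat
    define N where "N = UNIV - {m}"
    obtain H H' where H: "\<And>z. z \<notin> t ` N \<Longrightarrow> (\<lambda>n. if n \<in> N then prim_term n z else 0) sums H z"
      "\<And>z. z \<notin> t ` N \<Longrightarrow> (H has_field_derivative H' z) (at z)"
      by (rule partial_primitive[of N]) (rule that; assumption)
    have tm: "t m \<in> - (t ` N)" using t_distinct by (auto simp: N_def inj_on_def)
    then obtain r where r: "0 < r" "ball (t m) r \<subseteq> - (t ` N)"
      using closed_subset_range[of N] open_contains_ball by (metis open_Compl)
    \<comment> \<open>Minus the constant part of the omitted term.\<close>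
    define k where "k = c m * (if t m = 0 then 0 else 1 / t m)"
    have rng: "z \<notin> range t" if "z \<in> ball (t m) r - {t m}" for z
    proof
      assume "z \<in> range t"
      then obtain n where "z = t n" by blast
      thus False using that r by (cases "n = m") (auto simp: N_def)
    qed
    show "\<exists>H r. 0 < r \<and> H holomorphic_on ball (t m) r \<and>
        (\<forall>z\<in>ball (t m) r - {t m}. z \<notin> range t \<and> F z = H z - c m / (z - t m))"
    proof (intro exI[of _ "\<lambda>z. H z - k"] exI[of _ r] conjI ballI r(1))
      have "H field_differentiable (at z within ball (t m) r)" if "z \<in> ball (t m) r" for z
        using H(2)[of z] r that by (meson ComplD DERIV_subset field_differentiable_def subsetD subset_UNIV)
      thus "(\<lambda>z. H z - k) holomorphic_on ball (t m) r"
        by (intro holomorphic_intros) (simp add: holomorphic_on_def)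
      fix z assume z: "z \<in> ball (t m) r - {t m}"
      show "z \<notin> range t" by (rule rng[OF z])
      have zN: "z \<notin> t ` N" using rng[OF z] by blast
      have "(\<lambda>n. (if n \<in> N then prim_term n z else 0) + (if n = m then prim_term m z else 0)) sums (H z + prim_term m z)"
        by (intro sums_add H(1) zN) (use sums_single[of m "\<lambda>n. prim_term m z"] in simp)
      moreover have "(if n \<in> N then prim_term n z else 0) + (if n = m then prim_term m z else 0) = prim_term n z" for n
        by (simp add: N_def)
      ultimately have "(\<lambda>n. prim_term n z) sums (H z + prim_term m z)" by simp
      hence "F z = H z + prim_term m z" using F(1)[OF rng[OF z]] sums_unique2 by blast
      thus "F z = H z - k - c m / (z - t m)" by (simp add: prim_term_def k_def algebra_simps)
    qed
  qed
qed

lemma f_local: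
  obtains H r where "0 < r" "H holomorphic_on ball (t m) r"
    "\<And>z. z \<in> ball (t m) r - {t m} \<Longrightarrow> z \<notin> range t \<and> f z = c m / (z - t m)\<^sup>2 + H z"
proof -
  obtain F where F: "\<And>z. z \<notin> range t \<Longrightarrow> (F has_field_derivative f z) (at z)"
    "\<And>m. \<exists>H r. 0 < r \<and> H holomorphic_on ball (t m) r \<and>
        (\<forall>z\<in>ball (t m) r - {t m}. z \<notin> range t \<and> F z = H z - c m / (z - t m))"
    using primitive_exists by blast
  obtain H r where H: "0 < r" "H holomorphic_on ball (t m) r"
    "\<And>z. z \<in> ball (t m) r - {t m} \<Longrightarrow> z \<notin> range t \<and> F z = H z - c m / (z - t m)"
    using F(2)[of m] by blast
  show ?thesis
  proof (rule that[of r "deriv H"])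
    show "deriv H holomorphic_on ball (t m) r" by (intro holomorphic_deriv H) auto
    fix z assume z: "z \<in> ball (t m) r - {t m}"
    hence zt: "z - t m \<noteq> 0" by auto
    have "((\<lambda>z. H z - c m / (z - t m)) has_field_derivative deriv H z + c m / (z - t m)\<^sup>2) (at z)"
      using zt z H by (auto intro!: derivative_eq_intros holomorphic_derivI[OF H(2)] simp: power2_eq_square)
    hence "(F has_field_derivative deriv H z + c m / (z - t m)\<^sup>2) (at z)"
      by (rule has_field_derivative_transform_within_open[where S = "ball (t m) r - {t m}"])
         (use z H(3) in auto)
    moreover have "z \<notin> range t" using H(3)[OF z] by blast
    ultimately show "z \<notin> range t \<and> f z = c m / (z - t m)\<^sup>2 + deriv H z"
      using F(1) DERIV_unique by (metis add.commute)
  qed (rule H(1))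
qed

lemma f_analytic: "z \<notin> range t \<Longrightarrow> f analytic_on {z}"
proof -
  assume z: "z \<notin> range t"
  obtain F where F: "\<And>z. z \<notin> range t \<Longrightarrow> (F has_field_derivative f z) (at z)"
    using primitive_exists by blast
  have op: "open (- range t)" using closed_subset_range[of UNIV] by auto
  have "F holomorphic_on (- range t)"
    unfolding holomorphic_on_open[OF op] using F by blast
  hence "deriv F holomorphic_on (- range t)" by (intro holomorphic_deriv op)
  hence "f holomorphic_on (- range t)"
    by (rule holomorphic_transform) (use F DERIV_imp_deriv in blast)
  thus ?thesis using z op by (metis ComplI analytic_at)
qed

lemma pole_iff: "is_pole f z \<longleftrightarrow> z \<in> range t"
proof
  assume "is_pole f z"
  thus "z \<in> range t" using f_analytic analytic_at_imp_no_pole by blast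
next
  assume "z \<in> range t"
  then obtain m where m: "z = t m" by blast
  obtain H r where H: "0 < r" "H holomorphic_on ball (t m) r"
    "\<And>z. z \<in> ball (t m) r - {t m} \<Longrightarrow> z \<notin> range t \<and> f z = c m / (z - t m)\<^sup>2 + H z"
    by (rule f_local[of m]) (rule that; assumption)
  have Hl: "H \<midarrow>t m\<rightarrow> H (t m)"
    using H(1,2) by (metis centre_in_ball holomorphic_on_imp_continuous_on continuous_on_eq_continuous_at isCont_def open_ball)
  have "(\<lambda>z. (z - t m)\<^sup>2) \<midarrow>t m\<rightarrow> (t m - t m)\<^sup>2" by (intro tendsto_intros)
  hence "filterlim (\<lambda>z. (z - t m)\<^sup>2) (at 0) (at (t m))"
    by (auto simp: filterlim_at eventually_at_filter)
  hence "filterlim (\<lambda>z. c m / (z - t m)\<^sup>2) at_infinity (at (t m))"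
    by (intro filterlim_divide_at_infinity[OF tendsto_const] c_nz)
  hence "filterlim (\<lambda>z. c m / (z - t m)\<^sup>2 + H z) at_infinity (at (t m))"
    by (rule tendsto_add_filterlim_at_infinity'[OF _ Hl])
  moreover have "\<forall>\<^sub>F z in at (t m). c m / (z - t m)\<^sup>2 + H z = f z"
    unfolding eventually_at using H(1,3) by (intro exI[of _ r]) (auto simp: dist_commute)
  ultimately have "filterlim f at_infinity (at (t m))" by (simp cong: filterlim_cong)
  thus "is_pole f z" by (simp add: is_pole_def m)
qed

lemma infinite_poles: "infinite (range t)"
  using t_distinct by (simp add: range_inj_infinite)

text \<open>The Weierstrass product takes nonzero prescribed zeros, so the plane is first shifted by
  a point \<open>z0\<close> outside the countable set of poles.\<close>

lemma simple_zero_function: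
  obtains g0 where "g0 holomorphic_on UNIV" "\<And>z. g0 z = 0 \<longleftrightarrow> z \<in> range t" "\<And>z. g0 z = 0 \<Longrightarrow> deriv g0 z \<noteq> 0"
proof -
  have "countable (range t)" by simp
  hence "range t \<noteq> UNIV" using uncountable_UNIV_complex by metis
  then obtain z0 where z0: "z0 \<notin> range t" by blast
  define a where "a n = t n - z0" for n
  have "filterlim t at_infinity sequentially"
    using t_lim by (rule filterlim_norm_at_top_imp_at_infinity)
  hence "filterlim (\<lambda>n. t n + (- z0)) at_infinity sequentially"
    by (rule tendsto_add_filterlim_at_infinity'[OF _ tendsto_const])
  hence lim: "filterlim a at_infinity at_top" by (simp add: a_def[abs_def])
  have inj: "inj a" using t_distinct by (auto simp: a_def inj_on_def)
  interpret W: weierstrass_product' a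
  proof
    show "a n \<noteq> 0" for n using z0 by (auto simp: a_def)
    show "filterlim a at_infinity at_top" by (rule lim)
    show "finite (a -` {z})" for z using inj by (simp add: finite_vimageI)
  qed
  have simple: "deriv W.f z \<noteq> 0" if z: "W.f z = 0" for z
  proof -
    have "z \<in> range a" using z W.zero by blast
    then obtain n where n: "z = a n" by blast
    have "a -` {z} = {n}" using inj n by (auto simp: inj_on_def)
    hence zo: "zorder W.f z = 1" using W.zorder[of z] by simp
    have "\<exists>w\<in>UNIV. W.f w \<noteq> 0"
    proof -
      have "0 \<notin> range a" using z0 by (auto simp: a_def)
      thus ?thesis using W.zero by blast
    qed
    from zorder_exist_zero[OF W.holomorphic open_UNIV connected_UNIV UNIV_I this, of z]
    obtain r where r: "0 < r" "zor_poly W.f z holomorphic_on cball z r"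
      "\<And>w. w \<in> cball z r \<Longrightarrow> W.f w = zor_poly W.f z w * (w - z) \<and> zor_poly W.f z w \<noteq> 0"
      unfolding zo by auto
    have h: "zor_poly W.f z holomorphic_on ball z r" by (rule holomorphic_on_subset[OF r(2)]) auto
    have "((\<lambda>w. zor_poly W.f z w * (w - z)) has_field_derivative zor_poly W.f z z) (at z)"
      using r(1) by (auto intro!: derivative_eq_intros holomorphic_derivI[OF h])
    hence "(W.f has_field_derivative zor_poly W.f z z) (at z)"
      by (rule has_field_derivative_transform_within_open[where S = "ball z r"]) (use r in auto)
    thus ?thesis using r(1) r(3)[of z] by (simp add: DERIV_imp_deriv)
  qed
  define g0 where "g0 z = W.f (z - z0)" for z
  have hol: "W.f holomorphic_on UNIV" by (rule W.holomorphic)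
  have d: "(g0 has_field_derivative deriv W.f (z - z0)) (at z)" for z
    unfolding g0_def[abs_def]
    using DERIV_chain2[OF holomorphic_derivI[OF hol open_UNIV UNIV_I] DERIV_diff[OF DERIV_ident DERIV_const], of z0 z]
    by simp
  show ?thesis
  proof (rule that[of g0])
    show "g0 holomorphic_on UNIV" unfolding holomorphic_on_open[OF open_UNIV] using d by blast
    show "g0 z = 0 \<longleftrightarrow> z \<in> range t" for z unfolding g0_def W.zero by (auto simp: a_def image_iff)
    show "deriv g0 z \<noteq> 0" if "g0 z = 0" for z
      using simple[of "z - z0"] that d[of z] by (simp add: g0_def DERIV_imp_deriv)
  qed
qed


text \<open>The last conclusion fixes the values filled in at the points t_m; it shows later that
  the extension of f g0^2 does not vanish there.\<close>

lemma extend_entire: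
  assumes "\<And>z. z \<notin> range t \<Longrightarrow> \<phi> analytic_on {z}"
    and "\<And>m. \<exists>H r. 0 < r \<and> H holomorphic_on ball (t m) r \<and> (\<forall>z\<in>ball (t m) r - {t m}. \<phi> z = H z)"
  obtains E where "E holomorphic_on UNIV" "\<And>z. z \<notin> range t \<Longrightarrow> E z = \<phi> z"
    "\<forall>m H r. 0 < r \<and> H holomorphic_on ball (t m) r \<and> (\<forall>z\<in>ball (t m) r - {t m}. \<phi> z = H z) \<longrightarrow> E (t m) = H (t m)"
proof -
  have lim: "\<phi> \<midarrow>t m\<rightarrow> H (t m) \<and> isolated_singularity_at \<phi> (t m)"
    if "0 < r" "H holomorphic_on ball (t m) r" "\<And>z. z \<in> ball (t m) r - {t m} \<Longrightarrow> \<phi> z = H z" for m H r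
  proof
    have "H \<midarrow>t m\<rightarrow> H (t m)"
      using that(1,2) by (metis centre_in_ball holomorphic_on_imp_continuous_on continuous_on_eq_continuous_at isCont_def open_ball)
    moreover have "\<forall>\<^sub>F z in at (t m). H z = \<phi> z"
      unfolding eventually_at using that by (intro exI[of _ r]) (auto simp: dist_commute)
    ultimately show "\<phi> \<midarrow>t m\<rightarrow> H (t m)" by (rule Lim_transform_eventually)
    have "H holomorphic_on ball (t m) r - {t m}" by (rule holomorphic_on_subset[OF that(2)]) auto
    hence "\<phi> holomorphic_on ball (t m) r - {t m}" by (rule holomorphic_transform) (use that(3) in auto)
    thus "isolated_singularity_at \<phi> (t m)"
      unfolding isolated_singularity_at_def using that(1) by (auto simp: analytic_on_open open_delete intro!: exI[of _ r])
  qed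
  have "remove_sings \<phi> analytic_on {z}" for z
  proof (cases "z \<in> range t")
    case False
    from remove_sings_analytic_on[OF assms(1)[OF this]] show ?thesis .
  next
    case True
    then obtain m where m: "z = t m" by blast
    obtain H r where "0 < r" "H holomorphic_on ball (t m) r" "\<And>z. z \<in> ball (t m) r - {t m} \<Longrightarrow> \<phi> z = H z"
      using assms(2) by blast
    from lim[OF this] show ?thesis unfolding m using remove_sings_analytic_at by blast
  qed
  hence "remove_sings \<phi> analytic_on UNIV" using analytic_on_analytic_at by blast
  hence "remove_sings \<phi> holomorphic_on UNIV" by (rule analytic_imp_holomorphic)
  moreover have "remove_sings \<phi> z = \<phi> z" if "z \<notin> range t" for z
    using assms(1)[OF that] by (rule remove_sings_at_analytic)
  moreover have "remove_sings \<phi> (t m) = H (t m)"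
    if "0 < r" "H holomorphic_on ball (t m) r" "\<forall>z\<in>ball (t m) r - {t m}. \<phi> z = H z" for m H r
    using lim[OF that(1,2) bspec[OF that(3)]] by (intro remove_sings_eqI) blast
  ultimately show ?thesis by (intro that[of "remove_sings \<phi>"]) blast+
qed

theorem square_representation_exists:
  assumes fin: "finite {z. \<not> is_pole f z \<and> f z = 0}"
  obtains g P Q where "square_representation f g P Q"
proof -
  obtain g0 where g0: "g0 holomorphic_on UNIV" "\<And>z. g0 z = 0 \<longleftrightarrow> z \<in> range t" "\<And>z. g0 z = 0 \<Longrightarrow> deriv g0 z \<noteq> 0"
    using simple_zero_function by blast
  have g0_ana: "g0 analytic_on S" for S by (rule entire_imp_analytic[OF g0(1)])
  have loc: "\<exists>H r. 0 < r \<and> H holomorphic_on ball (t m) r \<and> H (t m) \<noteq> 0 \<and> (\<forall>z\<in>ball (t m) r - {t m}. f z * (g0 z)\<^sup>2 = H z)" for m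
  proof -
    obtain H r where H: "0 < r" "H holomorphic_on ball (t m) r"
      "\<And>z. z \<in> ball (t m) r - {t m} \<Longrightarrow> z \<notin> range t \<and> f z = c m / (z - t m)\<^sup>2 + H z"
      by (rule f_local[of m]) (rule that; assumption)
    have z: "g0 (t m) = 0" using g0(2) by blast
    obtain G where G: "G holomorphic_on UNIV" "G (t m) \<noteq> 0" "\<And>z. g0 z = (z - t m) * G z"
      using entire_simple_zero_factor[OF g0(1) z g0(3)[OF z]] by metis
    show ?thesis
    proof (intro exI conjI ballI)
      show "(\<lambda>z. (c m + (z - t m)\<^sup>2 * H z) * (G z)\<^sup>2) holomorphic_on ball (t m) r"
        by (intro holomorphic_intros H(2) holomorphic_on_subset[OF G(1)]) auto
      show "(c m + (t m - t m)\<^sup>2 * H (t m)) * (G (t m))\<^sup>2 \<noteq> 0" using c_nz G(2) by simp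
      fix z assume z: "z \<in> ball (t m) r - {t m}"
      hence "z - t m \<noteq> 0" by auto
      moreover have "f z = c m / (z - t m)\<^sup>2 + H z" using H(3)[OF z] by blast
      ultimately show "f z * (g0 z)\<^sup>2 = (c m + (z - t m)\<^sup>2 * H z) * (G z)\<^sup>2"
        unfolding G(3) by (simp only: double_pole_times_square not_False_eq_True)
    qed (rule H(1))
  qed
  have ana: "(\<lambda>z. f z * (g0 z)\<^sup>2) analytic_on {z}" if "z \<notin> range t" for z
    by (intro analytic_intros f_analytic that g0_ana)
  obtain E where E: "E holomorphic_on UNIV" "\<And>z. z \<notin> range t \<Longrightarrow> E z = f z * (g0 z)\<^sup>2"
    and E_loc: "\<forall>m H r. 0 < r \<and> H holomorphic_on ball (t m) r \<and>
       (\<forall>z\<in>ball (t m) r - {t m}. f z * (g0 z)\<^sup>2 = H z) \<longrightarrow> E (t m) = H (t m)"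
  proof (rule extend_entire[of "\<lambda>z. f z * (g0 z)\<^sup>2", OF ana])
    show "\<exists>H r. 0 < r \<and> H holomorphic_on ball (t m) r \<and> (\<forall>z\<in>ball (t m) r - {t m}. f z * (g0 z)\<^sup>2 = H z)" for m
      using loc[of m] by (elim exE conjE) (intro exI conjI, assumption+)
  qed (assumption, (rule that; assumption))
  have E_pole: "E (t m) \<noteq> 0" for m
  proof -
    obtain H r where H: "0 < r" "H holomorphic_on ball (t m) r" "H (t m) \<noteq> 0"
      "\<forall>z\<in>ball (t m) r - {t m}. f z * (g0 z)\<^sup>2 = H z"
      using loc[of m] by (elim exE conjE)
    have "E (t m) = H (t m)" using E_loc[rule_format, of r H m] H(1,2,4) by blast
    thus ?thesis using H(3) by simp
  qed
  have E_zero: "E z = 0 \<longleftrightarrow> \<not> is_pole f z \<and> f z = 0" for z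
    using E_pole E(2)[of z] g0(2)[of z] unfolding pole_iff by auto
  define Z where "Z = {z. E z = 0}"
  have Z: "finite Z" using fin unfolding Z_def E_zero .
  obtain mu E1 where E1: "E1 holomorphic_on UNIV" "\<And>a. a \<in> Z \<Longrightarrow> E1 a \<noteq> 0"
    "\<And>z. E z = (\<Prod>a\<in>Z. (z - a) ^ mu a) * E1 z"
    using entire_factor_finite[OF E(1) E_pole[of 0] Z] by metis
  have E1_nz: "E1 z \<noteq> 0" for z using E1(2)[of z] E1(3)[of z] by (auto simp: Z_def)
  obtain L where L: "L holomorphic_on UNIV" "\<And>z. exp (L z) = E1 z"
    using holomorphic_logarithm_exists[OF convex_UNIV open_UNIV E1(1), of 0] E1_nz by auto
  define P where "P = (\<Prod>a\<in>Z. [:- a, 1:] ^ mu a)"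
  have P_nz: "P \<noteq> 0" unfolding P_def using Z by (simp add: prod_zero_iff)
  have polyP: "poly P z = (\<Prod>a\<in>Z. (z - a) ^ mu a)" for z
    unfolding P_def by (simp add: poly_prod poly_power)
  \<comment> \<open>With E1 = exp L, the factor exp (-L/2) makes g^2 = g0^2 / E1, so only
    \<open>P\<close> remains in the numerator.\<close>
  define g where "g z = g0 z * exp (- L z / 2)" for z
  have g_hol: "g holomorphic_on UNIV" unfolding g_def by (intro holomorphic_intros g0 L) auto
  have g_zero: "g z = 0 \<longleftrightarrow> z \<in> range t" for z by (simp add: g_def g0)
  have g_simple: "deriv g z \<noteq> 0" if "g z = 0" for z
  proof -
    have z: "g0 z = 0" using that by (simp add: g_def)
    have "((\<lambda>z. exp (- L z / 2)) has_field_derivative exp (- L z / 2) * (- deriv L z / 2)) (at z)"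
      by (auto intro!: derivative_eq_intros holomorphic_derivI[OF L(1)])
    from DERIV_mult[OF holomorphic_derivI[OF g0(1) open_UNIV UNIV_I] this]
    have "deriv g z = deriv g0 z * exp (- L z / 2)"
      unfolding g_def[abs_def] using z by (intro DERIV_imp_deriv) simp
    thus ?thesis using g0(3)[OF z] by simp
  qed
  have f_rep: "f z = poly P z / (g z)\<^sup>2" if "z \<notin> range t" for z
  proof -
    have "exp (- L z / 2) ^ 2 = exp (- L z)" by (simp flip: exp_double)
    hence "exp (- L z / 2) ^ 2 = inverse (E1 z)" by (simp only: exp_minus L(2))
    hence "(g z)\<^sup>2 = (g0 z)\<^sup>2 / E1 z" by (simp only: g_def power_mult_distrib divide_inverse)
    moreover have fE: "f z * (g0 z)\<^sup>2 = poly P z * E1 z" using E(2)[OF that] E1(3)[of z] by (simp add: polyP)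
    moreover have "g0 z \<noteq> 0" using that g0(2) by blast
    hence "f z = poly P z * E1 z / (g0 z)\<^sup>2" using fE by (simp add: nonzero_eq_divide_eq)
    ultimately show ?thesis by simp
  qed
  define N where "N z = poly P z * deriv (deriv g) z - poly (pderiv P) z * deriv g z" for z
  have dg_hol: "deriv g holomorphic_on UNIV" by (intro holomorphic_deriv g_hol) auto
  have ddg_hol: "deriv (deriv g) holomorphic_on UNIV" by (intro holomorphic_deriv dg_hol) auto
  have N_hol: "N holomorphic_on UNIV" unfolding N_def by (intro holomorphic_intros g_hol dg_hol ddg_hol)
  text \<open>The residue of \<open>P / g\<^sup>2\<close> at a simple zero of \<open>g\<close> is \<open>(P' g' - P g'') / g'\<^sup>3\<close>.\<close>
  have N_zero: "N (t m) = 0" for m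
  proof -
    obtain H r where H: "0 < r" "H holomorphic_on ball (t m) r"
      "\<And>z. z \<in> ball (t m) r - {t m} \<Longrightarrow> z \<notin> range t \<and> f z = c m / (z - t m)\<^sup>2 + H z"
      by (rule f_local[of m]) (rule that; assumption)
    have z: "g (t m) = 0" using g_zero by blast
    obtain G where G: "G holomorphic_on UNIV" "G (t m) \<noteq> 0" "\<And>z. g z = (z - t m) * G z"
      using entire_simple_zero_factor[OF g_hol z g_simple[OF z]] by metis
    have dG: "(G has_field_derivative deriv G z) (at z)" for z by (rule holomorphic_derivI[OF G(1)]) auto
    have ddG: "(deriv G has_field_derivative deriv (deriv G) z) (at z)" for z
      by (rule holomorphic_derivI[OF holomorphic_deriv[OF G(1)]]) auto
    \<comment> \<open>Near t_m one has P = f g^2 = \<open>\<phi>\<close>. Since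
      \<open>\<phi>\<close> has no linear term beyond that of c_m G^2, P' = 2 c_m G G' at t_m, while
      g' = G and g'' = 2 G' there.\<close>
    define \<phi> where "\<phi> z = (c m + (z - t m)\<^sup>2 * H z) * (G z)\<^sup>2" for z
    have \<phi>_eq: "poly P z = \<phi> z" if "z \<in> ball (t m) r - {t m}" for z
    proof -
      have "z \<notin> range t" "z - t m \<noteq> 0" using H(3)[OF that] that by auto
      moreover have "g z \<noteq> 0" using g_zero[of z] H(3)[OF that] by blast
      ultimately have "poly P z = f z * (g z)\<^sup>2" using f_rep[of z] by simp
      moreover have "f z = c m / (z - t m)\<^sup>2 + H z" using H(3)[OF that] by blast
      ultimately show ?thesis using \<open>z - t m \<noteq> 0\<close> unfolding \<phi>_def G(3) by (simp only: double_pole_times_square not_False_eq_True)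
    qed
    have "((\<lambda>z. c m + (z - t m)\<^sup>2 * H z) has_field_derivative 0) (at (t m))"
    proof -
      have "((\<lambda>z. (z - t m)\<^sup>2) has_field_derivative 0) (at (t m))" by (auto intro!: derivative_eq_intros)
      from DERIV_mult[OF this holomorphic_derivI[OF H(2) open_ball]] H(1)
      show ?thesis using DERIV_add[OF DERIV_const] by fastforce
    qed
    from DERIV_mult[OF this DERIV_power[OF dG, of 2]]
    have d\<phi>: "(\<phi> has_field_derivative c m * (2 * G (t m) * deriv G (t m))) (at (t m))"
      unfolding \<phi>_def[abs_def] by (simp add: mult_ac)
    have P_tm: "poly P (t m) = \<phi> (t m)"
    proof (rule LIM_unique)
      show "poly P \<midarrow>t m\<rightarrow> poly P (t m)" by (intro tendsto_intros)
      have "\<phi> \<midarrow>t m\<rightarrow> \<phi> (t m)" using d\<phi> DERIV_isCont isCont_def by blast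
      moreover have "\<forall>\<^sub>F z in at (t m). \<phi> z = poly P z"
        unfolding eventually_at using H(1) \<phi>_eq by (intro exI[of _ r]) (auto simp: dist_commute)
      ultimately show "poly P \<midarrow>t m\<rightarrow> \<phi> (t m)" by (rule Lim_transform_eventually)
    qed
    have all: "\<phi> x = poly P x" if "x \<in> ball (t m) r" for x
      using P_tm \<phi>_eq[of x] that by (cases "x = t m") simp_all
    have "(poly P has_field_derivative c m * (2 * G (t m) * deriv G (t m))) (at (t m))"
      by (rule has_field_derivative_transform_within_open[OF d\<phi>, where S = "ball (t m) r"])
         (use H(1) all in auto)
    hence P': "poly (pderiv P) (t m) = c m * (2 * G (t m) * deriv G (t m))"
      using poly_DERIV DERIV_unique by blast
    have g_fun: "g = (\<lambda>z. (z - t m) * G z)" using G(3) by auto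
    have dg: "deriv g z = G z + (z - t m) * deriv G z" for z
      unfolding g_fun
      by (rule DERIV_imp_deriv, rule DERIV_cong[OF DERIV_mult[OF DERIV_diff[OF DERIV_ident DERIV_const] dG]]) simp
    have "deriv (deriv g) (t m) = 2 * deriv G (t m)"
    proof -
      have "deriv g = (\<lambda>z. G z + (z - t m) * deriv G z)" using dg by auto
      moreover have "((\<lambda>z. G z + (z - t m) * deriv G z) has_field_derivative 2 * deriv G (t m)) (at (t m))"
        by (rule DERIV_cong[OF DERIV_add[OF dG DERIV_mult[OF DERIV_diff[OF DERIV_ident DERIV_const] ddG]]]) simp
      ultimately show ?thesis by (simp add: DERIV_imp_deriv)
    qed
    thus ?thesis unfolding N_def P' P_tm \<phi>_def dg by (simp add: power2_eq_square)
  qed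
  have N_loc: "\<exists>H r. 0 < r \<and> H holomorphic_on ball (t m) r \<and> (\<forall>z\<in>ball (t m) r - {t m}. - N z / g z = H z)" for m
  proof -
    have z: "g (t m) = 0" using g_zero by blast
    obtain G where G: "G holomorphic_on UNIV" "G (t m) \<noteq> 0" "\<And>z. g z = (z - t m) * G z"
      using entire_simple_zero_factor[OF g_hol z g_simple[OF z]] by metis
    have "open (G -` (- {0}))"
      by (rule open_vimage[OF _ holomorphic_on_imp_continuous_on[OF G(1)]]) auto
    then obtain r where r: "0 < r" "ball (t m) r \<subseteq> G -` (- {0})"
      using G(2) open_contains_ball by (metis ComplI singletonD vimageI)
    \<comment> \<open>\<open>N\<close> vanishes at t_m, so N = (z - t_m) N1, and the factor cancels
      against the one in \<open>g\<close>.\<close>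
    define N1 where "N1 z = (if z = t m then deriv N (t m) else (N z - N (t m)) / (z - t m))" for z
    have N1: "N1 holomorphic_on UNIV" unfolding N1_def
      by (rule pole_lemma_open[OF N_hol open_UNIV])
    show ?thesis
    proof (intro exI conjI ballI)
      show "(\<lambda>z. - N1 z / G z) holomorphic_on ball (t m) r"
        by (intro holomorphic_intros holomorphic_on_subset[OF N1] holomorphic_on_subset[OF G(1)]) (use r in auto)
      fix z assume "z \<in> ball (t m) r - {t m}"
      thus "- N z / g z = - N1 z / G z" unfolding G(3) by (simp add: N1_def N_zero)
    qed (rule r(1))
  qed
  have N_ana: "(\<lambda>z. - N z / g z) analytic_on {z}" if "z \<notin> range t" for z
  proof -
    have "N analytic_on {z}" "g analytic_on {z}"
      by (rule entire_imp_analytic[OF N_hol] entire_imp_analytic[OF g_hol])+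
    thus ?thesis using that g_zero by (intro analytic_intros) auto
  qed
  obtain Q where Q: "Q holomorphic_on UNIV" "\<And>z. z \<notin> range t \<Longrightarrow> Q z = - N z / g z"
    by (rule extend_entire[of "\<lambda>z. - N z / g z", OF N_ana N_loc]) (assumption, (rule that; assumption))
  have "square_representation f g P Q"
    unfolding square_representation_def pole_iff
  proof (intro conjI allI impI)
    fix z
    show "poly P z * deriv (deriv g) z - poly (pderiv P) z * deriv g z + Q z * g z = 0"
    proof (cases "z \<in> range t")
      case True
      thus ?thesis using N_zero g_zero[of z] by (auto simp: N_def)
    next
      case False
      hence "Q z * g z = - N z" using Q(2) g_zero[of z] by simp
      thus ?thesis by (simp add: N_def)
    qed
  qed (use g_hol Q P_nz g_zero g_simple f_rep in auto)
  thus ?thesis by (rule that)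
qed

end

section \<open>Asymptotics and the second solution\<close>

lemma one_plus_ln_over_powr:
  fixes a :: real
  assumes "0 < a"
  shows "((\<lambda>r. (1 + ln r) / r powr a) \<longlongrightarrow> 0) at_top"
proof (rule tendsto_sandwich[where f = "\<lambda>_. 0" and h = "\<lambda>r. r powr (- a) + 2 / a * r powr (- (a / 2))"])
  have "((\<lambda>r. r powr (- a) + 2 / a * r powr (- (a / 2))) \<longlongrightarrow> 0 + 2 / a * 0) at_top"
    using assms by (intro tendsto_add tendsto_mult_left tendsto_neg_powr filterlim_ident) auto
  thus "((\<lambda>r. r powr (- a) + 2 / a * r powr (- (a / 2))) \<longlongrightarrow> 0) at_top" by simp
  show "\<forall>\<^sub>F r in at_top. 0 \<le> (1 + ln r) / r powr a"
    using eventually_ge_at_top[of 1] by eventually_elim simp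
  show "\<forall>\<^sub>F r in at_top. (1 + ln r) / r powr a \<le> r powr (- a) + 2 / a * r powr (- (a / 2))"
    using eventually_ge_at_top[of 1]
  proof eventually_elim
    case (elim r)
    have "ln r \<le> r powr (a / 2) / (a / 2)" using elim assms by (intro ln_powr_bound) auto
    hence "(1 + ln r) * r powr (- a) \<le> (1 + r powr (a / 2) / (a / 2)) * r powr (- a)"
      by (intro mult_right_mono) auto
    also have "\<dots> = r powr (- a) + 2 / a * (r powr (a / 2) * r powr (- a))"
      using assms by (simp add: field_simps)
    also have "r powr (a / 2) * r powr (- a) = r powr (- (a / 2))"
      by (simp flip: powr_add)
    moreover have "(1 + ln r) / r powr a = (1 + ln r) * r powr (- a)" by (simp add: powr_minus_divide)
    ultimately show ?case by (simp only:)
  qed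
qed auto

lemma order_of_powr_asymp:
  assumes "((\<lambda>r. T r / r powr a) \<longlongrightarrow> \<tau>) at_top" "0 < \<tau>" "0 < a"
  shows "((\<lambda>r. ereal (ln (T r) / ln r)) \<longlongrightarrow> ereal a) at_top"
proof -
  have ln_inf: "filterlim (ln :: real \<Rightarrow> real) at_infinity at_top"
    by (rule filterlim_at_top_imp_at_infinity[OF ln_at_top])
  have "((\<lambda>r. ln (T r / r powr a)) \<longlongrightarrow> ln \<tau>) at_top"
    using assms by (intro tendsto_ln) auto
  hence "((\<lambda>r. ln (T r / r powr a) / ln r + a) \<longlongrightarrow> 0 + a) at_top"
    by (intro tendsto_add tendsto_const tendsto_divide_0[OF _ ln_inf])
  moreover have "\<forall>\<^sub>F r in at_top. ln (T r / r powr a) / ln r + a = ln (T r) / ln r"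
    using order_tendstoD(1)[OF assms(1,2)] eventually_gt_at_top[of 1]
  proof eventually_elim
    case (elim r)
    have "T r \<noteq> 0" using elim by auto
    hence "ln (T r / r powr a) = ln (T r) - a * ln r" using elim by (simp add: ln_div ln_powr)
    thus ?case using elim by (simp add: field_simps)
  qed
  ultimately have "((\<lambda>r. ln (T r) / ln r) \<longlongrightarrow> 0 + a) at_top" by (rule Lim_transform_eventually)
  thus ?thesis by simp
qed

context poly_ode_irregular
begin

lemma \<rho>_powr_infinity: "filterlim (\<lambda>r. r powr \<rho>) at_top at_top"
  using filterlim_scaled_powr[of 1] by simp

text \<open>The upper bound is \<open>growth_bound\<close>, the lower bound a dominant central ray;
  both have the rate sqrt |K|.\<close>

lemma max_modulus_asymp:
  assumes g: "solution g" and \<beta>: "\<beta> ^ n * K = 1" "dominant_on g (Arg \<beta>)"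
  shows "((\<lambda>r. ln (max_modulus g r) / r powr \<rho>) \<longlongrightarrow> sqrt (cmod K)) at_top"
proof (rule tendstoI)
  fix d :: real assume d: "0 < d"
  define k where "k = sqrt (cmod K)"
  have k: "0 < k" using K_nz by (simp add: k_def)
  have lim: "((\<lambda>r. ln (cmod (g (of_real r * cis (Arg \<beta>)))) / r powr \<rho>) \<longlongrightarrow> k) at_top"
    using \<beta>(2) unfolding dominant_on_def dominant_on_central(1)[OF \<beta>(1)] k_def .
  \<comment> \<open>Spends d / 3 on the factor 1 + e; another d / 3 goes to ln C.\<close>
  define e where "e = d / (3 * k)"
  have e: "0 < e" using d k by (simp add: e_def)
  obtain C r0 where C: "0 < C" "1 \<le> r0"
    "\<And>z. r0 \<le> cmod z \<Longrightarrow> cmod (g z) \<le> C * exp ((1 + e) * sqrt (cmod K) * cmod z powr \<rho>)"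
    using growth_bound[OF g e] by metis
  have cont: "continuous_on S g" for S
    using solution_entire[OF g] holomorphic_on_imp_continuous_on holomorphic_on_subset by blast
  have bdd: "bdd_above ((\<lambda>z. norm (g z)) ` sphere 0 r)" for r
    by (intro bounded_imp_bdd_above compact_imp_bounded compact_continuous_image continuous_intros cont) auto
  have "((\<lambda>r. ln C / r powr \<rho>) \<longlongrightarrow> 0) at_top"
    by (intro tendsto_divide_0[OF tendsto_const] filterlim_at_top_imp_at_infinity \<rho>_powr_infinity)
  hence "\<forall>\<^sub>F r in at_top. ln C / r powr \<rho> < d / 3" by (rule order_tendstoD) (use d in simp)
  moreover have "\<forall>\<^sub>F r in at_top. max (k / 2) (k - d) < ln (cmod (g (of_real r * cis (Arg \<beta>)))) / r powr \<rho>"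
    by (rule order_tendstoD(1)[OF lim]) (use k d in auto)
  ultimately show "\<forall>\<^sub>F r in at_top. dist (ln (max_modulus g r) / r powr \<rho>) (sqrt (cmod K)) < d"
    using eventually_ge_at_top[of r0]
  proof eventually_elim
    case (elim r)
    have r: "1 \<le> r" "0 < r" "0 < r powr \<rho>" using elim C by auto
    define x where "x = cmod (g (of_real r * cis (Arg \<beta>)))"
    have "0 < ln x / r powr \<rho>" using elim(2) k unfolding x_def by linarith
    hence "0 < ln x" using r by (simp add: zero_less_divide_iff)
    hence x: "0 < x" by (cases "x = 0") (auto simp: x_def)
    have "x \<le> max_modulus g r"
      unfolding x_def max_modulus_def using r by (intro cSUP_upper bdd) (auto simp: norm_mult)
    hence "ln x \<le> ln (max_modulus g r)" using x by (intro ln_mono) auto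
    hence "ln x / r powr \<rho> \<le> ln (max_modulus g r) / r powr \<rho>" using r by (intro divide_right_mono) auto
    hence low: "k - d < ln (max_modulus g r) / r powr \<rho>" using elim(2) unfolding x_def by linarith
    have M0: "0 < max_modulus g r" using \<open>x \<le> max_modulus g r\<close> x by linarith
    have "max_modulus g r \<le> C * exp ((1 + e) * k * r powr \<rho>)"
      unfolding max_modulus_def
    proof (rule cSUP_least)
      show "sphere 0 r \<noteq> ({} :: complex set)" using r by simp
      fix z :: complex assume "z \<in> sphere 0 r"
      thus "norm (g z) \<le> C * exp ((1 + e) * k * r powr \<rho>)" using C(3)[of z] elim by (simp add: k_def)
    qed
    hence "ln (max_modulus g r) \<le> ln (C * exp ((1 + e) * k * r powr \<rho>))" using M0 by (intro ln_mono) auto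
    also have "\<dots> = ln C + (1 + e) * k * r powr \<rho>" using C by (simp add: ln_mult)
    finally have "ln (max_modulus g r) / r powr \<rho> \<le> (ln C + (1 + e) * k * r powr \<rho>) / r powr \<rho>"
      using r by (intro divide_right_mono) auto
    also have "\<dots> = ln C / r powr \<rho> + k + e * k" using r by (simp add: add_divide_distrib distrib_right)
    also have "e * k = d / 3" using k by (simp add: e_def)
    finally have "ln (max_modulus g r) / r powr \<rho> < k + d" using elim(1) d by linarith
    with low show ?case unfolding k_def dist_real_def by linarith
  qed
qed

end

section \<open>The second solution and the case of one sector\<close>

context double_pole_series
begin

text \<open>Reduction of order: g (F - a) has the Wronskian g^2 f = P with \<open>g\<close>, as
  Abel's formula demands. The simple zeros of \<open>g\<close> cancel the simple poles of
  \<open>F\<close>, so the product extends to an entire function.\<close>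

lemma second_solution:
  assumes sr: "square_rep f g P Q"
    and F: "\<And>z. z \<notin> range t \<Longrightarrow> (F has_field_derivative f z) (at z)"
    and F_loc: "\<And>m. \<exists>H r. 0 < r \<and> H holomorphic_on ball (t m) r \<and>
        (\<forall>z\<in>ball (t m) r - {t m}. z \<notin> range t \<and> F z = H z - c m / (z - t m))"
  obtains h where "h holomorphic_on UNIV" "\<exists>z. h z \<noteq> 0"
    "\<And>z. poly P z * deriv (deriv h) z - poly (pderiv P) z * deriv h z + Q z * h z = 0"
    "\<And>z. z \<notin> range t \<Longrightarrow> h z = g z * (F z - a)"
proof -
  interpret S: square_rep f g P Q by (rule sr)
  have g_zero: "g z = 0 \<longleftrightarrow> z \<in> range t" for z using S.pole_iff pole_iff by blast
  have op: "open (- range t)" using closed_subset_range[of UNIV] by auto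
  have F_hol: "F holomorphic_on (- range t)" unfolding holomorphic_on_open[OF op] using F by blast
  have loc: "\<exists>H r. 0 < r \<and> H holomorphic_on ball (t m) r \<and> (\<forall>z\<in>ball (t m) r - {t m}. g z * (F z - a) = H z)" for m
  proof -
    obtain H r where H: "0 < r" "H holomorphic_on ball (t m) r"
      "\<And>z. z \<in> ball (t m) r - {t m} \<Longrightarrow> F z = H z - c m / (z - t m)"
      using F_loc[of m] by blast
    have z: "g (t m) = 0" using g_zero by blast
    obtain G where G: "G holomorphic_on UNIV" "G (t m) \<noteq> 0" "\<And>z. g z = (z - t m) * G z"
      using entire_simple_zero_factor[OF S.g_hol z S.simple[OF z]] by metis
    show ?thesis
    proof (intro exI conjI ballI)
      show "(\<lambda>z. (z - t m) * G z * (H z - a) - c m * G z) holomorphic_on ball (t m) r"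
        by (intro holomorphic_intros H(2) holomorphic_on_subset[OF G(1)]) auto
      fix z assume z: "z \<in> ball (t m) r - {t m}"
      hence "z - t m \<noteq> 0" by auto
      moreover have "v * x * (y - k / v - a) = v * x * (y - a) - k * x" if "v \<noteq> 0" for v x y k :: complex
        using that by (simp add: field_simps)
      ultimately show "g z * (F z - a) = (z - t m) * G z * (H z - a) - c m * G z"
        unfolding H(3)[OF z] G(3) by blast
    qed (rule H(1))
  qed
  have ana: "(\<lambda>z. g z * (F z - a)) analytic_on {z}" if "z \<notin> range t" for z
  proof -
    have "F analytic_on {z}" using F_hol op that by (metis ComplI analytic_at)
    moreover have "g analytic_on {z}" by (rule entire_imp_analytic[OF S.g_hol])
    ultimately show ?thesis by (intro analytic_intros)
  qed
  obtain h where h: "h holomorphic_on UNIV" "\<And>z. z \<notin> range t \<Longrightarrow> h z = g z * (F z - a)"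
    by (rule extend_entire[of "\<lambda>z. g z * (F z - a)", OF ana loc]) (assumption, (rule that; assumption))
  have dg: "(g has_field_derivative deriv g z) (at z)" for z by (rule holomorphic_derivI[OF S.g_hol]) auto
  have dg_hol: "deriv g holomorphic_on UNIV" by (intro holomorphic_deriv S.g_hol) auto
  have ddg: "(deriv g has_field_derivative deriv (deriv g) z) (at z)" for z by (rule holomorphic_derivI[OF dg_hol]) auto
  have dh: "deriv h z = deriv g z * (F z - a) + poly P z / g z" if z: "z \<notin> range t" for z
  proof -
    have gz: "g z \<noteq> 0" using z g_zero by blast
    have "((\<lambda>z. g z * (F z - a)) has_field_derivative (deriv g z * (F z - a) + f z * g z)) (at z)"
      by (rule DERIV_cong[OF DERIV_mult[OF dg DERIV_diff[OF F[OF z] DERIV_const]]]) simp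
    hence "(h has_field_derivative (deriv g z * (F z - a) + f z * g z)) (at z)"
      by (rule has_field_derivative_transform_within_open[OF _ op]) (use z h(2) in auto)
    moreover have "f z * g z = poly P z / g z" using S.f_eq[OF gz] gz by (simp add: power2_eq_square)
    ultimately show ?thesis by (simp add: DERIV_imp_deriv)
  qed
  have ddh: "deriv (deriv h) z = deriv (deriv g) z * (F z - a) + poly (pderiv P) z / g z" if z: "z \<notin> range t" for z
  proof -
    have gz: "g z \<noteq> 0" using z g_zero by blast
    have "((\<lambda>z. deriv g z * (F z - a) + poly P z / g z) has_field_derivative
       (deriv (deriv g) z * (F z - a) + (f z - 0) * deriv g z) + (poly (pderiv P) z * g z - poly P z * deriv g z) / (g z * g z)) (at z)"
      by (intro DERIV_add DERIV_mult ddg DERIV_diff F z DERIV_const DERIV_divide poly_DERIV dg gz)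
    hence "(deriv h has_field_derivative
       (deriv (deriv g) z * (F z - a) + (f z - 0) * deriv g z) + (poly (pderiv P) z * g z - poly P z * deriv g z) / (g z * g z)) (at z)"
      by (rule has_field_derivative_transform_within_open[OF _ op]) (use z dh in auto)
    hence "deriv (deriv h) z = deriv (deriv g) z * (F z - a) + (f z * deriv g z + (poly (pderiv P) z * g z - poly P z * deriv g z) / (g z * g z))"
      by (simp add: DERIV_imp_deriv)
    also have "f z * deriv g z + (poly (pderiv P) z * g z - poly P z * deriv g z) / (g z * g z) = poly (pderiv P) z / g z"
      unfolding S.f_eq[OF gz] using gz by (simp add: field_simps power2_eq_square)
    finally show ?thesis .
  qed
  define D where "D z = poly P z * deriv (deriv h) z - poly (pderiv P) z * deriv h z + Q z * h z" for z
  have D0: "D z = 0" if z: "z \<notin> range t" for z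
  proof -
    have gz: "g z \<noteq> 0" using z g_zero by blast
    have "D z = (F z - a) * (poly P z * deriv (deriv g) z - poly (pderiv P) z * deriv g z + Q z * g z)"
      unfolding D_def dh[OF z] ddh[OF z] h(2)[OF z] by (simp add: algebra_simps)
    thus ?thesis using S.ode[of z] by simp
  qed
  have D_hol: "D holomorphic_on UNIV"
  proof -
    have h1: "deriv h holomorphic_on UNIV" by (intro holomorphic_deriv h) auto
    have h2: "deriv (deriv h) holomorphic_on UNIV" by (intro holomorphic_deriv h1) auto
    show ?thesis unfolding D_def by (intro holomorphic_intros h1 h2 h S.Q_hol)
  qed
  \<comment> \<open>The equation extends to the poles by continuity.\<close>
  have D: "D z = 0" for z
  proof (rule LIM_unique)
    show "D \<midarrow>z\<rightarrow> D z" using D_hol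
      by (metis UNIV_I holomorphic_on_imp_continuous_on continuous_on_eq_continuous_at isCont_def open_UNIV)
    have "\<forall>\<^sub>F w in at z. D w = 0"
      using S.g_ev_nonzero[of z] by eventually_elim (use D0 g_zero in blast)
    thus "D \<midarrow>z\<rightarrow> 0" by (rule tendsto_eventually)
  qed
  \<comment> \<open>Otherwise \<open>F\<close> would be constant and \<open>P\<close> would vanish
    outside a countable set.\<close>
  have "\<exists>z. h z \<noteq> 0"
  proof (rule ccontr)
    assume "\<nexists>z. h z \<noteq> 0"
    hence Fa: "F z = a" if "z \<notin> range t" for z using h(2)[OF that] g_zero[of z] that by auto
    have P0: "poly P z = 0" if z: "z \<notin> range t" for z
    proof -
      have "((\<lambda>_. a) has_field_derivative f z) (at z)"
        by (rule has_field_derivative_transform_within_open[OF F[OF z] op]) (use z Fa in auto)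
      hence "f z = 0" using DERIV_const DERIV_unique by blast
      thus ?thesis using S.f_eq[of z] g_zero[of z] z by auto
    qed
    have "countable (range t \<union> {z. poly P z = 0})"
      using poly_roots_finite[OF S.P_nz] by (intro countable_Un) (auto simp: countable_finite)
    hence "range t \<union> {z. poly P z = 0} \<noteq> UNIV" using uncountable_UNIV_complex by metis
    thus False using P0 by blast
  qed
  thus ?thesis using h D that unfolding D_def by blast
qed

text \<open>If \<open>deg P = deg R + 1\<close>, there is a single sector, and the solution \<open>g (F - a)\<close>, with \<open>a\<close> the limit
  of the primitive \<open>F\<close> of \<open>f\<close> in the central direction, is recessive there.\<close>

lemma degree_P_neq_Suc_degree_R:
  assumes sr: "square_rep f g P (poly R)" and irr: "poly_ode_irregular P R"
  shows "degree P \<noteq> degree R + 1"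
proof
  assume one: "degree P = degree R + 1"
  interpret S: square_rep f g P "poly R" by (rule sr)
  interpret I: poly_ode_irregular P R by (rule irr)
  have n1: "I.n = 1" using one by (simp add: I.n_def)
  have g_zero: "g z = 0 \<longleftrightarrow> z \<in> range t" for z using S.pole_iff pole_iff by blast
  have solg: "I.solution g" unfolding I.solution_def using S.g_hol S.g_nonzero S.ode by blast
  obtain \<beta> where \<beta>: "\<beta> ^ I.n * I.K = 1" "I.dominant_on g (Arg \<beta>)"
    using I.proximity_asymp[OF solg] by metis
  obtain F where F: "\<And>z. z \<notin> range t \<Longrightarrow> (F has_field_derivative f z) (at z)"
    and F_loc: "\<And>m. \<exists>H r. 0 < r \<and> H holomorphic_on ball (t m) r \<and>
        (\<forall>z\<in>ball (t m) r - {t m}. z \<notin> range t \<and> F z = H z - c m / (z - t m))"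
    using primitive_exists by blast
  define k where "k = sqrt (cmod I.K)"
  have k: "0 < k" using I.K_nz by (simp add: k_def)
  define \<rho> where "\<rho> = I.\<rho>"
  have \<rho>: "0 < \<rho>" using I.\<rho>_pos by (simp add: \<rho>_def)
  define z where "z r = of_real r * cis (Arg \<beta>)" for r :: real
  have cz: "cmod (z r) = \<bar>r\<bar>" for r by (simp add: z_def norm_mult)
  have dom: "((\<lambda>r. ln (cmod (u (z r))) / r powr \<rho>) \<longlongrightarrow> k) at_top" if "I.dominant_on u (Arg \<beta>)" for u
    using that unfolding I.dominant_on_def I.dominant_on_central(1)[OF \<beta>(1)] k_def z_def \<rho>_def .
  have inf: "filterlim (\<lambda>r. r powr \<rho>) at_infinity at_top"
    unfolding \<rho>_def by (rule filterlim_at_top_imp_at_infinity[OF I.\<rho>_powr_infinity])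
  obtain CP rP where CP: "1 \<le> rP" "0 \<le> CP"
    "\<And>z. rP \<le> cmod z \<Longrightarrow> poly P z \<noteq> 0 \<and> \<bar>ln (cmod (poly P z))\<bar> \<le> CP * (1 + ln (cmod z))"
    using S.cmod_P_circle by metis
  \<comment> \<open>With this factor the bound for |f| is exactly the derivative of
    \<open>\<psi>\<close> below.\<close>
  define q where "q = 3/2 * k * \<rho>"
  have q: "0 < q" using k \<rho> by (simp add: q_def)
  have "((\<lambda>r. (CP + 1) * ((1 + ln r) / r powr \<rho>) - ln q / r powr \<rho>) \<longlongrightarrow> (CP + 1) * 0 - 0) at_top"
    by (intro tendsto_diff tendsto_mult_left one_plus_ln_over_powr \<rho> tendsto_divide_0[OF tendsto_const inf])
  hence "\<forall>\<^sub>F r in at_top. (CP + 1) * ((1 + ln r) / r powr \<rho>) - ln q / r powr \<rho> < 3/10 * k"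
    by (rule order_tendstoD) (use k in simp)
  \<comment> \<open>The margins fix the rates: |f| decays at 3/2 k, as 2 * 9/10 - 3/10 = 3/2, and
    this beats the growth of |g|, as 11/10 < 3/2.\<close>
  moreover have "\<forall>\<^sub>F r in at_top. 9/10 * k < ln (cmod (g (z r))) / r powr \<rho>"
    by (rule order_tendstoD(1)[OF dom[OF \<beta>(2)]]) (use k in simp)
  moreover have "\<forall>\<^sub>F r in at_top. ln (cmod (g (z r))) / r powr \<rho> < 11/10 * k"
    by (rule order_tendstoD(2)[OF dom[OF \<beta>(2)]]) (use k in simp)
  ultimately have "\<forall>\<^sub>F r in at_top. (CP + 1) * ((1 + ln r) / r powr \<rho>) - ln q / r powr \<rho> < 3/10 * k \<and>
     9/10 * k < ln (cmod (g (z r))) / r powr \<rho> \<and> ln (cmod (g (z r))) / r powr \<rho> < 11/10 * k"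
    by eventually_elim simp
  then obtain r1 where r1: "\<And>r. r1 \<le> r \<Longrightarrow> (CP + 1) * ((1 + ln r) / r powr \<rho>) - ln q / r powr \<rho> < 3/10 * k \<and>
     9/10 * k < ln (cmod (g (z r))) / r powr \<rho> \<and> ln (cmod (g (z r))) / r powr \<rho> < 11/10 * k"
    unfolding eventually_at_top_linorder by blast
  define r0 where "r0 = max rP r1"
  have est: "g (z r) \<noteq> 0" "cmod (g (z r)) \<le> exp (11/10 * k * r powr \<rho>)"
      "cmod (f (z r)) \<le> q * r powr (\<rho> - 1) * exp (- (3/2 * k) * r powr \<rho>)" if r: "r0 \<le> r" for r
  proof -
    have rr: "1 \<le> r" "rP \<le> r" "r1 \<le> r" using r CP by (auto simp: r0_def)
    have rp: "0 < r powr \<rho>" using rr by simp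
    define x where "x = cmod (g (z r))"
    have b: "9/10 * k * r powr \<rho> < ln x" "ln x < 11/10 * k * r powr \<rho>"
      using r1[OF rr(3)] rp unfolding x_def by (auto simp: pos_less_divide_eq pos_divide_less_eq)
    have "0 < 9/10 * k * r powr \<rho>" using k rp by simp
    hence x: "0 < x" using b(1) by (cases "x = 0") (auto simp: x_def)
    thus gz: "g (z r) \<noteq> 0" by (auto simp: x_def)
    have "x = exp (ln x)" using x by simp
    also have "\<dots> \<le> exp (11/10 * k * r powr \<rho>)" using b(2) by (subst exp_le_cancel_iff) linarith
    finally show "cmod (g (z r)) \<le> exp (11/10 * k * r powr \<rho>)" by (simp add: x_def)
    define y where "y = cmod (poly P (z r))"
    have y: "0 < y" "ln y \<le> CP * (1 + ln r)"
      using CP(3)[of "z r"] rr cz[of r] by (auto simp: y_def)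
    have "(CP + 1) * (1 + ln r) - ln q < 3/10 * k * r powr \<rho>"
    proof -
      have "((CP + 1) * (1 + ln r) - ln q) / r powr \<rho> < 3/10 * k"
        using r1[OF rr(3)] by (simp add: diff_divide_distrib)
      thus ?thesis using rp by (simp add: pos_divide_less_eq)
    qed
    moreover have "ln r * (1 - \<rho>) \<le> 1 + ln r"
    proof -
      have "0 \<le> ln r * \<rho>" using rr \<rho> by simp
      thus ?thesis by (simp add: right_diff_distrib)
    qed
    ultimately have "ln y - 2 * ln x \<le> ln q + (\<rho> - 1) * ln r + - (3/2 * k) * r powr \<rho>"
      using y(2) b(1) by (simp add: algebra_simps)
    hence "exp (ln y - 2 * ln x) \<le> exp (ln q + (\<rho> - 1) * ln r + - (3/2 * k) * r powr \<rho>)" by simp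
    moreover have "exp (ln y - 2 * ln x) = y / x\<^sup>2"
      using x y by (simp add: exp_diff exp_double)
    moreover have "exp (ln q + (\<rho> - 1) * ln r + - (3/2 * k) * r powr \<rho>) = q * r powr (\<rho> - 1) * exp (- (3/2 * k) * r powr \<rho>)"
      using q rr by (simp only: exp_add) (simp add: powr_def)
    moreover have "cmod (f (z r)) = y / x\<^sup>2" unfolding S.f_eq[OF gz] by (simp add: x_def y_def norm_divide norm_power)
    ultimately show "cmod (f (z r)) \<le> q * r powr (\<rho> - 1) * exp (- (3/2 * k) * r powr \<rho>)" by simp
  qed
  define \<psi> where "\<psi> r = - exp (- (3/2 * k) * r powr \<rho>)" for r
  define \<phi> where "\<phi> r = F (z r)" for r
  have r0: "1 \<le> r0" using CP by (simp add: r0_def)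
  have d\<phi>: "(\<phi> has_vector_derivative cis (Arg \<beta>) * f (z r)) (at r)" if "r0 \<le> r" for r
  proof -
    have "(z has_vector_derivative cis (Arg \<beta>)) (at r)"
      unfolding z_def[abs_def] by (auto intro!: derivative_eq_intros simp: has_vector_derivative_def scaleR_conv_of_real)
    moreover have "z r \<notin> range t" using est(1)[OF that] g_zero by blast
    ultimately show ?thesis
      using field_vector_diff_chain_at[OF _ F] unfolding \<phi>_def[abs_def] o_def by blast
  qed
  have d\<psi>: "(\<psi> has_vector_derivative q * r powr (\<rho> - 1) * exp (- (3/2 * k) * r powr \<rho>)) (at r)" if "r0 \<le> r" for r
  proof -
    have "0 < r" using that r0 by linarith
    have "((\<lambda>r. r powr \<rho>) has_real_derivative \<rho> * r powr (\<rho> - 1)) (at r)"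
      by (rule has_real_derivative_powr[OF \<open>0 < r\<close>])
    from DERIV_minus[OF DERIV_chain2[OF DERIV_exp DERIV_cmult[OF this, of "- (3/2 * k)"]]]
    have "(\<psi> has_real_derivative q * r powr (\<rho> - 1) * exp (- (3/2 * k) * r powr \<rho>)) (at r)"
      unfolding \<psi>_def[abs_def] by (rule DERIV_cong) (simp add: q_def)
    thus ?thesis by (simp add: has_real_derivative_iff_has_vector_derivative)
  qed
  have incr: "cmod (\<phi> s - \<phi> r) \<le> exp (- (3/2 * k) * r powr \<rho>)" if rs: "r0 \<le> r" "r < s" for r s
  proof -
    have "norm (\<phi> s - \<phi> r) \<le> \<psi> s - \<psi> r"
    proof (rule differentiable_bound_general[OF rs(2)])
      show "continuous_on {r..s} \<phi>" using rs
        by (intro continuous_at_imp_continuous_on ballI has_vector_derivative_continuous[OF d\<phi>]) auto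
      show "continuous_on {r..s} \<psi>" using rs
        by (intro continuous_at_imp_continuous_on ballI has_vector_derivative_continuous[OF d\<psi>]) auto
      fix x assume x: "r < x" "x < s"
      have x0: "r0 \<le> x" using x rs by linarith
      show "(\<phi> has_vector_derivative cis (Arg \<beta>) * f (z x)) (at x)" by (rule d\<phi>[OF x0])
      show "(\<psi> has_vector_derivative q * x powr (\<rho> - 1) * exp (- (3/2 * k) * x powr \<rho>)) (at x)" by (rule d\<psi>[OF x0])
      show "norm (cis (Arg \<beta>) * f (z x)) \<le> q * x powr (\<rho> - 1) * exp (- (3/2 * k) * x powr \<rho>)"
        using est(3)[OF x0] by (simp add: norm_mult)
    qed
    thus ?thesis by (simp add: \<psi>_def) (smt (verit) exp_ge_zero)
  qed
  have decay: "((\<lambda>r. exp (- (3/2 * k) * r powr \<rho>)) \<longlongrightarrow> 0) at_top"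
    using k I.\<rho>_powr_infinity unfolding \<rho>_def
    by (intro filterlim_compose[OF exp_at_bot] filterlim_tendsto_neg_mult_at_bot[OF tendsto_const]) auto
  \<comment> \<open>The integers suffice to obtain the limit \<open>a\<close>; \<open>close\<close>
    then covers all large radii.\<close>
  have "Cauchy (\<lambda>i. \<phi> (real i))"
  proof (rule metric_CauchyI)
    fix e :: real assume e: "0 < e"
    have "\<forall>\<^sub>F r in at_top. exp (- (3/2 * k) * r powr \<rho>) < e / 2" using decay by (rule order_tendstoD) (use e in simp)
    then obtain b where b: "\<And>r. b \<le> r \<Longrightarrow> exp (- (3/2 * k) * r powr \<rho>) < e / 2"
      unfolding eventually_at_top_linorder by blast
    obtain M :: nat where M: "max b r0 \<le> real M" using real_arch_simple by blast
    have "dist (\<phi> (real i)) (\<phi> (real M)) < e / 2" if "M \<le> i" for i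
    proof (cases "i = M")
      case True
      thus ?thesis using e by simp
    next
      case False
      hence "real M < real i" using that by simp
      from incr[OF _ this] M b[of "real M"] show ?thesis by (simp add: dist_norm)
    qed
    hence "\<forall>i\<ge>M. \<forall>j\<ge>M. dist (\<phi> (real i)) (\<phi> (real j)) < e"
      by (meson dist_triangle_half_l dist_commute)
    thus "\<exists>M. \<forall>i\<ge>M. \<forall>j\<ge>M. dist (\<phi> (real i)) (\<phi> (real j)) < e" by blast
  qed
  then obtain a where a: "(\<lambda>i. \<phi> (real i)) \<longlonglongrightarrow> a" using Cauchy_convergent convergent_def by blast
  have close: "cmod (\<phi> r - a) \<le> exp (- (3/2 * k) * r powr \<rho>)" if r: "r0 \<le> r" for r
  proof (rule tendsto_upperbound)
    show "(\<lambda>i. cmod (\<phi> r - \<phi> (real i))) \<longlonglongrightarrow> cmod (\<phi> r - a)" by (intro tendsto_intros a)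
    have "\<forall>\<^sub>F i in sequentially. r < real i"
      using filterlim_real_sequentially eventually_gt_at_top filterlim_iff by fast
    thus "\<forall>\<^sub>F i in sequentially. cmod (\<phi> r - \<phi> (real i)) \<le> exp (- (3/2 * k) * r powr \<rho>)"
      by eventually_elim (subst norm_minus_commute, rule incr[OF r])
  qed simp
  obtain h where h: "h holomorphic_on UNIV" "\<exists>z. h z \<noteq> 0"
    "\<And>z. poly P z * deriv (deriv h) z - poly (pderiv P) z * deriv h z + poly R z * h z = 0"
    "\<And>z. z \<notin> range t \<Longrightarrow> h z = g z * (F z - a)"
    by (rule second_solution[OF sr F F_loc]) (assumption, (rule that; assumption))
  have solh: "I.solution h" unfolding I.solution_def using h by blast
  obtain \<gamma> where \<gamma>: "\<gamma> ^ I.n * I.K = 1" "I.dominant_on h (Arg \<gamma>)"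
    using I.proximity_asymp[OF solh] by metis
  \<comment> \<open>For n = 1 the equation \<beta> K = 1 has one solution, so \<open>h\<close> would
    have to dominate on the very ray where it decays.\<close>
  have "\<gamma> = \<beta>" using \<beta>(1) \<gamma>(1) I.K_nz unfolding n1 by (metis mult_right_cancel power_one_right)
  hence lim_h: "((\<lambda>r. ln (cmod (h (z r))) / r powr \<rho>) \<longlongrightarrow> k) at_top" using dom[of h] \<gamma>(2) by simp
  have "\<forall>\<^sub>F r in at_top. ln (cmod (h (z r))) / r powr \<rho> \<le> 0"
    using eventually_ge_at_top[of r0]
  proof eventually_elim
    case (elim r)
    have "z r \<notin> range t" using est(1)[OF elim] g_zero by blast
    hence "cmod (h (z r)) = cmod (g (z r)) * cmod (\<phi> r - a)" by (simp add: h(4) norm_mult \<phi>_def)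
    also have "\<dots> \<le> exp (11/10 * k * r powr \<rho>) * exp (- (3/2 * k) * r powr \<rho>)"
      by (intro mult_mono est(2)[OF elim] close[OF elim]) auto
    also have "\<dots> = exp (- (4/10 * k * r powr \<rho>))" by (simp flip: exp_add)
    also have "\<dots> \<le> 1" using k by simp
    finally have "ln (cmod (h (z r))) \<le> 0" by (cases "h (z r) = 0") auto
    thus ?case by (simp add: divide_nonpos_nonneg)
  qed
  from tendsto_upperbound[OF lim_h this] show False using k by simp
qed

end

section \<open>Order and type\<close>

context square_rep
begin

text \<open>Finite order bounds the characteristic by a power for large \<open>r\<close>; on the
  remaining bounded range of radii \<open>g\<close> is bounded.\<close>

lemma proximity_power_bound:
  assumes "mero_order f < \<infinity>"
  obtains C N where "\<And>r. 1 \<le> r \<Longrightarrow> proximity_integral g r \<le> C * r ^ N"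
proof -
  obtain CT r0 where CT: "1 \<le> r0" "0 \<le> CT"
    "\<And>r. r0 \<le> r \<Longrightarrow> \<bar>nevanlinna_T f r - proximity_integral g r / pi\<bar> \<le> CT * (1 + ln r)"
    using nevanlinna_T_approx by metis
  obtain L :: ereal where L: "mero_order f < L" "L < \<infinity>" using assms dense by blast
  have "\<forall>\<^sub>F r in at_top. ereal (ln (nevanlinna_T f r) / ln r) < L"
    using L(1) unfolding mero_order_def by (rule Limsup_lessD)
  then obtain r1 where r1: "\<And>r. r1 \<le> r \<Longrightarrow> ereal (ln (nevanlinna_T f r) / ln r) < L"
    unfolding eventually_at_top_linorder by blast
  obtain N :: nat where N: "L \<le> ereal (real N)"
  proof -
    obtain y where "L \<le> ereal y" using L(2) by (cases L) auto
    moreover obtain N :: nat where "y \<le> real N" using real_arch_simple by blast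
    ultimately show ?thesis using that[of N] order_trans by fastforce
  qed
  define r2 where "r2 = max r0 (max r1 2)"
  have large: "proximity_integral g r \<le> pi * (1 + CT) * r ^ (N + 1)" if r: "r2 \<le> r" for r
  proof -
    have rr: "r0 \<le> r" "r1 \<le> r" "2 \<le> r" using r by (auto simp: r2_def)
    define T where "T = nevanlinna_T f r"
    have lr: "0 < ln r" using rr by simp
    have "T \<le> r ^ N"
    proof (cases "0 < T")
      case True
      have "ereal (ln T / ln r) < ereal (real N)" using r1[OF rr(2)] N unfolding T_def by (rule less_le_trans)
      hence "ln T < real N * ln r" using lr by (simp add: pos_divide_less_eq)
      hence "ln T \<le> ln (r ^ N)" using rr by (simp add: ln_realpow)
      thus ?thesis using True rr by (subst (asm) ln_le_cancel_iff) auto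
    next
      case False
      thus ?thesis using rr by (smt (verit) zero_le_power)
    qed
    also have "r ^ N \<le> r ^ (N + 1)" using rr by (intro power_increasing) auto
    finally have T: "T \<le> r ^ (N + 1)" .
    have "1 + ln r \<le> r" using ln_le_minus_one[of r] rr by linarith
    also have "r \<le> r ^ (N + 1)" using rr by (intro self_le_power) auto
    finally have "CT * (1 + ln r) \<le> CT * r ^ (N + 1)" using CT(2) by (intro mult_left_mono)
    hence "proximity_integral g r / pi \<le> (1 + CT) * r ^ (N + 1)"
      using CT(3)[OF rr(1)] T unfolding T_def distrib_right mult_1 by linarith
    thus ?thesis by (simp add: pos_divide_le_eq mult_ac)
  qed
  have "continuous_on (cball 0 r2) g" using g_hol holomorphic_on_imp_continuous_on continuous_on_subset by blast
  hence "bounded (g ` cball 0 r2)" by (intro compact_imp_bounded compact_continuous_image) auto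
  then obtain B where B: "\<And>z. z \<in> cball 0 r2 \<Longrightarrow> cmod (g z) \<le> B" unfolding bounded_iff by blast
  have small: "proximity_integral g r \<le> 2 * pi * ln (max 1 B)" if r: "1 \<le> r" "r \<le> r2" for r
  proof -
    have "proximity_integral g r \<le> integral {0..2*pi} (\<lambda>_. ln (max 1 B))"
      unfolding proximity_integral_def
    proof (intro integral_le ln_max_one_integrable g_hol integrable_const_ivl)
      fix \<theta>
      have "cmod (g (of_real r * cis \<theta>)) \<le> B" using r by (intro B) (simp add: norm_mult)
      thus "ln (max 1 (cmod (g (of_real r * cis \<theta>)))) \<le> ln (max 1 B)" by (intro ln_mono) auto
    qed
    thus ?thesis by simp
  qed
  define C where "C = pi * (1 + CT) + 2 * pi * ln (max 1 B)"
  have C: "pi * (1 + CT) \<le> C" "2 * pi * ln (max 1 B) \<le> C" "0 \<le> C"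
    using CT(2) by (auto simp: C_def)
  show ?thesis
  proof (rule that[of C "N + 1"])
    fix r :: real assume r: "1 \<le> r"
    have rN: "1 \<le> r ^ (N + 1)" using r by (intro one_le_power)
    show "proximity_integral g r \<le> C * r ^ (N + 1)"
    proof (cases "r2 \<le> r")
      case True
      have "pi * (1 + CT) * r ^ (N + 1) \<le> C * r ^ (N + 1)" using C rN by (intro mult_right_mono) auto
      thus ?thesis using large[OF True] by linarith
    next
      case False
      have "C * 1 \<le> C * r ^ (N + 1)" using C rN by (intro mult_left_mono) auto
      thus ?thesis using small[of r] r False C by linarith
    qed
  qed
qed

text \<open>The logarithmic error of \<open>nevanlinna_T_approx\<close> is negligible against r^a.
  The limits differ by a factor 2 because \<open>f\<close> contains the square of
  \<open>g\<close>.\<close>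

lemma nevanlinna_T_asymp:
  assumes "((\<lambda>r. proximity_integral g r / r powr a) \<longlongrightarrow> \<tau>) at_top" "0 < a"
  shows "((\<lambda>r. nevanlinna_T f r / r powr a) \<longlongrightarrow> \<tau> / pi) at_top"
    and "((\<lambda>r. nevanlinna_T g r / r powr a) \<longlongrightarrow> \<tau> / (2 * pi)) at_top"
proof -
  obtain C r0 where C: "1 \<le> r0" "0 \<le> C"
    "\<And>r. r0 \<le> r \<Longrightarrow> \<bar>nevanlinna_T f r - proximity_integral g r / pi\<bar> \<le> C * (1 + ln r)"
    using nevanlinna_T_approx by metis
  have "((\<lambda>r. (nevanlinna_T f r - proximity_integral g r / pi) / r powr a) \<longlongrightarrow> 0) at_top"
  proof (rule tendsto_rabs_zero_cancel, rule tendsto_sandwich[where f = "\<lambda>_. 0"])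
    show "((\<lambda>r. C * ((1 + ln r) / r powr a)) \<longlongrightarrow> 0) at_top"
      using tendsto_mult_left[OF one_plus_ln_over_powr[OF assms(2)], of C] by simp
    show "\<forall>\<^sub>F r in at_top. \<bar>(nevanlinna_T f r - proximity_integral g r / pi) / r powr a\<bar> \<le> C * ((1 + ln r) / r powr a)"
      using eventually_ge_at_top[of r0]
    proof eventually_elim
      case (elim r)
      show ?case using divide_right_mono[OF C(3)[OF elim], of "r powr a"] by simp
    qed
  qed auto
  from tendsto_add[OF this tendsto_divide[OF assms(1) tendsto_const[of pi]]]
  show "((\<lambda>r. nevanlinna_T f r / r powr a) \<longlongrightarrow> \<tau> / pi) at_top"
    by (simp add: diff_divide_distrib divide_divide_eq_left mult.commute)
  show "((\<lambda>r. nevanlinna_T g r / r powr a) \<longlongrightarrow> \<tau> / (2 * pi)) at_top"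
    using tendsto_divide[OF assms(1) tendsto_const[of "2 * pi"]]
    by (simp add: nevanlinna_T_entire divide_divide_eq_left mult.commute)
qed

end

lemma (in double_pole_series) finite_order_structure:
  assumes rep: "square_representation f g P Q" and ord: "mero_order f < \<infinity>"
  obtains R where "Q = poly R" "poly_ode_irregular P R" "degree P \<le> degree R"
proof -
  interpret S: square_rep f g P Q by (rule square_rep.intro[OF rep])
  obtain w where w: "g w \<noteq> 0" using S.g_nonzero by blast
  obtain C N where CN: "\<And>r. 1 \<le> r \<Longrightarrow> proximity_integral g r \<le> C * r ^ N"
    using S.proximity_power_bound[OF ord] by blast
  obtain R where R: "Q = poly R"
    using ode_coefficient_is_poly[OF S.g_hol w S.simple CN S.Q_hol S.ode] by blast
  have g_zero: "{z. g z = 0} = range t" using S.pole_iff pole_iff by blast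
  interpret O: poly_ode P R by (rule poly_ode.intro[OF S.P_nz])
  have sol: "O.solution g" unfolding O.solution_def using S.g_hol S.g_nonzero S.ode R by blast
  have not_reg: "\<not> (R = 0 \<or> degree R + 2 \<le> degree P)"
  proof
    assume "R = 0 \<or> degree R + 2 \<le> degree P"
    then obtain p where p: "g = poly p" using O.regular_singular_imp_poly[OF _ sol] by blast
    have "p \<noteq> 0" using w p by auto
    hence "finite {z. g z = 0}" unfolding p by (rule poly_roots_finite)
    thus False using infinite_poles g_zero by simp
  qed
  have irr: "poly_ode_irregular P R"
    using not_reg by unfold_locales auto
  have "degree P \<noteq> degree R + 1"
    by (rule degree_P_neq_Suc_degree_R[OF _ irr]) (use rep R in \<open>auto intro: square_rep.intro\<close>)
  hence "degree P \<le> degree R" using not_reg by linarith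
  thus ?thesis using R irr that by blast
qed

theorem theorem2p3:
  fixes c t :: "nat \<Rightarrow> complex" and f :: "complex \<Rightarrow> complex"
  assumes c_nz: "\<And>n. c n \<noteq> 0"
    and t_distinct: "inj t"
    and t_lim: "filterlim (\<lambda>n. norm (t n)) at_top sequentially"
    and summ: "summable (\<lambda>n. if t n = 0 then 0 else norm (c n) / (norm (t n))\<^sup>2)"
    and f_def: "\<And>z. z \<notin> range t \<Longrightarrow> f z = (\<Sum>n. c n / (z - t n)\<^sup>2)"
    and fin_zeros: "finite {z. \<not> is_pole f z \<and> f z = 0}"
  shows "(\<exists>g P Q. square_representation f g P Q) \<and>
    (\<forall>g P Q. square_representation f g P Q \<and> mero_order f < \<infinity> \<longrightarrow>
      (\<exists>R :: complex poly. \<exists>\<rho> :: real.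
        Q = poly R \<and> R \<noteq> 0 \<and> degree P \<le> degree R \<and>
        \<rho> = (real (degree R) - real (degree P) + 2) / 2 \<and>
        \<rho> \<in> {real k / 2 | k :: nat. 2 \<le> k} \<and>
        mero_order f = ereal \<rho> \<and> mero_lower_order f = ereal \<rho> \<and>
        mero_order g = ereal \<rho> \<and> mero_lower_order g = ereal \<rho> \<and>
        0 < mero_lower_type \<rho> f \<and> mero_lower_type \<rho> f = mero_type \<rho> f \<and> mero_type \<rho> f < \<infinity> \<and>
        0 < entire_lower_type \<rho> g \<and> entire_lower_type \<rho> g = entire_type \<rho> g \<and>
        entire_type \<rho> g < \<infinity> \<and>
        (\<forall>(n :: nat) (p :: nat \<Rightarrow> complex) (\<alpha> :: nat \<Rightarrow> nat).
          inj_on p {1..n} \<and> (\<forall>j\<in>{1..n}. 0 < \<alpha> j) \<and>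
          P = (\<Prod>j=1..n. [:- p j, 1:] ^ \<alpha> j) \<longrightarrow>
          (\<exists>S :: complex poly. \<forall>z. z \<notin> p ` {1..n} \<longrightarrow>
            poly R z / poly P z = poly S z +
              (\<Sum>j=1..n. of_nat (\<alpha> j) * (deriv g (p j) / g (p j)) * (1 / (z - p j)))))))"
proof (intro conjI allI impI, goal_cases)
  interpret D: double_pole_series c t f by unfold_locales (fact assms)+
  case 1
  show ?case using D.square_representation_exists[OF fin_zeros] by blast
next
  interpret D: double_pole_series c t f by unfold_locales (fact assms)+
  case (2 g P Q)
  hence rep: "square_representation f g P Q" and ord: "mero_order f < \<infinity>" by auto
  obtain R where R: "Q = poly R" and irr: "poly_ode_irregular P R" and deg: "degree P \<le> degree R"
    using D.finite_order_structure[OF rep ord] by blast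
  interpret S: square_rep f g P Q by (rule square_rep.intro[OF rep])
  interpret I: poly_ode_irregular P R by (rule irr)
  have sol: "I.solution g" unfolding I.solution_def using S.g_hol S.g_nonzero S.ode R by blast
  obtain \<tau> where \<tau>: "0 < \<tau>" "((\<lambda>r. proximity_integral g r / r powr I.\<rho>) \<longlongrightarrow> \<tau>) at_top"
    "\<exists>\<beta>. \<beta> ^ I.n * I.K = 1 \<and> I.dominant_on g (Arg \<beta>)"
    using I.proximity_asymp[OF sol] by blast
  have M: "((\<lambda>r. ln (max_modulus g r) / r powr I.\<rho>) \<longlongrightarrow> sqrt (cmod I.K)) at_top"
    using \<tau>(3) I.max_modulus_asymp[OF sol] by blast
  note T = S.nevanlinna_T_asymp[OF \<tau>(2) I.\<rho>_pos]
  have ord_f: "((\<lambda>r. ereal (ln (nevanlinna_T f r) / ln r)) \<longlongrightarrow> ereal I.\<rho>) at_top"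
    by (rule order_of_powr_asymp[OF T(1) _ I.\<rho>_pos]) (use \<tau>(1) in simp)
  have ord_g: "((\<lambda>r. ereal (ln (nevanlinna_T g r) / ln r)) \<longlongrightarrow> ereal I.\<rho>) at_top"
    by (rule order_of_powr_asymp[OF T(2) _ I.\<rho>_pos]) (use \<tau>(1) in simp)
  have type_f: "((\<lambda>r. ereal (nevanlinna_T f r / r powr I.\<rho>)) \<longlongrightarrow> ereal (\<tau> / pi)) at_top"
    using T(1) by simp
  have type_g: "((\<lambda>r. ereal (ln (max_modulus g r) / r powr I.\<rho>)) \<longlongrightarrow> ereal (sqrt (cmod I.K))) at_top"
    using M by simp
  have nt: "\<not> trivial_limit (at_top :: real filter)" by simp
  \<comment> \<open>Each quotient converges, so its limsup and liminf coincide.\<close>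
  have lims: "mero_order f = ereal I.\<rho>" "mero_lower_order f = ereal I.\<rho>"
    "mero_order g = ereal I.\<rho>" "mero_lower_order g = ereal I.\<rho>"
    "mero_type I.\<rho> f = ereal (\<tau> / pi)" "mero_lower_type I.\<rho> f = ereal (\<tau> / pi)"
    "entire_type I.\<rho> g = ereal (sqrt (cmod I.K))" "entire_lower_type I.\<rho> g = ereal (sqrt (cmod I.K))"
    unfolding mero_order_def mero_lower_order_def mero_type_def mero_lower_type_def
      entire_type_def entire_lower_type_def
    by (intro lim_imp_Limsup[OF nt] lim_imp_Liminf[OF nt] ord_f ord_g type_f type_g)+
  have \<rho>_eq: "I.\<rho> = (real (degree R) - real (degree P) + 2) / 2"
    using deg by (simp add: I.\<rho>_def I.n_def of_nat_diff)
  \<comment> \<open>deg P \<le> deg R makes the natural number deg R + 2 - deg P at least 2.\<close>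
  have \<rho>_half: "I.\<rho> \<in> {real k / 2 | k :: nat. 2 \<le> k}"
    unfolding I.\<rho>_def using deg by (auto simp: I.n_def intro!: exI[of _ "degree R + 2 - degree P"])
  have pf: "\<exists>S :: complex poly. \<forall>z. z \<notin> p ` {1..n} \<longrightarrow>
            poly R z / poly P z = poly S z +
              (\<Sum>j=1..n. of_nat (\<alpha> j) * (deriv g (p j) / g (p j)) * (1 / (z - p j)))"
    if "inj_on p {1..n} \<and> (\<forall>j\<in>{1..n}. 0 < \<alpha> j) \<and> P = (\<Prod>j=1..n. [:- p j, 1:] ^ \<alpha> j)"
    for n and p :: "nat \<Rightarrow> complex" and \<alpha> :: "nat \<Rightarrow> nat"
    by (rule S.partial_fractions[OF R]) (use that in auto)
  show ?case
    by (rule exI[of _ R], rule exI[of _ I.\<rho>])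
       (use R I.R_nz deg \<rho>_eq \<rho>_half lims \<tau>(1) I.K_nz pf in \<open>simp add: lims del: mult_1_right\<close>)
qed

end
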